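(* On $S^2$, consider the quadratic rational maps $$f_t(z)=\frac{z(z-1)}{2(z-1)+t},\qquad 0<t<1.$$ With the standard conformal structure, their optimal constants satisfy $A_{f_t}\to\infty$ as $t\downarrow0$. In particular, no bound for the prefactor in the correlation inequality can depend only on the dimension $n$, the maximal dilatation $K$ and the degree $d$: there is no function $C(n,K,d)<\infty$ such that $$\left|\int_M\varphi\,(\psi\circ f^k)\,\mathrm d\mu_f-\mu_f(\varphi)\mu_f(\psi)\right|\le C(n,K,d)\,d^{-k/n}E(\varphi)\|\psi\|_{L^\infty(\mu_f)}$$ for all $k\ge0$, all $\varphi\in C(M)\cap W^{1,n}(M)$, all $\psi\in L^\infty(\mu_f)$, and all uniformly $K$-quasiregular endomorphisms $f$ of degree $d\geq 2$ of closed, connected, oriented Riemannian $n$-manifolds $M$ (with $f$-invariant conformal structures defining $E$).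
   Context: $S^2$ is the Riemann sphere with the spherical metric and $m$ is normalized spherical area. For a rational map $f$ of degree $d\ge2$, the equilibrium measure $\mu_f$ is the weak limit of the probability measures $d^{-k}(f^k)^*m$ (pullback counted with multiplicity). With $E(\varphi)=\left(\int_{S^2}|\mathrm d\varphi|^2\,\mathrm dm\right)^{1/2}$ and $\mathcal D=C(S^2)\cap W^{1,2}(S^2)$ (complex-valued functions), $$A_f=\sup_{\varphi\in\mathcal D,\ E(\varphi)>0}\frac{\|\varphi-\mu_f(\varphi)\|_{L^1(\mu_f)}}{E(\varphi)},\qquad \mu_f(\varphi)=\int\varphi\,\mathrm d\mu_f.$$ General setting for the last assertion: $M$ is a closed, connected, oriented Riemannian $n$-manifold, $n\ge2$, $m=\mathrm{vol}_M/\mathrm{vol}_M(M)$. The maximal dilatation of a quasiregular map $g$ is $K(g)=\max\{K_O(g),K_I(g)\}$, where $K_O,K_I$ are the least constants with $\|Dg\|^n\le K_OJ_g$, $J_g\le K_I\inf_{|v|=1}|Dg\,v|^n$ a.e.; $f$ is uniformly $K$-quasiregular if every iterate $f^k$, $k\ge1$, is quasiregular with $K(f^k)\le K$. $\mu_f$ is the weak limit of $d^{-k}(f^k)^*m$. An $f$-invariant conformal structure $G$ is a measurable, determinant-one, boundedly elliptic field of positive definite symmetric endomorphisms of $TM$ with $(Df^k)^{\mathsf T}(G\circ f^k)Df^k=J_{f^k}^{2/n}G$ a.e. for every $k\ge1$, and $E(\varphi)=\left(\int_M|\mathrm d\varphi|_G^n\,\mathrm dm\right)^{1/n}$, where $|\cdot|_G$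 is the covector norm dual to $\langle Gv,w\rangle$. For rational maps (uniformly $1$-quasiregular, $n=2$) the standard structure $G=I$ is used. *)

theory Defs
  imports
    "HOL-Probability.Probability_Measure"
    "HOL-Probability.Essential_Supremum"
    "HOL-Computational_Algebra.Polynomial"
    "Jordan_Normal_Form.Determinant"
begin

section \<open>Calculus and Sobolev functions on open subsets of Euclidean n-space\<close>

text \<open>
  The dimension n is a quantified variable of the theorem, so points of n-space are the elements
  of the library space \<^const>\<open>Euclidean_space\<close> n, i.e. functions \<^typ>\<open>nat \<Rightarrow> real\<close> vanishing at
  all indices \<^term>\<open>i \<ge> n\<close>; tangent vectors and matrices are those of Jordan_Normal_Form.
\<close>

type_synonym coords = "nat \<Rightarrow> real"

text \<open>Lebesgue measure of n-space, as a measure on the Borel sets of \<^typ>\<open>nat \<Rightarrow> real\<close>.\<close>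
definition leb :: "nat \<Rightarrow> coords measure" where
  "leb n = distr (\<Pi>\<^sub>M i\<in>{..<n}. lborel) borel (\<lambda>x i. if i < n then x i else 0)"

definition partial :: "nat \<Rightarrow> (coords \<Rightarrow> real) \<Rightarrow> coords \<Rightarrow> real" where
  "partial i h x = deriv (\<lambda>s. h (x(i := s))) (x i)"

primrec C_diff :: "nat \<Rightarrow> nat \<Rightarrow> coords set \<Rightarrow> (coords \<Rightarrow> real) \<Rightarrow> bool" where
  "C_diff n 0 \<Omega> h \<longleftrightarrow> continuous_map (subtopology (Euclidean_space n) \<Omega>) euclideanreal h"
| "C_diff n (Suc k) \<Omega> h \<longleftrightarrow>
     continuous_map (subtopology (Euclidean_space n) \<Omega>) euclideanreal h \<and>
     (\<forall>i<n. (\<forall>x\<in>\<Omega>. (\<lambda>s. h (x(i := s))) differentiable (at (x i))) \<and> C_diff n k \<Omega> (partial i h))"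

definition smooth_on :: "nat \<Rightarrow> coords set \<Rightarrow> (coords \<Rightarrow> real) \<Rightarrow> bool" where
  "smooth_on n \<Omega> h \<longleftrightarrow> (\<forall>k. C_diff n k \<Omega> h)"

definition test_function :: "nat \<Rightarrow> coords set \<Rightarrow> (coords \<Rightarrow> real) \<Rightarrow> bool" where
  "test_function n \<Omega> \<eta> \<longleftrightarrow> smooth_on n (topspace (Euclidean_space n)) \<eta> \<and>
     (\<exists>K. compactin (Euclidean_space n) K \<and> K \<subseteq> \<Omega> \<and> (\<forall>x\<in>topspace (Euclidean_space n) - K. \<eta> x = 0))"

definition loc_integrable ::
    "nat \<Rightarrow> coords set \<Rightarrow> (coords \<Rightarrow> 'b::{banach, second_countable_topology}) \<Rightarrow> bool" where
  "loc_integrable n \<Omega> u \<longleftrightarrow>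
     (\<forall>K. compactin (Euclidean_space n) K \<longrightarrow> K \<subseteq> \<Omega> \<longrightarrow> set_integrable (leb n) K u)"

definition weak_partial ::
    "nat \<Rightarrow> coords set \<Rightarrow> nat \<Rightarrow> (coords \<Rightarrow> 'b::{banach, second_countable_topology}) \<Rightarrow> (coords \<Rightarrow> 'b) \<Rightarrow> bool"
  where
  "weak_partial n \<Omega> i u v \<longleftrightarrow> loc_integrable n \<Omega> u \<and> loc_integrable n \<Omega> v \<and>
     (\<forall>\<eta>. test_function n \<Omega> \<eta> \<longrightarrow>
        (LINT x:\<Omega>|leb n. partial i \<eta> x *\<^sub>R u x) = - (LINT x:\<Omega>|leb n. \<eta> x *\<^sub>R v x))"


section \<open>Closed connected oriented Riemannian manifolds\<close>

text \<open>
  A closed manifold is presented by a finite smooth oriented atlas (its smooth structure is the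
  maximal atlas this one generates): the charts are \<open>coord M i\<close> on the open set \<open>dom M i\<close>, for
  \<open>i < nch M\<close>. The metric is given by its Gram matrix \<open>gram M i x\<close> in each chart. The topology is
  abstract: any type with continuum many elements carries a copy of every such manifold.
\<close>

record 'a riem =
  mtop :: "'a topology"
  mdim :: nat
  nch :: nat
  dom :: "nat \<Rightarrow> 'a set"
  coord :: "nat \<Rightarrow> 'a \<Rightarrow> coords"
  gram :: "nat \<Rightarrow> 'a \<Rightarrow> real mat"

definition param :: "'a riem \<Rightarrow> nat \<Rightarrow> coords \<Rightarrow> 'a" where
  "param M i = inv_into (dom M i) (coord M i)"

definition transition_jac :: "'a riem \<Rightarrow> nat \<Rightarrow> nat \<Rightarrow> 'a \<Rightarrow> real mat" where
  "transition_jac M i j x = Matrix.mat (mdim M) (mdim M)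
     (\<lambda>(a, b). partial b (\<lambda>y. coord M j (param M i y) a) (coord M i x))"

definition closed_connected_oriented_riemannian :: "'a riem \<Rightarrow> bool" where
  "closed_connected_oriented_riemannian M \<longleftrightarrow>
     topspace (mtop M) \<noteq> {} \<and> compact_space (mtop M) \<and> connected_space (mtop M) \<and>
     Hausdorff_space (mtop M) \<and> topspace (mtop M) = (\<Union>i<nch M. dom M i) \<and>
     (\<forall>i<nch M. openin (mtop M) (dom M i) \<and>
        openin (Euclidean_space (mdim M)) (coord M i ` dom M i) \<and>
        homeomorphic_map (subtopology (mtop M) (dom M i))
          (subtopology (Euclidean_space (mdim M)) (coord M i ` dom M i)) (coord M i)) \<and>
     (\<forall>i<nch M. \<forall>j<nch M.
        (\<forall>a<mdim M. smooth_on (mdim M) (coord M i ` (dom M i \<inter> dom M j))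
           (\<lambda>y. coord M j (param M i y) a)) \<and>
        (\<forall>x\<in>dom M i \<inter> dom M j. 0 < Determinant.det (transition_jac M i j x) \<and>
           gram M i x = transpose_mat (transition_jac M i j x) * gram M j x * transition_jac M i j x)) \<and>
     (\<forall>i<nch M.
        (\<forall>x\<in>dom M i. gram M i x \<in> carrier_mat (mdim M) (mdim M) \<and>
           transpose_mat (gram M i x) = gram M i x \<and>
           (\<forall>v\<in>carrier_vec (mdim M). v \<noteq> 0\<^sub>v (mdim M) \<longrightarrow> 0 < scalar_prod v (gram M i x *\<^sub>v v))) \<and>
        (\<forall>a<mdim M. \<forall>b<mdim M.
           smooth_on (mdim M) (coord M i ` dom M i) (\<lambda>y. gram M i (param M i y) $$ (a, b))))"

text \<open>
  The tangent space at x is identified with n-space through the coordinate frame of the first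
  chart whose domain contains x. All tangent vectors, covectors and endomorphisms at x below are
  written in this frame, which depends on x in a Borel measurable way.
\<close>

definition chart_at :: "'a riem \<Rightarrow> 'a \<Rightarrow> nat" where
  "chart_at M x = (LEAST i. i < nch M \<and> x \<in> dom M i)"

definition gram_at :: "'a riem \<Rightarrow> 'a \<Rightarrow> real mat" where
  "gram_at M x = gram M (chart_at M x) x"

definition ginner :: "'a riem \<Rightarrow> 'a \<Rightarrow> real vec \<Rightarrow> real vec \<Rightarrow> real" where
  "ginner M x v w = scalar_prod v (gram_at M x *\<^sub>v w)"

definition gnorm :: "'a riem \<Rightarrow> 'a \<Rightarrow> real vec \<Rightarrow> real" where
  "gnorm M x v = sqrt (ginner M x v v)"

definition borel_of :: "'a topology \<Rightarrow> 'a measure" where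
  "borel_of X = sigma (topspace X) {U. openin X U}"

definition vol :: "'a riem \<Rightarrow> 'a measure" where
  "vol M = measure_of (topspace (mtop M)) {U. openin (mtop M) U}
     (\<lambda>A. \<Sum>i<nch M. \<integral>\<^sup>+ y \<in> coord M i ` {x \<in> A. chart_at M x = i}.
        ennreal (sqrt (Determinant.det (gram M i (param M i y)))) \<partial>leb (mdim M))"

definition normalized_vol :: "'a riem \<Rightarrow> 'a measure" where
  "normalized_vol M = uniform_measure (vol M) (topspace (mtop M))"


section \<open>Quasiregular maps\<close>

text \<open>
  \<open>F i j\<close> is the weak differential of f read in chart i of the domain and chart j of the target,
  required to be locally n-integrable: f is a \<open>W\<^sup>1\<^sup>,\<^sup>n\<close> map, locally.
\<close>
definition weak_tangent :: "'a riem \<Rightarrow> ('a \<Rightarrow> 'a) \<Rightarrow> (nat \<Rightarrow> nat \<Rightarrow> 'a \<Rightarrow> real mat) \<Rightarrow> bool" where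
  "weak_tangent M f F \<longleftrightarrow>
     (\<forall>i j x. F i j x \<in> carrier_mat (mdim M) (mdim M)) \<and>
     (\<forall>i<nch M. \<forall>j<nch M. \<forall>a<mdim M. \<forall>b<mdim M.
        let \<Omega> = coord M i ` {x \<in> dom M i. f x \<in> dom M j} in
          weak_partial (mdim M) \<Omega> b (\<lambda>y. coord M j (f (param M i y)) a)
            (\<lambda>y. F i j (param M i y) $$ (a, b)) \<and>
          loc_integrable (mdim M) \<Omega> (\<lambda>y. \<bar>F i j (param M i y) $$ (a, b)\<bar> ^ mdim M))"

text \<open>Weak differentials are unique almost everywhere, so the choice is immaterial.\<close>
definition tangent_map :: "'a riem \<Rightarrow> ('a \<Rightarrow> 'a) \<Rightarrow> 'a \<Rightarrow> real mat" where
  "tangent_map M f x = (SOME F. weak_tangent M f F) (chart_at M x) (chart_at M (f x)) x"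

definition op_norm :: "'a riem \<Rightarrow> ('a \<Rightarrow> 'a) \<Rightarrow> 'a \<Rightarrow> real" where
  "op_norm M f x = Sup {gnorm M (f x) (tangent_map M f x *\<^sub>v v) | v.
     v \<in> carrier_vec (mdim M) \<and> gnorm M x v = 1}"

definition min_stretch :: "'a riem \<Rightarrow> ('a \<Rightarrow> 'a) \<Rightarrow> 'a \<Rightarrow> real" where
  "min_stretch M f x = Inf {gnorm M (f x) (tangent_map M f x *\<^sub>v v) | v.
     v \<in> carrier_vec (mdim M) \<and> gnorm M x v = 1}"

definition jacobian :: "'a riem \<Rightarrow> ('a \<Rightarrow> 'a) \<Rightarrow> 'a \<Rightarrow> real" where
  "jacobian M f x = Determinant.det (tangent_map M f x) *
     sqrt (Determinant.det (gram_at M (f x))) / sqrt (Determinant.det (gram_at M x))"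

definition outer_dilatation :: "'a riem \<Rightarrow> ('a \<Rightarrow> 'a) \<Rightarrow> ereal" where
  "outer_dilatation M f = Inf {ereal K | K. 0 \<le> K \<and>
     (AE x in vol M. op_norm M f x ^ mdim M \<le> K * jacobian M f x)}"

definition inner_dilatation :: "'a riem \<Rightarrow> ('a \<Rightarrow> 'a) \<Rightarrow> ereal" where
  "inner_dilatation M f = Inf {ereal K | K. 0 \<le> K \<and>
     (AE x in vol M. jacobian M f x \<le> K * min_stretch M f x ^ mdim M)}"

definition max_dilatation :: "'a riem \<Rightarrow> ('a \<Rightarrow> 'a) \<Rightarrow> ereal" where
  "max_dilatation M f = max (outer_dilatation M f) (inner_dilatation M f)"

definition quasiregular :: "'a riem \<Rightarrow> ('a \<Rightarrow> 'a) \<Rightarrow> bool" where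
  "quasiregular M f \<longleftrightarrow> continuous_map (mtop M) (mtop M) f \<and> (\<exists>F. weak_tangent M f F) \<and>
     outer_dilatation M f < \<infinity>"

definition uniformly_quasiregular :: "'a riem \<Rightarrow> real \<Rightarrow> ('a \<Rightarrow> 'a) \<Rightarrow> bool" where
  "uniformly_quasiregular M K f \<longleftrightarrow>
     (\<forall>k\<ge>1. quasiregular M (f ^^ k) \<and> max_dilatation M (f ^^ k) \<le> ereal K)"


section \<open>Degree, pullback of measures and the equilibrium measure\<close>

text \<open>The multiplicity of f at x: the maximal number of preimages near x of a single point.\<close>
definition local_index :: "'a topology \<Rightarrow> ('a \<Rightarrow> 'a) \<Rightarrow> 'a \<Rightarrow> ennreal" where
  "local_index X f x = (INF U\<in>{U. openin X U \<and> x \<in> U}.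
     SUP y\<in>topspace X. emeasure (count_space UNIV) (U \<inter> f -` {y}))"

definition preimage_count :: "'a topology \<Rightarrow> ('a \<Rightarrow> 'a) \<Rightarrow> 'a set \<Rightarrow> 'a \<Rightarrow> ennreal" where
  "preimage_count X f A y = (\<integral>\<^sup>+ x. local_index X f x \<partial>count_space (A \<inter> f -` {y}))"

text \<open>
  Nonconstant quasiregular maps are discrete, open and sense-preserving; their degree is the number
  of preimages, counted with multiplicity, of each point.
\<close>
definition has_degree :: "'a topology \<Rightarrow> ('a \<Rightarrow> 'a) \<Rightarrow> nat \<Rightarrow> bool" where
  "has_degree X f d \<longleftrightarrow> (\<forall>y\<in>topspace X. preimage_count X f (topspace X) y = of_nat d)"

definition pullback_measure :: "'a topology \<Rightarrow> ('a \<Rightarrow> 'a) \<Rightarrow> 'a measure \<Rightarrow> 'a measure" where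
  "pullback_measure X f \<nu> = measure_of (topspace X) {U. openin X U}
     (\<lambda>A. \<integral>\<^sup>+ y. preimage_count X f A y \<partial>\<nu>)"

definition weak_limit :: "'a topology \<Rightarrow> (nat \<Rightarrow> 'a measure) \<Rightarrow> 'a measure \<Rightarrow> bool" where
  "weak_limit X \<nu> \<mu> \<longleftrightarrow> (\<forall>\<phi>::'a \<Rightarrow> real. continuous_map X euclideanreal \<phi> \<longrightarrow>
     (\<lambda>k. LINT x|\<nu> k. \<phi> x) \<longlonglongrightarrow> (LINT x|\<mu>. \<phi> x))"

definition is_equilibrium_measure :: "'a riem \<Rightarrow> nat \<Rightarrow> ('a \<Rightarrow> 'a) \<Rightarrow> 'a measure \<Rightarrow> bool" where
  "is_equilibrium_measure M d f \<mu> \<longleftrightarrow>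
     prob_space \<mu> \<and> sets \<mu> = sets (borel_of (mtop M)) \<and>
     weak_limit (mtop M)
       (\<lambda>k. scale_measure (1 / of_nat d ^ k) (pullback_measure (mtop M) (f ^^ k) (normalized_vol M))) \<mu>"

definition equilibrium_measure :: "'a riem \<Rightarrow> nat \<Rightarrow> ('a \<Rightarrow> 'a) \<Rightarrow> 'a measure" where
  "equilibrium_measure M d f = (THE \<mu>. is_equilibrium_measure M d f \<mu>)"


section \<open>Conformal structures and the energy\<close>

definition conformal_structure :: "'a riem \<Rightarrow> ('a \<Rightarrow> real mat) \<Rightarrow> bool" where
  "conformal_structure M G \<longleftrightarrow>
     (\<forall>x\<in>topspace (mtop M). G x \<in> carrier_mat (mdim M) (mdim M)) \<and>
     (\<forall>a<mdim M. \<forall>b<mdim M. (\<lambda>x. G x $$ (a, b)) \<in> borel_measurable (borel_of (mtop M))) \<and>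
     (AE x in vol M. Determinant.det (G x) = 1 \<and>
        (\<forall>v\<in>carrier_vec (mdim M). \<forall>w\<in>carrier_vec (mdim M).
           ginner M x (G x *\<^sub>v v) w = ginner M x v (G x *\<^sub>v w)) \<and>
        (\<forall>v\<in>carrier_vec (mdim M). v \<noteq> 0\<^sub>v (mdim M) \<longrightarrow> 0 < ginner M x (G x *\<^sub>v v) v)) \<and>
     (\<exists>L\<ge>1. AE x in vol M. \<forall>v\<in>carrier_vec (mdim M).
        ginner M x v v / L \<le> ginner M x (G x *\<^sub>v v) v \<and>
        ginner M x (G x *\<^sub>v v) v \<le> L * ginner M x v v)"

text \<open>
  The transpose in the invariance equation is the adjoint with respect to the Riemannian metric;
  the equation is stated after pairing both sides with v and w.
\<close>
definition invariant_structure :: "'a riem \<Rightarrow> ('a \<Rightarrow> 'a) \<Rightarrow> ('a \<Rightarrow> real mat) \<Rightarrow> bool" where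
  "invariant_structure M f G \<longleftrightarrow>
     (\<forall>k\<ge>1. AE x in vol M. \<forall>v\<in>carrier_vec (mdim M). \<forall>w\<in>carrier_vec (mdim M).
        ginner M ((f ^^ k) x) (G ((f ^^ k) x) *\<^sub>v (tangent_map M (f ^^ k) x *\<^sub>v v))
            (tangent_map M (f ^^ k) x *\<^sub>v w)
          = jacobian M (f ^^ k) x powr (2 / real (mdim M)) * ginner M x (G x *\<^sub>v v) w)"

definition standard_structure :: "'a riem \<Rightarrow> 'a \<Rightarrow> real mat" where
  "standard_structure M x = 1\<^sub>m (mdim M)"

text \<open>\<open>w i\<close> consists of the weak partial derivatives of the function in chart i.\<close>
definition weak_differential :: "'a riem \<Rightarrow> ('a \<Rightarrow> complex) \<Rightarrow> (nat \<Rightarrow> 'a \<Rightarrow> complex vec) \<Rightarrow> bool" where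
  "weak_differential M \<phi> w \<longleftrightarrow> (\<forall>i x. w i x \<in> carrier_vec (mdim M)) \<and>
     (\<forall>i<nch M. \<forall>a<mdim M. weak_partial (mdim M) (coord M i ` dom M i) a
        (\<lambda>y. \<phi> (param M i y)) (\<lambda>y. vec_index (w i (param M i y)) a))"

definition differential :: "'a riem \<Rightarrow> ('a \<Rightarrow> complex) \<Rightarrow> 'a \<Rightarrow> complex vec" where
  "differential M \<phi> x = (SOME w. weak_differential M \<phi> w) (chart_at M x) x"

definition conorm :: "'a riem \<Rightarrow> ('a \<Rightarrow> real mat) \<Rightarrow> 'a \<Rightarrow> real vec \<Rightarrow> real" where
  "conorm M G x \<xi> = Sup {scalar_prod \<xi> v | v. v \<in> carrier_vec (mdim M) \<and> ginner M x (G x *\<^sub>v v) v \<le> 1}"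

text \<open>Complex covectors carry the Hermitian extension of the Euclidean norm \<^const>\<open>conorm\<close>.\<close>
definition conorm_complex :: "'a riem \<Rightarrow> ('a \<Rightarrow> real mat) \<Rightarrow> 'a \<Rightarrow> complex vec \<Rightarrow> real" where
  "conorm_complex M G x \<xi> =
     sqrt ((conorm M G x (map_vec Re \<xi>))\<^sup>2 + (conorm M G x (map_vec Im \<xi>))\<^sup>2)"

definition energy :: "'a riem \<Rightarrow> ('a \<Rightarrow> real mat) \<Rightarrow> ('a \<Rightarrow> complex) \<Rightarrow> real" where
  "energy M G \<phi> = root (mdim M)
     (LINT x|normalized_vol M. conorm_complex M G x (differential M \<phi> x) ^ mdim M)"

definition sobolev_W1n :: "'a riem \<Rightarrow> ('a \<Rightarrow> complex) set" where
  "sobolev_W1n M = {\<phi>. \<phi> \<in> borel_measurable (borel_of (mtop M)) \<and>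
     (\<exists>w. weak_differential M \<phi> w) \<and>
     integrable (normalized_vol M) (\<lambda>x. cmod (\<phi> x) ^ mdim M) \<and>
     integrable (normalized_vol M)
       (\<lambda>x. conorm_complex M (standard_structure M) x (differential M \<phi> x) ^ mdim M)}"

definition continuous_sobolev :: "'a riem \<Rightarrow> ('a \<Rightarrow> complex) set" where
  "continuous_sobolev M = {\<phi>. continuous_map (mtop M) euclidean \<phi>} \<inter> sobolev_W1n M"

definition Linf_norm :: "'a measure \<Rightarrow> ('a \<Rightarrow> complex) \<Rightarrow> real" where
  "Linf_norm \<mu> \<psi> = real_of_ereal (esssup \<mu> (\<lambda>x. ereal (cmod (\<psi> x))))"

definition Linf :: "'a measure \<Rightarrow> ('a \<Rightarrow> complex) set" where
  "Linf \<mu> = {\<psi>. \<psi> \<in> borel_measurable \<mu> \<and> esssup \<mu> (\<lambda>x. ereal (cmod (\<psi> x))) < \<infinity>}"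


section \<open>Rational maps of the Riemann sphere\<close>

text \<open>Chart 0 is z, chart 1 is 1/z; in both the spherical metric is \<open>4 |dz|\<^sup>2 / (1 + |z|\<^sup>2)\<^sup>2\<close>.\<close>

definition complex_coords :: "complex \<Rightarrow> coords" where
  "complex_coords z = (\<lambda>a. if a = 0 then Re z else if a = 1 then Im z else 0)"

definition sphere_coord :: "nat \<Rightarrow> complex option \<Rightarrow> complex" where
  "sphere_coord i x = (case x of None \<Rightarrow> 0 | Some z \<Rightarrow> if i = 0 then z else 1 / z)"

definition riemann_sphere :: "complex option riem" where
  "riemann_sphere =
     \<lparr> mtop = Alexandroff_compactification euclidean,
       mdim = 2,
       nch = 2,
       dom = (\<lambda>i. if i = 0 then range Some else UNIV - {Some 0}),
       coord = (\<lambda>i x. complex_coords (sphere_coord i x)),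
       gram = (\<lambda>i x. (4 / (1 + (cmod (sphere_coord i x))\<^sup>2)\<^sup>2) \<cdot>\<^sub>m 1\<^sub>m 2) \<rparr>"

definition rational_degree :: "complex poly \<Rightarrow> complex poly \<Rightarrow> nat" where
  "rational_degree p q = max (degree p) (degree q)"

text \<open>The extension to the sphere of the quotient p/q of coprime polynomials.\<close>
definition rational_map :: "complex poly \<Rightarrow> complex poly \<Rightarrow> complex option \<Rightarrow> complex option" where
  "rational_map p q x = (case x of
     Some z \<Rightarrow> if poly q z = 0 then None else Some (poly p z / poly q z)
   | None \<Rightarrow> (let d = rational_degree p q in
       if coeff q d = 0 then None else Some (coeff p d / coeff q d)))"

definition optimal_const :: "complex poly \<Rightarrow> complex poly \<Rightarrow> ereal" where
  "optimal_const p q =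
     (let M = riemann_sphere;
          \<mu> = equilibrium_measure M (rational_degree p q) (rational_map p q);
          E = energy M (standard_structure M)
      in SUP \<phi>\<in>{\<phi> \<in> continuous_sobolev M. E \<phi> > 0}.
           ereal ((LINT x|\<mu>. cmod (\<phi> x - (LINT y|\<mu>. \<phi> y))) / E \<phi>))"

definition f_num :: "complex poly" where
  "f_num = [:0, 1:] * [:-1, 1:]"

definition f_den :: "real \<Rightarrow> complex poly" where
  "f_den t = 2 * [:-1, 1:] + [:of_real t:]"


section \<open>The correlation inequality\<close>

definition correlation_bound ::
    "'a riem \<Rightarrow> nat \<Rightarrow> ('a \<Rightarrow> 'a) \<Rightarrow> ('a \<Rightarrow> real mat) \<Rightarrow> 'a measure \<Rightarrow> real \<Rightarrow> bool" where
  "correlation_bound M d f G \<mu> C \<longleftrightarrow>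
     (\<forall>k. \<forall>\<phi>\<in>continuous_sobolev M. \<forall>\<psi>\<in>Linf \<mu>.
        cmod ((LINT x|\<mu>. \<phi> x * \<psi> ((f ^^ k) x)) - (LINT x|\<mu>. \<phi> x) * (LINT x|\<mu>. \<psi> x))
          \<le> C * real d powr (- real k / real (mdim M)) * energy M G \<phi> * Linf_norm \<mu> \<psi>)"

end

theory Submission
  imports Defs "HOL-Complex_Analysis.Complex_Analysis" "HOL-Probability.Probability"
begin

text \<open>
  As t tends to 0, the maps f_t degenerate to z/2, because the zero 1 of the numerator collides
  with the pole 1 - t/2. The degree that is lost in the limit is concentrated at the point 1: of
  the two preimages of any point, one lies close to 1 for small t (the two preimages have a fixed
  product of distances to the pole, of size about t/2, see \<open>root_pole_prod\<close>). The equilibrium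
  measure gives equal weight to both preimages, so it puts mass 1/2 on a disc around 1 whose radius
  is of order t, while the other half stays at a definite distance from 1.

  Points have zero capacity for the two-dimensional Dirichlet energy: there are continuous cutoff
  functions that are 1 on a tiny disc around 1, vanish off a fixed disc and have arbitrarily small
  energy E. Once t is small in terms of such a cutoff, the cutoff is, almost everywhere for the
  equilibrium measure, the indicator of a set of mass 1/2. Its mean deviation is therefore 1/2, and
  A_{f_t} is at least 1/(2 E). Likewise the correlation inequality for k = 0, with both functions
  equal to the cutoff, reads 1/4 \<le> C E. All maps f_t are uniformly 1-quasiregular of degree 2
  on the same 2-manifold, so C would be the single number C(2, 1, 2), and letting E tend to 0 is
  absurd (\<open>optimal_const_ge\<close>, \<open>universal_constant_bound\<close>).

  The dynamical part identifies the equilibrium measure explicitly. In the coordinate 1/z the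
  region |z| \<ge> 3/4 is mapped into itself by both inverse branches, which contract there
  (\<open>branch_contracts\<close>). Random backward orbits, with a fair coin choosing the branch in each
  step, converge, and the law of the limit point is the equilibrium measure
  (\<open>is_equilibrium_measure_mu\<close>): away from finitely many critical values, counting preimages
  under the iterates is the same as averaging over coin sequences (\<open>pullback_measure_funpow\<close>).
  The first coin of the sequence decides whether the limit point is near 1.

  The analytic part verifies that the Riemann sphere is a manifold of the required kind, that
  holomorphic maps are uniformly 1-quasiregular and preserve the standard structure, and that the
  energy of a cutoff is its planar Dirichlet integral. Differentials are chosen among all weak
  differentials, so their values are known only up to null sets, and only because weak derivatives
  are unique (\<open>weak_partial_unique\<close>).
\<close>

section \<open>Complex coordinates of the plane\<close>

text \<open>
  Coordinate vectors are functions on all natural numbers; only the first two entries are read.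
\<close>
definition cpoint :: "coords \<Rightarrow> complex" where
  "cpoint y = Complex (y 0) (y 1)"

lemma cpoint_complex_coords [simp]: "cpoint (complex_coords z) = z"
  by (simp add: cpoint_def complex_coords_def)

lemma complex_coords_cpoint: "y \<in> topspace (Euclidean_space 2) \<Longrightarrow> complex_coords (cpoint y) = y"
  by (auto simp: cpoint_def complex_coords_def topspace_Euclidean_space fun_eq_iff)

lemma complex_coords_in_Euclidean [simp]: "complex_coords z \<in> topspace (Euclidean_space 2)"
  by (auto simp: complex_coords_def topspace_Euclidean_space)

lemma inj_complex_coords: "inj complex_coords"
  by (metis cpoint_complex_coords injI)

lemma complex_coords_eq_iff [simp]: "complex_coords z = complex_coords z' \<longleftrightarrow> z = z'"
  using inj_complex_coords by (auto dest: injD)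

lemma complex_coords_image_iff [simp]: "complex_coords z \<in> complex_coords ` A \<longleftrightarrow> z \<in> A"
  by auto

lemma range_complex_coords: "range complex_coords = topspace (Euclidean_space 2)"
proof (intro equalityI subsetI)
  fix y assume "y \<in> topspace (Euclidean_space 2)"
  then show "y \<in> range complex_coords" using complex_coords_cpoint[of y] by (metis rangeI)
qed auto

lemma continuous_on_complex_coords [continuous_intros]: "continuous_on A complex_coords"
proof (rule continuous_on_coordinatewise_then_product)
  fix i show "continuous_on A (\<lambda>z. complex_coords z i)"
    by (cases "i = 0"; cases "i = 1") (auto simp: complex_coords_def intro!: continuous_intros)
qed

lemma continuous_on_cpoint [continuous_intros]: "continuous_on A cpoint"
  unfolding cpoint_def Complex_eq
  by (intro continuous_intros continuous_on_subset[OF continuous_on_product_coordinates]) auto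

lemma homeomorphic_maps_complex_coords:
  "homeomorphic_maps euclidean (Euclidean_space 2) complex_coords cpoint"
  unfolding homeomorphic_maps_def
  by (auto simp: complex_coords_cpoint Euclidean_space_def euclidean_product_topology
      continuous_map_in_subtopology continuous_on_complex_coords
      intro: continuous_map_from_subtopology continuous_on_cpoint)
     (auto simp: complex_coords_def)

lemma homeomorphic_map_complex_coords:
  "homeomorphic_map euclidean (Euclidean_space 2) complex_coords"
  using homeomorphic_maps_complex_coords homeomorphic_maps_map by blast

lemma openin_complex_coords: "openin (Euclidean_space 2) (complex_coords ` U) \<longleftrightarrow> open U"
  using homeomorphic_map_openness[OF homeomorphic_map_complex_coords, of U] by simp

lemma compactin_complex_coords: "compactin (Euclidean_space 2) (complex_coords ` C) \<longleftrightarrow> compact C"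
  using homeomorphic_map_compactness[OF homeomorphic_map_complex_coords, of C] by simp

lemma compactin_Euclidean_2E:
  assumes "compactin (Euclidean_space 2) K"
  obtains C where "compact C" "K = complex_coords ` C"
proof -
  have "K \<subseteq> range complex_coords"
    using assms compactin_subset_topspace range_complex_coords by blast
  then have "K = complex_coords ` (complex_coords -` K)" by auto
  then show ?thesis using that assms compactin_complex_coords by metis
qed

lemma subtopology_complex_coords:
  "homeomorphic_map (top_of_set U) (subtopology (Euclidean_space 2) (complex_coords ` U)) complex_coords"
  by (rule homeomorphic_map_subtopologies_alt[OF homeomorphic_map_complex_coords]) auto

lemma continuous_map_complex_coords:
  "continuous_map (subtopology (Euclidean_space 2) (complex_coords ` U)) X h \<longleftrightarrow>
   continuous_map (top_of_set U) X (\<lambda>z. h (complex_coords z))"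
proof
  assume "continuous_map (subtopology (Euclidean_space 2) (complex_coords ` U)) X h"
  then show "continuous_map (top_of_set U) X (\<lambda>z. h (complex_coords z))"
    using continuous_map_compose[OF homeomorphic_imp_continuous_map[OF subtopology_complex_coords], of U X h]
    by (simp add: o_def)
next
  assume *: "continuous_map (top_of_set U) X (\<lambda>z. h (complex_coords z))"
  have "continuous_map (subtopology (Euclidean_space 2) (complex_coords ` U)) (top_of_set U) cpoint"
    using homeomorphic_maps_complex_coords
    by (auto simp: continuous_map_in_subtopology homeomorphic_maps_def intro: continuous_map_from_subtopology)
  from continuous_map_compose[OF this *]
  show "continuous_map (subtopology (Euclidean_space 2) (complex_coords ` U)) X h"
    by (rule continuous_map_eq) (auto simp: complex_coords_cpoint)
qed

section \<open>Planar Lebesgue measure\<close>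

lemma borel_measurable_complex_coords [measurable]: "complex_coords \<in> borel_measurable borel"
  by (rule borel_measurable_continuous_onI) (rule continuous_on_complex_coords)

lemma borel_measurable_cpoint [measurable]: "cpoint \<in> borel_measurable borel"
  by (rule borel_measurable_continuous_onI) (rule continuous_on_cpoint)

lemma complex_coords_image_borel:
  assumes "A \<in> sets borel" shows "complex_coords ` A \<in> sets borel"
proof -
  have "closed (topspace (Euclidean_space 2))"
    by (rule closedin_Euclidean_imp_closed[of 2]) simp
  moreover have "complex_coords ` A = cpoint -` A \<inter> topspace (Euclidean_space 2)"
  proof (intro equalityI subsetI)
    fix y assume "y \<in> cpoint -` A \<inter> topspace (Euclidean_space 2)"
    then show "y \<in> complex_coords ` A" using complex_coords_cpoint[of y] by (metis IntD1 IntD2 image_eqI vimageD)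
  qed auto
  ultimately show ?thesis
    using measurable_sets[OF borel_measurable_cpoint assms] by (auto simp: borel_closed)
qed

text \<open>
  Both measures give a box the product of its side lengths.
\<close>
lemma lborel_complex_eq_distr_PiM:
  "(lborel :: complex measure) = distr (\<Pi>\<^sub>M i\<in>{..<2::nat}. lborel) borel (\<lambda>x. Complex (x 0) (x 1))"
proof (rule lborel_eqI)
  interpret product_sigma_finite "\<lambda>_::nat. lborel :: real measure" by standard
  fix l u :: complex assume le: "\<And>b. b \<in> Basis \<Longrightarrow> inner l b \<le> inner u b"
  have meas: "(\<lambda>x. Complex (x 0) (x 1)) \<in> measurable (\<Pi>\<^sub>M i\<in>{..<2::nat}. lborel) borel"
    unfolding Complex_eq by measurable
  define lo hi where "lo = (\<lambda>i::nat. if i = 0 then Re l else Im l)"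
    and "hi = (\<lambda>i::nat. if i = 0 then Re u else Im u)"
  have "(\<lambda>x. Complex (x 0) (x 1)) -` box l u \<inter> space (\<Pi>\<^sub>M i\<in>{..<2::nat}. lborel)
      = (\<Pi>\<^sub>E i\<in>{..<2}. {lo i<..<hi i})"
    by (auto simp: space_PiM PiE_iff lo_def hi_def in_box_complex_iff numeral_2_eq_2 lessThan_Suc)
  then have "emeasure (distr (\<Pi>\<^sub>M i\<in>{..<2::nat}. lborel) borel (\<lambda>x. Complex (x 0) (x 1))) (box l u)
      = emeasure (\<Pi>\<^sub>M i\<in>{..<2::nat}. lborel) (\<Pi>\<^sub>E i\<in>{..<2}. {lo i<..<hi i})"
    by (subst emeasure_distr[OF meas]) simp_all
  also have "\<dots> = (\<Prod>i<2. emeasure lborel {lo i<..<hi i})"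
    by (rule emeasure_PiM) auto
  also have "\<dots> = ennreal (Re u - Re l) * ennreal (Im u - Im l)"
    using le[of 1] le[of \<i>]
    by (simp add: lo_def hi_def numeral_2_eq_2 Basis_complex_def inner_complex_def)
  also have "\<dots> = ennreal (\<Prod>b\<in>Basis. inner (u - l) b)"
    using le[of 1] le[of \<i>]
    by (simp add: ennreal_mult Basis_complex_def inner_complex_def)
  finally show "emeasure (distr (\<Pi>\<^sub>M i\<in>{..<2::nat}. lborel) borel (\<lambda>x. Complex (x 0) (x 1))) (box l u)
      = ennreal (\<Prod>b\<in>Basis. inner (u - l) b)" .
qed simp

lemma leb_2: "leb 2 = distr lborel borel complex_coords"
proof -
  have "leb 2 = distr (\<Pi>\<^sub>M i\<in>{..<2::nat}. lborel) borel (complex_coords \<circ> (\<lambda>x. Complex (x 0) (x 1)))"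
    unfolding leb_def
    by (rule arg_cong[where f="distr _ _"]) (auto simp: complex_coords_def fun_eq_iff less_2_cases_iff)
  also have "\<dots> = distr (distr (\<Pi>\<^sub>M i\<in>{..<2::nat}. lborel) borel (\<lambda>x. Complex (x 0) (x 1))) borel complex_coords"
    by (subst distr_distr) (auto simp: Complex_eq)
  finally show ?thesis by (simp add: lborel_complex_eq_distr_PiM)
qed

lemma sets_leb_2 [simp, measurable_cong]: "sets (leb 2) = sets borel"
  by (simp add: leb_2)

lemma borel_measurable_indicator_complex_coords:
  fixes u :: "coords \<Rightarrow> 'b::{banach, second_countable_topology}"
  assumes A: "A \<in> sets borel"
  shows "(\<lambda>y. indicator (complex_coords ` A) y *\<^sub>R u y) \<in> borel_measurable borel \<longleftrightarrow>
         (\<lambda>z. indicator A z *\<^sub>R u (complex_coords z)) \<in> borel_measurable borel" (is "?L \<longleftrightarrow> ?R")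
proof
  assume ?L
  from measurable_compose[OF borel_measurable_complex_coords this] show ?R
    by (simp add: indicator_def cong: if_cong)
next
  assume ?R
  from borel_measurable_scaleR[OF borel_measurable_indicator[OF complex_coords_image_borel[OF A]]
      measurable_compose[OF borel_measurable_cpoint this]]
  have "(\<lambda>y. indicator (complex_coords ` A) y *\<^sub>R (indicator A (cpoint y) *\<^sub>R u (complex_coords (cpoint y))))
      \<in> borel_measurable borel"
    by simp
  also have "(\<lambda>y. indicator (complex_coords ` A) y *\<^sub>R (indicator A (cpoint y) *\<^sub>R u (complex_coords (cpoint y))))
      = (\<lambda>y. indicator (complex_coords ` A) y *\<^sub>R u y)"
    by (auto simp: fun_eq_iff indicator_def)
  finally show ?L .
qed

lemma set_integrable_leb_2:
  fixes u :: "coords \<Rightarrow> 'b::{banach, second_countable_topology}"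
  assumes A: "A \<in> sets borel"
  shows "set_integrable (leb 2) (complex_coords ` A) u \<longleftrightarrow>
         set_integrable lborel A (\<lambda>z. u (complex_coords z))"
proof (cases "(\<lambda>y. indicator (complex_coords ` A) y *\<^sub>R u y) \<in> borel_measurable borel")
  case True
  then show ?thesis
    unfolding set_integrable_def leb_2
    by (subst integrable_distr_eq) (auto simp: indicator_def)
next
  case False
  moreover from this have "(\<lambda>z. indicator A z *\<^sub>R u (complex_coords z)) \<notin> borel_measurable borel"
    using borel_measurable_indicator_complex_coords[OF A] by blast
  ultimately show ?thesis
    unfolding set_integrable_def
    using borel_measurable_integrable[of lborel] borel_measurable_integrable[of "leb 2"]
    by (auto simp: measurable_cong_sets[OF sets_leb_2 refl])
qed

lemma set_integral_leb_2:
  fixes u :: "coords \<Rightarrow> 'b::{banach, second_countable_topology}"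
  assumes A: "A \<in> sets borel"
  shows "(LINT y:complex_coords ` A|leb 2. u y) = (LINT z:A|lborel. u (complex_coords z))"
proof (cases "(\<lambda>y. indicator (complex_coords ` A) y *\<^sub>R u y) \<in> borel_measurable borel")
  case True
  then show ?thesis
    unfolding set_lebesgue_integral_def leb_2
    by (subst integral_distr) (auto simp: indicator_def)
next
  case False
  then have "\<not> set_integrable (leb 2) (complex_coords ` A) u"
    unfolding set_integrable_def
    using borel_measurable_integrable[of "leb 2"]
    by (auto simp: measurable_cong_sets[OF sets_leb_2 refl])
  moreover from this have "\<not> set_integrable lborel A (\<lambda>z. u (complex_coords z))"
    using set_integrable_leb_2[OF A] by blast
  ultimately show ?thesis
    by (simp add: set_integrable_def set_lebesgue_integral_def not_integrable_integral_eq)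
qed

section \<open>The Riemann sphere\<close>

abbreviation sphere_top :: "complex option topology" where
  "sphere_top \<equiv> Alexandroff_compactification euclidean"

text \<open>
  The inverses of the two charts z and 1/z; the second one sends 0 to the point at infinity.
\<close>
definition sphere_param :: "nat \<Rightarrow> complex \<Rightarrow> complex option" where
  "sphere_param i z = (if i = 0 then Some z else if z = 0 then None else Some (1 / z))"

lemma riemann_sphere_simps [simp]:
  "mtop riemann_sphere = sphere_top" "mdim riemann_sphere = 2" "nch riemann_sphere = 2"
  "dom riemann_sphere i = (if i = 0 then range Some else UNIV - {Some 0})"
  "coord riemann_sphere i x = complex_coords (sphere_coord i x)"
  "gram riemann_sphere i x = (4 / (1 + (cmod (sphere_coord i x))\<^sup>2)\<^sup>2) \<cdot>\<^sub>m 1\<^sub>m 2"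
  by (simp_all add: riemann_sphere_def)

lemma sphere_coord_param [simp]: "sphere_coord i (sphere_param i z) = z"
  by (simp add: sphere_coord_def sphere_param_def)

lemma sphere_param_in_dom [simp]: "sphere_param i z \<in> dom riemann_sphere i"
  by (auto simp: sphere_param_def)

lemma sphere_param_coord: "x \<in> dom riemann_sphere i \<Longrightarrow> sphere_param i (sphere_coord i x) = x"
  by (auto simp: sphere_param_def sphere_coord_def split: option.splits if_splits)

lemma sphere_param_eq_iff [simp]: "sphere_param i z = sphere_param i z' \<longleftrightarrow> z = z'"
  by (metis sphere_coord_param)

lemma coord_image_dom_Collect: "coord riemann_sphere i ` {x \<in> dom riemann_sphere i. P x} 
    = complex_coords ` {z. P (sphere_param i z)}"
proof (intro equalityI subsetI)
  fix y assume "y \<in> coord riemann_sphere i ` {x \<in> dom riemann_sphere i. P x}"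
  then obtain x where "x \<in> dom riemann_sphere i" "P x" "y = coord riemann_sphere i x" by blast
  then show "y \<in> complex_coords ` {z. P (sphere_param i z)}"
    using sphere_param_coord[of x i] by (simp del: riemann_sphere_simps(4))
next
  fix y assume "y \<in> complex_coords ` {z. P (sphere_param i z)}"
  then obtain z where z: "P (sphere_param i z)" "y = complex_coords z" by blast
  have "y = coord riemann_sphere i (sphere_param i z)" using z by simp
  with z show "y \<in> coord riemann_sphere i ` {x \<in> dom riemann_sphere i. P x}"
    using sphere_param_in_dom by blast
qed

lemma coord_image_dom_UNIV: "coord riemann_sphere i ` dom riemann_sphere i = range complex_coords"
  using coord_image_dom_Collect[of i "\<lambda>_. True"] by simp

lemma param_riemann_sphere [simp]: "param riemann_sphere i (complex_coords z) = sphere_param i z"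
proof -
  have "inj_on (coord riemann_sphere i) (dom riemann_sphere i)"
    by (rule inj_onI) (metis complex_coords_eq_iff riemann_sphere_simps(5) sphere_param_coord)
  from inv_into_f_f[OF this sphere_param_in_dom[of i z]] show ?thesis
    by (simp add: param_def)
qed

lemma chart_at_Some [simp]: "chart_at riemann_sphere (Some z) = 0"
  by (auto simp: chart_at_def intro: Least_equality)

lemma chart_at_None [simp]: "chart_at riemann_sphere None = 1"
  unfolding chart_at_def
  by (rule Least_equality) (auto intro: ccontr simp: Suc_le_eq)

lemma space_borel_of: "space (borel_of X) = topspace X"
  unfolding borel_of_def by (rule space_measure_of) (auto dest: openin_subset)

lemma sets_borel_of: "sets (borel_of X) = sigma_sets (topspace X) {U. openin X U}"
  unfolding borel_of_def by (rule sets_measure_of) (auto dest: openin_subset)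

lemma measurable_borel_of:
  assumes "continuous_map X Y f" shows "f \<in> measurable (borel_of X) (borel_of Y)"
proof (rule measurable_sigma_sets[of _ "topspace Y" "{U. openin Y U}"])
  show "sets (borel_of Y) = sigma_sets (topspace Y) {U. openin Y U}" by (rule sets_borel_of)
  show "f \<in> space (borel_of X) \<rightarrow> topspace Y"
    using assms continuous_map_image_subset_topspace by (fastforce simp: space_borel_of)
  show "f -` U \<inter> space (borel_of X) \<in> sets (borel_of X)" if "U \<in> {U. openin Y U}" for U
  proof -
    have "openin X {x \<in> topspace X. f x \<in> U}" using assms that by (auto simp: continuous_map_def)
    moreover have "{x \<in> topspace X. f x \<in> U} = f -` U \<inter> space (borel_of X)" by (auto simp: space_borel_of)
    ultimately show ?thesis by (auto simp: sets_borel_of)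
  qed
qed (auto dest: openin_subset)

lemma borel_of_euclidean: "borel_of euclidean = borel"
  by (simp add: borel_of_def borel_def)

abbreviation sphere_borel :: "complex option measure" where
  "sphere_borel \<equiv> borel_of sphere_top"

lemma measurable_Some_sphere [measurable]: "Some \<in> measurable borel sphere_borel"
  using measurable_borel_of[OF continuous_map_Some[of euclidean]] by (simp add: borel_of_euclidean)

lemma topspace_sphere [simp]: "topspace sphere_top = UNIV"
proof (rule Set.set_eqI)
  fix x :: "complex option"
  show "x \<in> topspace sphere_top \<longleftrightarrow> x \<in> UNIV" by (cases x) auto
qed

declare topspace_Alexandroff_compactification [simp del]

lemma space_sphere_borel [simp]: "space sphere_borel = UNIV"
  by (simp add: space_borel_of)

definition sphere_density :: "complex \<Rightarrow> real" where
  "sphere_density z = 4 / (1 + (cmod z)\<^sup>2)\<^sup>2"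

lemma sphere_density_pos [simp]: "0 < sphere_density z"
  unfolding sphere_density_def by (intro divide_pos_pos zero_less_power) (auto simp: add_pos_nonneg)

lemma sphere_density_nonneg [simp]: "0 \<le> sphere_density z"
  using sphere_density_pos less_imp_le by blast

lemma borel_measurable_sphere_density [measurable]: "sphere_density \<in> borel_measurable borel"
  unfolding sphere_density_def by measurable

lemma sqrt_det_gram: "sqrt (Determinant.det (gram riemann_sphere i (sphere_param i z))) = sphere_density z"
proof -
  have "Determinant.det (gram riemann_sphere i (sphere_param i z)) = (sphere_density z)\<^sup>2"
    by (simp add: sphere_density_def power2_eq_square)
  then show ?thesis by (simp add: real_sqrt_abs)
qed

text \<open>
  The volume is assembled from the first chart on the finite points and the second one at infinity.
  The latter contributes a single point of the coordinate plane, which is a null set, so the volume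
  is carried by the plane.
\<close>
lemma vol_riemann_sphere:
  "vol riemann_sphere = distr (density lborel sphere_density) sphere_borel Some" (is "_ = ?D")
proof -
  have "vol riemann_sphere = measure_of (topspace sphere_top) {U. openin sphere_top U} (emeasure ?D)"
    unfolding vol_def riemann_sphere_simps(1)
  proof (rule measure_of_eq)
    show "{U. openin sphere_top U} \<subseteq> Pow (topspace sphere_top)" by (metis PowI mem_Collect_eq openin_subset subsetI)
    fix A assume "A \<in> sigma_sets (topspace sphere_top) {U. openin sphere_top U}"
    then have A: "A \<in> sets sphere_borel" by (simp add: sets_borel_of)
    then have sA: "Some -` A \<in> sets borel"
      using measurable_sets[OF measurable_Some_sphere A] by simp
    have i0: "coord riemann_sphere 0 ` {x \<in> A. chart_at riemann_sphere x = 0} = complex_coords ` (Some -` A)"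
      (is "?L = ?R")
    proof
      show "?L \<subseteq> ?R"
      proof safe
        fix x assume "x \<in> A" "chart_at riemann_sphere x = 0"
        then show "coord riemann_sphere 0 x \<in> ?R"
          by (cases x) (auto simp: sphere_coord_def)
      qed
      show "?R \<subseteq> ?L" by (force simp: sphere_coord_def)
    qed
    have i1: "coord riemann_sphere 1 ` {x \<in> A. chart_at riemann_sphere x = 1} \<subseteq> {complex_coords 0}"
    proof safe
      fix x assume "x \<in> A" "chart_at riemann_sphere x = 1"
      then show "coord riemann_sphere 1 x = complex_coords 0"
        by (cases x) (auto simp: sphere_coord_def)
    qed
    have null: "AE y in leb 2. y \<notin> {complex_coords 0}"
    proof -
      have "{complex_coords 0} \<in> null_sets (leb 2)"
      proof (rule null_setsI)
        have "{complex_coords 0} = complex_coords ` {0}" by simp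
        then have s: "{complex_coords 0} \<in> sets borel" using complex_coords_image_borel[of "{0}"] by simp
        then show "{complex_coords 0} \<in> sets (leb 2)" by simp
        have "complex_coords -` {complex_coords 0} = {0}" by auto
        with s show "emeasure (leb 2) {complex_coords 0} = 0"
          by (simp add: leb_2 emeasure_distr)
      qed
      then show ?thesis by (rule AE_not_in)
    qed
    have z1: "(\<integral>\<^sup>+ y \<in> coord riemann_sphere 1 ` {x \<in> A. chart_at riemann_sphere x = 1}.
        ennreal (sqrt (Determinant.det (gram riemann_sphere 1 (param riemann_sphere 1 y)))) \<partial>leb 2) = 0"
    proof -
      have "(\<integral>\<^sup>+ y \<in> coord riemann_sphere 1 ` {x \<in> A. chart_at riemann_sphere x = 1}.
        ennreal (sqrt (Determinant.det (gram riemann_sphere 1 (param riemann_sphere 1 y)))) \<partial>leb 2)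
        = (\<integral>\<^sup>+ y. 0 \<partial>leb 2)"
        by (rule nn_integral_cong_AE) (use null i1 in \<open>auto elim!: eventually_mono simp: indicator_def\<close>)
      then show ?thesis by simp
    qed
    have "(\<integral>\<^sup>+ y \<in> complex_coords ` (Some -` A).
        ennreal (sqrt (Determinant.det (gram riemann_sphere 0 (param riemann_sphere 0 y)))) \<partial>leb 2)
       = (\<integral>\<^sup>+ y. ennreal (sphere_density (cpoint y)) * indicator (complex_coords ` (Some -` A)) y \<partial>leb 2)"
      by (rule nn_integral_cong)
         (auto simp: indicator_def sqrt_det_gram simp del: riemann_sphere_simps)
    also have "\<dots> = (\<integral>\<^sup>+ z. ennreal (sphere_density z) * indicator (Some -` A) z \<partial>lborel)"
      unfolding leb_2 using complex_coords_image_borel[OF sA]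
      by (subst nn_integral_distr) (auto simp: indicator_def intro!: nn_integral_cong)
    also have "\<dots> = emeasure ?D A"
      using A sA by (simp add: emeasure_distr emeasure_density)
    finally have z0: "(\<integral>\<^sup>+ y \<in> complex_coords ` (Some -` A).
        ennreal (sqrt (Determinant.det (gram riemann_sphere 0 (param riemann_sphere 0 y)))) \<partial>leb 2)
      = emeasure ?D A" .
    have "{..<2::nat} = {0, 1}" by auto
    then show "(\<Sum>i<nch riemann_sphere. \<integral>\<^sup>+ y \<in> coord riemann_sphere i ` {x \<in> A. chart_at riemann_sphere x = i}.
        ennreal (sqrt (Determinant.det (gram riemann_sphere i (param riemann_sphere i y)))) \<partial>leb (mdim riemann_sphere)) = emeasure ?D A"
      unfolding riemann_sphere_simps(2,3) using z0[folded i0] z1 by (simp del: riemann_sphere_simps)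
  qed
  also have "\<dots> = ?D"
  proof -
    have "measure_of (space ?D) (sets ?D) (emeasure ?D) = ?D" by (rule measure_of_of_measure)
    moreover have "measure_of (topspace sphere_top) {U. openin sphere_top U} (emeasure ?D)
       = measure_of (topspace sphere_top) (sigma_sets (topspace sphere_top) {U. openin sphere_top U}) (emeasure ?D)"
      by (simp add: measure_of_def sigma_sets_sigma_sets_eq)
    ultimately show ?thesis by (simp add: sets_borel_of)
  qed
  finally show ?thesis .
qed

section \<open>Smooth functions and weak derivatives in the plane\<close>

definition axis_dir :: "nat \<Rightarrow> complex" where
  "axis_dir i = (if i = 0 then 1 else \<i>)"

lemma complex_coords_update:
  "i < 2 \<Longrightarrow> (complex_coords z)(i := s) = complex_coords (z + (s - complex_coords z i) *\<^sub>R axis_dir i)"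
  by (auto simp: complex_coords_def axis_dir_def fun_eq_iff)

text \<open>
  Smoothness by coinduction: to show that all iterated partial derivatives exist, it suffices to
  exhibit a family of functions that contains the given one and is closed under partial derivatives.
  Agreement is required on the open set only, which is why g0 and h may be different functions.
\<close>
lemma smooth_on_coinduct:
  assumes "openin (Euclidean_space n) \<Omega>" and "h \<in> S"
    and cont: "\<And>h. h \<in> S \<Longrightarrow> continuous_map (subtopology (Euclidean_space n) \<Omega>) euclideanreal h"
    and deriv: "\<And>h i. h \<in> S \<Longrightarrow> i < n \<Longrightarrow>
      \<exists>h'\<in>S. \<forall>x\<in>\<Omega>. ((\<lambda>s. h (x(i := s))) has_real_derivative h' x) (at (x i))"
    and eq: "\<And>x. x \<in> \<Omega> \<Longrightarrow> g0 x = h x"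
  shows "smooth_on n \<Omega> g0"
proof -
  have "C_diff n k \<Omega> g" if "h \<in> S" "\<And>x. x \<in> \<Omega> \<Longrightarrow> g x = h x" for k g h
    using that
  proof (induction k arbitrary: g h)
    case 0
    have "continuous_map (subtopology (Euclidean_space n) \<Omega>) euclideanreal g"
      by (rule continuous_map_eq[OF cont[OF 0(1)]]) (use 0(2) in auto)
    then show ?case by simp
  next
    case (Suc k)
    have c: "continuous_map (subtopology (Euclidean_space n) \<Omega>) euclideanreal g"
      by (rule continuous_map_eq[OF cont[OF Suc(2)]]) (use Suc(3) in auto)
    have "(\<forall>x\<in>\<Omega>. (\<lambda>s. g (x(i := s))) differentiable (at (x i))) \<and> C_diff n k \<Omega> (partial i g)"
      if i: "i < n" for i
    proof -
      from deriv[OF Suc(2) i] obtain h' where h': "h' \<in> S"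
        "\<And>x. x \<in> \<Omega> \<Longrightarrow> ((\<lambda>s. h (x(i := s))) has_real_derivative h' x) (at (x i))" by blast
      have *: "((\<lambda>s. g (x(i := s))) has_real_derivative h' x) (at (x i))" if x: "x \<in> \<Omega>" for x
      proof -
        note gh = Suc(3)
        have xe: "x \<in> topspace (Euclidean_space n)"
          using assms(1) x openin_subset by blast
        have "continuous_map euclidean (Euclidean_space n) (\<lambda>s. x(i := s))"
        proof -
          have "continuous_on UNIV (\<lambda>s. x(i := s))"
          proof (rule continuous_on_coordinatewise_then_product)
            fix j show "continuous_on UNIV (\<lambda>s. (x(i := s)) j)"
              by (cases "j = i") auto
          qed
          then show ?thesis
            using xe i unfolding Euclidean_space_def euclidean_product_topology
            by (auto simp: continuous_map_in_subtopology)
        qed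
        then have "open {s. x(i := s) \<in> \<Omega>}"
          using assms(1) unfolding continuous_map_def by simp
        moreover have "x i \<in> {s. x(i := s) \<in> \<Omega>}" using x by simp
        ultimately show ?thesis
          by (rule has_field_derivative_transform_within_open[OF h'(2)[OF x]]) (rule gh[symmetric], drule CollectD, assumption)
      qed
      have "C_diff n k \<Omega> (partial i g)"
        by (rule Suc.IH[OF h'(1)]) (auto simp: partial_def intro!: DERIV_imp_deriv *)
      with * show ?thesis
        by (auto simp: differentiable_def has_field_derivative_def)
    qed
    with c show ?case by simp
  qed
  with assms(2) eq show ?thesis unfolding smooth_on_def by blast
qed

text \<open>
  Real differentiability with the partial derivatives a and b named explicitly.
\<close>
definition grad_deriv :: "(complex \<Rightarrow> 'b::real_normed_vector) \<Rightarrow> complex \<Rightarrow> 'b \<Rightarrow> 'b \<Rightarrow> bool" where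
  "grad_deriv u z a b \<longleftrightarrow> (u has_derivative (\<lambda>h. Re h *\<^sub>R a + Im h *\<^sub>R b)) (at z)"

lemma grad_deriv_coord_line:
  assumes "grad_deriv u z (v 0) (v 1)" "i < 2"
  shows "((\<lambda>s. u (cpoint ((complex_coords z)(i := s)))) has_vector_derivative v i) (at (complex_coords z i))"
proof -
  have v: "v i = Re (axis_dir i) *\<^sub>R v 0 + Im (axis_dir i) *\<^sub>R v 1"
    using assms(2) by (auto simp: axis_dir_def less_2_cases_iff)
  have "((\<lambda>s. z + (s - complex_coords z i) *\<^sub>R axis_dir i) has_derivative (\<lambda>s. s *\<^sub>R axis_dir i))
      (at (complex_coords z i))"
    by (auto intro!: derivative_eq_intros)
  moreover have "(u has_derivative (\<lambda>h. Re h *\<^sub>R v 0 + Im h *\<^sub>R v 1))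
      (at (z + (complex_coords z i - complex_coords z i) *\<^sub>R axis_dir i))"
    using assms(1) by (simp add: grad_deriv_def)
  ultimately have "((\<lambda>s. u (z + (s - complex_coords z i) *\<^sub>R axis_dir i)) has_derivative
      (\<lambda>s. Re (s *\<^sub>R axis_dir i) *\<^sub>R v 0 + Im (s *\<^sub>R axis_dir i) *\<^sub>R v 1)) (at (complex_coords z i))"
    by (rule has_derivative_compose)
  then show ?thesis
    using assms(2) unfolding has_vector_derivative_def v
    by (simp add: complex_coords_update scaleR_add_right)
qed

lemma smooth_on_planar_coinduct:
  assumes U: "open U" and "u \<in> S"
    and step: "\<And>u. u \<in> S \<Longrightarrow> \<exists>ux\<in>S. \<exists>uy\<in>S. \<forall>z\<in>U. grad_deriv u z (ux z) (uy z)"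
    and eq: "\<And>z. z \<in> U \<Longrightarrow> g (complex_coords z) = u z"
  shows "smooth_on 2 (complex_coords ` U) g"
proof (rule smooth_on_coinduct[where S = "(\<lambda>u y. u (cpoint y)) ` S"])
  show "openin (Euclidean_space 2) (complex_coords ` U)" using U by (simp add: openin_complex_coords)
  show "(\<lambda>y. u (cpoint y)) \<in> (\<lambda>u y. u (cpoint y)) ` S" using assms(2) by blast
  show "\<And>x. x \<in> complex_coords ` U \<Longrightarrow> g x = u (cpoint x)" using eq by auto
next
  fix h :: "coords \<Rightarrow> real" assume "h \<in> (\<lambda>u y. u (cpoint y)) ` S"
  then obtain u where u: "u \<in> S" "h = (\<lambda>y. u (cpoint y))" by blast
  from step[OF u(1)] have "\<forall>z\<in>U. u differentiable (at z)"
    unfolding grad_deriv_def differentiable_def by blast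
  then have "continuous_on U u"
    by (meson continuous_at_imp_continuous_on differentiable_imp_continuous_within)
  then show "continuous_map (subtopology (Euclidean_space 2) (complex_coords ` U)) euclideanreal h"
    by (simp add: u continuous_map_complex_coords)
  fix i :: nat assume i: "i < 2"
  from step[OF u(1)] obtain ux uy where s: "ux \<in> S" "uy \<in> S"
    and d: "\<And>z. z \<in> U \<Longrightarrow> grad_deriv u z (ux z) (uy z)" by blast
  define w where "w = (if i = 0 then ux else uy)"
  have "((\<lambda>s. h ((complex_coords z)(i := s))) has_real_derivative w z) (at (complex_coords z i))"
    if "z \<in> U" for z
    using grad_deriv_coord_line[of u z "\<lambda>j. if j = 0 then ux z else uy z" i] d[OF that] i
    by (simp add: u w_def has_real_derivative_iff_has_vector_derivative split: if_splits)
  then have "\<forall>x\<in>complex_coords ` U. ((\<lambda>s. h (x(i := s))) has_real_derivative w (cpoint x)) (at (x i))"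
    by auto
  moreover have "(\<lambda>y. w (cpoint y)) \<in> (\<lambda>u y. u (cpoint y)) ` S" using s by (auto simp: w_def)
  ultimately show "\<exists>h'\<in>(\<lambda>u y. u (cpoint y)) ` S.
      \<forall>x\<in>complex_coords ` U. ((\<lambda>s. h (x(i := s))) has_real_derivative h' x) (at (x i))"
    by (intro bexI[of _ "\<lambda>y. w (cpoint y)"]) auto
qed

subsection \<open>Bump functions\<close>

text \<open>
  For P = 1 this is the smooth function exp(-1/s) that is flat at 0; the polynomials make the family
  closed under differentiation.
\<close>
definition flat_fun :: "real poly \<Rightarrow> real \<Rightarrow> real" where
  "flat_fun P s = (if s \<le> 0 then 0 else poly P (1 / s) * exp (- (1 / s)))"

lemma tendsto_poly_exp_minus: "((\<lambda>x. poly P x * exp (- x)) \<longlongrightarrow> 0) (at_top :: real filter)"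
proof -
  have "((\<lambda>x. \<Sum>i\<le>degree P. coeff P i * (x ^ i / exp x)) \<longlongrightarrow> (\<Sum>i\<le>degree P. coeff P i * 0)) (at_top :: real filter)"
    by (intro tendsto_intros tendsto_power_div_exp_0)
  moreover have "(\<lambda>x. \<Sum>i\<le>degree P. coeff P i * (x ^ i / exp x)) = (\<lambda>x. poly P x * exp (- x))"
    by (simp add: poly_altdef sum_distrib_right exp_minus divide_inverse mult.assoc)
  ultimately show ?thesis by simp
qed

lemma DERIV_flat_fun: "(flat_fun P has_real_derivative flat_fun ([:0, 0, 1:] * (P - pderiv P)) s) (at s)"
proof (cases s "0::real" rule: linorder_cases)
  case less
  have "((\<lambda>_. 0) has_real_derivative 0) (at s)" by simp
  then have "(flat_fun P has_real_derivative 0) (at s)"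
    by (rule has_field_derivative_transform_within_open[of _ _ _ "{..<0}"]) (use less in \<open>auto simp: flat_fun_def\<close>)
  then show ?thesis using less by (simp add: flat_fun_def)
next
  case greater
  have "((\<lambda>s. poly P (1 / s) * exp (- (1 / s))) has_real_derivative
      (poly (pderiv P) (1 / s) * (- 1 / s\<^sup>2)) * exp (- (1 / s))
        + exp (- (1 / s)) * (1 / s\<^sup>2) * poly P (1 / s)) (at s)"
    using greater by (auto intro!: derivative_eq_intros DERIV_chain'[OF _ poly_DERIV]
        simp: power2_eq_square field_simps)
  then have "(flat_fun P has_real_derivative
      (poly (pderiv P) (1 / s) * (- 1 / s\<^sup>2)) * exp (- (1 / s))
        + exp (- (1 / s)) * (1 / s\<^sup>2) * poly P (1 / s)) (at s)"
    by (rule has_field_derivative_transform_within_open[of _ _ _ "{0<..}"]) (use greater in \<open>auto simp: flat_fun_def\<close>)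
  then show ?thesis
    using greater by (simp add: flat_fun_def power2_eq_square algebra_simps)
next
  case equal
  have "((\<lambda>h. poly (pCons 0 P) (inverse h) * exp (- inverse h)) \<longlongrightarrow> 0) (at_right 0)"
    by (rule filterlim_compose[OF tendsto_poly_exp_minus filterlim_inverse_at_top_right])
  then have "((\<lambda>h. flat_fun P h / h) \<longlongrightarrow> 0) (at_right 0)"
    by (rule Lim_transform_eventually)
       (auto simp: eventually_at_filter flat_fun_def field_simps)
  moreover have "((\<lambda>h. flat_fun P h / h) \<longlongrightarrow> 0) (at_left 0)"
    by (rule Lim_transform_eventually[OF tendsto_const]) (auto simp: eventually_at_filter flat_fun_def)
  ultimately have "((\<lambda>h. flat_fun P h / h) \<longlongrightarrow> 0) (at 0)"
    by (simp add: filterlim_at_split)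
  then show ?thesis using equal by (simp add: DERIV_def flat_fun_def)
qed

text \<open>
  The algebra generated by the functions exp(-1/l) times a polynomial in 1/l, cut off where the
  affine function l is negative, is closed under partial derivatives.
\<close>
inductive_set flat_algebra :: "(complex \<Rightarrow> real) set" where
  gen: "(\<lambda>z. flat_fun P (\<alpha> + \<beta> * Re z + \<gamma> * Im z)) \<in> flat_algebra"
| add: "u \<in> flat_algebra \<Longrightarrow> v \<in> flat_algebra \<Longrightarrow> (\<lambda>z. u z + v z) \<in> flat_algebra"
| mult: "u \<in> flat_algebra \<Longrightarrow> v \<in> flat_algebra \<Longrightarrow> (\<lambda>z. u z * v z) \<in> flat_algebra"

lemma flat_algebra_closed_deriv:
  "u \<in> flat_algebra \<Longrightarrow> \<exists>ux\<in>flat_algebra. \<exists>uy\<in>flat_algebra. \<forall>z. grad_deriv u z (ux z) (uy z)"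
proof (induction rule: flat_algebra.induct)
  case (gen P \<alpha> \<beta> \<gamma>)
  let ?Q = "[:0, 0, 1:] * (P - pderiv P)"
  have s: "c * flat_fun ?Q s = flat_fun ([:c:] * ?Q) s" for c s
    by (simp add: flat_fun_def)
  have "((\<lambda>z. flat_fun P (\<alpha> + \<beta> * Re z + \<gamma> * Im z)) has_derivative
     (\<lambda>h. flat_fun ?Q (\<alpha> + \<beta> * Re z + \<gamma> * Im z) * (\<beta> * Re h + \<gamma> * Im h))) (at z)" for z
    by (rule has_derivative_compose[OF _ DERIV_flat_fun[unfolded has_field_derivative_def], THEN has_derivative_eq_rhs])
       (auto intro!: derivative_eq_intros simp: fun_eq_iff)
  then have "grad_deriv (\<lambda>z. flat_fun P (\<alpha> + \<beta> * Re z + \<gamma> * Im z)) z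
       (flat_fun ([:\<beta>:] * ?Q) (\<alpha> + \<beta> * Re z + \<gamma> * Im z)) (flat_fun ([:\<gamma>:] * ?Q) (\<alpha> + \<beta> * Re z + \<gamma> * Im z))" for z
    unfolding grad_deriv_def s[symmetric]
    by (rule has_derivative_eq_rhs) (auto simp: fun_eq_iff algebra_simps)
  then show ?case by (intro bexI allI) (auto intro: flat_algebra.gen)
next
  case (add u v)
  then obtain ux uy vx vy where m: "ux \<in> flat_algebra" "uy \<in> flat_algebra" "vx \<in> flat_algebra" "vy \<in> flat_algebra"
    and d: "\<And>z. grad_deriv u z (ux z) (uy z)" "\<And>z. grad_deriv v z (vx z) (vy z)" by blast
  have "grad_deriv (\<lambda>z. u z + v z) z (ux z + vx z) (uy z + vy z)" for z
    using has_derivative_add[OF d[unfolded grad_deriv_def]] unfolding grad_deriv_def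
    by (rule has_derivative_eq_rhs) (auto simp: fun_eq_iff algebra_simps)
  with m show ?case
    by (intro bexI[of _ "\<lambda>z. ux z + vx z"] bexI[of _ "\<lambda>z. uy z + vy z"]) (auto intro: flat_algebra.add)
next
  case (mult u v)
  then obtain ux uy vx vy where m: "ux \<in> flat_algebra" "uy \<in> flat_algebra" "vx \<in> flat_algebra" "vy \<in> flat_algebra"
    and d: "\<And>z. grad_deriv u z (ux z) (uy z)" "\<And>z. grad_deriv v z (vx z) (vy z)" by blast
  have "grad_deriv (\<lambda>z. u z * v z) z (u z * vx z + ux z * v z) (u z * vy z + uy z * v z)" for z
    using has_derivative_mult[OF d[unfolded grad_deriv_def]] unfolding grad_deriv_def
    by (rule has_derivative_eq_rhs) (auto simp: fun_eq_iff algebra_simps)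
  with m mult.hyps show ?case
    by (intro bexI[of _ "\<lambda>z. u z * vx z + ux z * v z"] bexI[of _ "\<lambda>z. u z * vy z + uy z * v z"])
       (auto intro!: flat_algebra.add flat_algebra.mult)
qed

text \<open>
  Each factor is a flat function of a multiple n l of an affine function l that is positive on one
  side of an edge of the box; the null terms bring the four functions into the shape required by
  the generating rule of the algebra. As n grows, exp(-1/(n l)) tends to 1 where l is positive, so
  that the bumps converge to the indicator of the open box.
\<close>
definition box_bump :: "complex \<Rightarrow> complex \<Rightarrow> nat \<Rightarrow> complex \<Rightarrow> real" where
  "box_bump a b n z = flat_fun 1 (- real n * Re a + real n * Re z + 0 * Im z)
     * flat_fun 1 (real n * Re b + (- real n) * Re z + 0 * Im z)
     * (flat_fun 1 (- real n * Im a + 0 * Re z + real n * Im z)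
     * flat_fun 1 (real n * Im b + 0 * Re z + (- real n) * Im z))"

lemma box_bump_in_flat_algebra: "box_bump a b n \<in> flat_algebra"
  unfolding box_bump_def[abs_def] by (intro flat_algebra.intros)

lemma flat_fun_1_bounds: "0 \<le> flat_fun 1 s" "flat_fun 1 s \<le> 1"
  by (auto simp: flat_fun_def)

lemma box_bump_bounds: "0 \<le> box_bump a b n z" "box_bump a b n z \<le> 1"
  unfolding box_bump_def by (intro mult_nonneg_nonneg mult_le_one flat_fun_1_bounds)+

lemma flat_fun_1_scaled_limit: "(\<lambda>n. flat_fun 1 (real n * s)) \<longlonglongrightarrow> (if s > 0 then 1 else 0)"
proof (cases "s > 0")
  case True
  have "(\<lambda>n. exp (- (1 / s) * inverse (real n))) \<longlonglongrightarrow> exp (- (1 / s) * 0)"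
    by (intro tendsto_intros lim_inverse_n)
  then have "(\<lambda>n. exp (- (1 / s) * inverse (real n))) \<longlonglongrightarrow> 1" by simp
  moreover have "\<forall>\<^sub>F n in sequentially. exp (- (1 / s) * inverse (real n)) = flat_fun 1 (real n * s)"
    using True by (intro eventually_sequentiallyI[of 1]) (auto simp: flat_fun_def field_simps mult_le_0_iff)
  ultimately show ?thesis using True by (simp add: Lim_transform_eventually)
qed (auto simp: flat_fun_def mult_le_0_iff)

lemma box_bump_limit: "(\<lambda>n. box_bump a b n z) \<longlonglongrightarrow> indicator (box a b) z"
proof -
  have "(\<lambda>n. flat_fun 1 (real n * (Re z - Re a)) * flat_fun 1 (real n * (Re b - Re z))
     * (flat_fun 1 (real n * (Im z - Im a)) * flat_fun 1 (real n * (Im b - Im z)))) \<longlonglongrightarrow>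
     (if Re z - Re a > 0 then 1 else 0) * (if Re b - Re z > 0 then 1 else 0) *
     ((if Im z - Im a > 0 then 1 else 0) * (if Im b - Im z > 0 then 1 else 0))"
    by (intro tendsto_mult flat_fun_1_scaled_limit)
  then show ?thesis
    by (simp add: box_bump_def indicator_def in_box_complex_iff algebra_simps split: if_splits)
qed

lemma box_bump_eq_0: "z \<notin> cbox a b \<Longrightarrow> box_bump a b n z = 0"
  by (auto simp: box_bump_def in_cbox_complex_iff flat_fun_def not_le mult_less_cancel_left)

lemma continuous_on_box_bump: "continuous_on A (box_bump a b n)"
proof -
  from flat_algebra_closed_deriv[OF box_bump_in_flat_algebra]
  have "(box_bump a b n) differentiable (at z)" for z
    unfolding grad_deriv_def differentiable_def by blast
  then show ?thesis
    by (meson continuous_at_imp_continuous_on differentiable_imp_continuous_within)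
qed

lemma test_function_box_bump:
  assumes "cbox a b \<subseteq> U"
  shows "test_function 2 (complex_coords ` U) (\<lambda>y. box_bump a b n (cpoint y))"
proof -
  have "smooth_on 2 (complex_coords ` UNIV) (\<lambda>y. box_bump a b n (cpoint y))"
    by (rule smooth_on_planar_coinduct[OF open_UNIV box_bump_in_flat_algebra])
       (use flat_algebra_closed_deriv in \<open>blast, simp\<close>)
  moreover have "compactin (Euclidean_space 2) (complex_coords ` cbox a b)"
    by (simp add: compactin_complex_coords)
  moreover have "\<forall>x\<in>topspace (Euclidean_space 2) - complex_coords ` cbox a b. box_bump a b n (cpoint x) = 0"
    using box_bump_eq_0 by (auto simp flip: range_complex_coords)
  ultimately show ?thesis
    using assms unfolding test_function_def range_complex_coords by blast
qed

subsection \<open>Uniqueness of weak derivatives\<close>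

lemma loc_integrable_complex_coords:
  "loc_integrable 2 (complex_coords ` U) u \<longleftrightarrow>
   (\<forall>C. compact C \<longrightarrow> C \<subseteq> U \<longrightarrow> set_integrable lborel C (\<lambda>z. u (complex_coords z)))"
proof
  assume L: "loc_integrable 2 (complex_coords ` U) u"
  show "\<forall>C. compact C \<longrightarrow> C \<subseteq> U \<longrightarrow> set_integrable lborel C (\<lambda>z. u (complex_coords z))"
  proof (intro allI impI)
    fix C assume C: "compact C" "C \<subseteq> U"
    then have "set_integrable (leb 2) (complex_coords ` C) u"
      using L compactin_complex_coords[of C] unfolding loc_integrable_def by (simp add: image_mono)
    then show "set_integrable lborel C (\<lambda>z. u (complex_coords z))"
      using C(1) by (simp add: set_integrable_leb_2 borel_compact)
  qed
next
  assume R: "\<forall>C. compact C \<longrightarrow> C \<subseteq> U \<longrightarrow> set_integrable lborel C (\<lambda>z. u (complex_coords z))"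
  show "loc_integrable 2 (complex_coords ` U) u"
    unfolding loc_integrable_def
  proof (intro allI impI)
    fix K assume K: "compactin (Euclidean_space 2) K" "K \<subseteq> complex_coords ` U"
    from K(1) obtain C where C: "compact C" "K = complex_coords ` C" by (rule compactin_Euclidean_2E)
    with K have "C \<subseteq> U" by auto
    with R C show "set_integrable (leb 2) K u" by (simp add: set_integrable_leb_2 borel_compact)
  qed
qed

text \<open>
  Boxes are an intersection-stable generator of the Borel sets, so the integral of w vanishes over
  every Borel set.
\<close>
lemma set_integral_zero_on_boxes_imp_AE_zero:
  fixes w :: "complex \<Rightarrow> 'b::{banach, second_countable_topology}"
  assumes int: "integrable lborel w"
    and boxes: "\<And>a b. (LINT z:box a b|lborel. w z) = 0"
  shows "AE z in lborel. w z = 0"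
proof (rule sigma_finite_measure.density_zero[OF sigma_finite_lborel int])
  have gen: "sigma_sets UNIV (range (\<lambda>(a, b). box a b :: complex set)) = sets borel"
    by (simp add: borel_eq_box)
  have sint: "set_integrable lborel A w" if "A \<in> sets borel" for A
    using that int unfolding set_integrable_def by (intro integrable_mult_indicator) auto
  have "Int_stable (range (\<lambda>(a, b). box a b :: complex set))"
  proof (rule Int_stableI, elim rangeE, clarify)
    fix a b c d :: complex
    have "box a b \<inter> box c d = box (Complex (max (Re a) (Re c)) (max (Im a) (Im c)))
        (Complex (min (Re b) (Re d)) (min (Im b) (Im d)))"
      by (auto simp: in_box_complex_iff)
    then show "box a b \<inter> box c d \<in> range (\<lambda>(a, b). box a b :: complex set)" by auto
  qed
  then have "(LINT z:A|lborel. w z) = 0" if "A \<in> sigma_sets UNIV (range (\<lambda>(a, b). box a b))" for A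
  proof (induction rule: sigma_sets_induct_disjoint[OF _ _ that, consumes 1])
    case 1 then show ?case by auto
  next
    case (2 A) then show ?case using boxes by auto
  next
    case 3 show ?case by (simp add: set_lebesgue_integral_def)
  next
    case (4 A)
    then have A: "A \<in> sets borel" by (simp add: gen)
    have "(LINT z:UNIV|lborel. w z) = 0"
    proof -
      have "(\<lambda>n. LINT z:box (- complex_of_real (real n) - \<i> * real n) (complex_of_real (real n) + \<i> * real n)|lborel. w z)
          \<longlonglongrightarrow> (LINT z:UNIV|lborel. w z)"
        unfolding set_lebesgue_integral_def
      proof (rule integral_dominated_convergence[where w = "\<lambda>z. norm (w z)"])
        show "AE z in lborel. (\<lambda>n. indicat_real (box (- complex_of_real (real n) - \<i> * real n) (complex_of_real (real n) + \<i> * real n)) z *\<^sub>R w z)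
          \<longlonglongrightarrow> indicat_real UNIV z *\<^sub>R w z"
        proof (rule AE_I2)
          fix z :: complex
          obtain N where N: "max \<bar>Re z\<bar> \<bar>Im z\<bar> < real N" using reals_Archimedean2 by blast
          then have "\<forall>\<^sub>F n in sequentially. indicat_real (box (- complex_of_real (real n) - \<i> * real n) (complex_of_real (real n) + \<i> * real n)) z *\<^sub>R w z
            = indicat_real UNIV z *\<^sub>R w z"
            by (intro eventually_sequentiallyI[of N]) (auto simp: in_box_complex_iff indicator_def)
          then show "(\<lambda>n. indicat_real (box (- complex_of_real (real n) - \<i> * real n) (complex_of_real (real n) + \<i> * real n)) z *\<^sub>R w z)
          \<longlonglongrightarrow> indicat_real UNIV z *\<^sub>R w z" by (rule tendsto_eventually)
        qed
      qed (use int in \<open>auto simp: indicator_def\<close>)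
      then show ?thesis using boxes LIMSEQ_unique[OF _ tendsto_const] by simp
    qed
    moreover have "(LINT z:A \<union> (UNIV - A)|lborel. w z) = (LINT z:A|lborel. w z) + (LINT z:UNIV - A|lborel. w z)"
      using A by (intro set_integral_Un sint) auto
    ultimately show ?case using 4 by simp
  next
    case (5 A)
    then have "\<And>i. A i \<in> sets borel" by (auto simp: gen)
    then have "(LINT z:(\<Union>i. A i)|lborel. w z) = (\<Sum>i. LINT z:A i|lborel. w z)"
      using 5(1) sint
      by (intro lebesgue_integral_countable_add) (auto simp: disjoint_family_on_def)
    then show ?case using 5 by simp
  qed
  then show "(LINT z:A|lborel. w z) = 0" if "A \<in> sets lborel" for A
    using that by (simp add: gen)
qed

lemma test_function_planarE:
  assumes "test_function 2 (complex_coords ` U) \<eta>"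
  obtains C where "compact C" "C \<subseteq> U" "\<And>z. z \<notin> C \<Longrightarrow> \<eta> (complex_coords z) = 0"
proof -
  have "\<exists>K. compactin (Euclidean_space 2) K \<and> K \<subseteq> complex_coords ` U
      \<and> (\<forall>x\<in>topspace (Euclidean_space 2) - K. \<eta> x = 0)"
    using assms unfolding test_function_def by (rule conjunct2)
  then obtain K where K: "compactin (Euclidean_space 2) K" "K \<subseteq> complex_coords ` U"
    "\<forall>x\<in>topspace (Euclidean_space 2) - K. \<eta> x = 0" by (elim exE conjE)
  from K(1) obtain C where C: "compact C" "K = complex_coords ` C" by (rule compactin_Euclidean_2E)
  show ?thesis
  proof (rule that[OF C(1)])
    show "C \<subseteq> U" using K(2) C(2) by auto
    show "\<eta> (complex_coords z) = 0" if "z \<notin> C" for z using K(3) C(2) that by simp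
  qed
qed

text \<open>
  The fundamental lemma of the calculus of variations. Test functions converging to the indicator of
  a box show that v has integral 0 over every box in U, hence vanishes almost everywhere on each such
  box; countably many boxes with rational corners cover U.
\<close>
lemma test_integrals_zero_imp_AE_zero:
  fixes v :: "coords \<Rightarrow> 'b::{banach, second_countable_topology}"
  assumes U: "open U" and loc: "loc_integrable 2 (complex_coords ` U) v"
    and test: "\<And>\<eta>. test_function 2 (complex_coords ` U) \<eta> \<Longrightarrow>
      (LINT y:complex_coords ` U|leb 2. \<eta> y *\<^sub>R v y) = 0"
  shows "AE z in lborel. z \<in> U \<longrightarrow> v (complex_coords z) = 0"
proof -
  define V where "V z = v (complex_coords z)" for z
  have box0: "(LINT z:box a b|lborel. V z) = 0" if ab: "cbox a b \<subseteq> U" for a b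
  proof -
    have si: "set_integrable lborel (cbox a b) V"
      using loc ab unfolding loc_integrable_complex_coords V_def by simp
    have "(\<lambda>n. LINT z|lborel. box_bump a b n z *\<^sub>R (indicator (cbox a b) z *\<^sub>R V z)) \<longlonglongrightarrow>
        (LINT z|lborel. indicator (box a b) z *\<^sub>R (indicator (cbox a b) z *\<^sub>R V z))"
    proof (rule integral_dominated_convergence[where w = "\<lambda>z. norm (indicator (cbox a b) z *\<^sub>R V z)"])
      show "AE z in lborel. (\<lambda>n. box_bump a b n z *\<^sub>R (indicator (cbox a b) z *\<^sub>R V z)) \<longlonglongrightarrow>
          indicator (box a b) z *\<^sub>R (indicator (cbox a b) z *\<^sub>R V z)"
        by (intro AE_I2 tendsto_intros box_bump_limit)
      show "AE z in lborel. norm (box_bump a b n z *\<^sub>R (indicator (cbox a b) z *\<^sub>R V z)) \<le>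
          norm (indicator (cbox a b) z *\<^sub>R V z)" for n
      proof (rule AE_I2)
        fix z
        have "norm (box_bump a b n z *\<^sub>R (indicator (cbox a b) z *\<^sub>R V z))
            = box_bump a b n z * norm (indicator (cbox a b) z *\<^sub>R V z)"
          using box_bump_bounds(1)[of a b n z] by simp
        then show "norm (box_bump a b n z *\<^sub>R (indicator (cbox a b) z *\<^sub>R V z)) \<le>
          norm (indicator (cbox a b) z *\<^sub>R V z)"
          using box_bump_bounds[of a b n z] by (metis mult_left_le_one_le norm_ge_zero)
      qed
      show "(\<lambda>z. box_bump a b n z *\<^sub>R (indicator (cbox a b) z *\<^sub>R V z)) \<in> borel_measurable lborel" for n
        using borel_measurable_continuous_onI[OF continuous_on_box_bump]
          borel_measurable_integrable[OF si[unfolded set_integrable_def]]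
        by - (rule borel_measurable_scaleR; simp del: borel_measurable_indicator)
      show "(\<lambda>z. indicator (box a b) z *\<^sub>R (indicator (cbox a b) z *\<^sub>R V z)) \<in> borel_measurable lborel"
        using borel_measurable_integrable[OF si[unfolded set_integrable_def]]
        by - (rule borel_measurable_scaleR; simp)
      show "integrable lborel (\<lambda>z. norm (indicator (cbox a b) z *\<^sub>R V z))"
        using si unfolding set_integrable_def by (rule integrable_norm)
    qed
    moreover have "(LINT z|lborel. box_bump a b n z *\<^sub>R (indicator (cbox a b) z *\<^sub>R V z)) = 0" for n
    proof -
      have "(LINT z|lborel. box_bump a b n z *\<^sub>R (indicator (cbox a b) z *\<^sub>R V z))
          = (LINT z:U|lborel. box_bump a b n z *\<^sub>R V z)"
        unfolding set_lebesgue_integral_def using box_bump_eq_0 ab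
        by (intro Bochner_Integration.integral_cong) (auto simp: indicator_def)
      also have "\<dots> = 0"
        using test[OF test_function_box_bump[OF ab, of n]] U
        by (simp add: set_integral_leb_2 V_def borel_open)
      finally show ?thesis .
    qed
    ultimately have "(LINT z|lborel. indicator (box a b) z *\<^sub>R (indicator (cbox a b) z *\<^sub>R V z)) = 0"
      using LIMSEQ_unique[OF _ tendsto_const] by simp
    moreover have "(\<lambda>z. indicator (box a b) z *\<^sub>R (indicator (cbox a b) z *\<^sub>R V z)) = (\<lambda>z. indicator (box a b) z *\<^sub>R V z)"
      using subsetD[OF box_subset_cbox[of a b]] by (fastforce simp: indicator_def fun_eq_iff)
    ultimately show ?thesis unfolding set_lebesgue_integral_def by metis
  qed
  have AEbox: "AE z in lborel. z \<in> box a b \<longrightarrow> V z = 0" if ab: "cbox a b \<subseteq> U" for a b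
  proof -
    have "set_integrable lborel (cbox a b) V"
      using loc ab unfolding loc_integrable_complex_coords V_def by simp
    then have si: "set_integrable lborel (box a b) V"
      by (rule set_integrable_subset) (auto intro: subsetD[OF box_subset_cbox])
    have "AE z in lborel. indicator (box a b) z *\<^sub>R V z = 0"
    proof (rule set_integral_zero_on_boxes_imp_AE_zero)
      show "integrable lborel (\<lambda>z. indicat_real (box a b) z *\<^sub>R V z)"
        using si by (simp add: set_integrable_def)
      fix c d
      define p q where "p = Complex (max (Re a) (Re c)) (max (Im a) (Im c))"
        and "q = Complex (min (Re b) (Re d)) (min (Im b) (Im d))"
      have "box a b \<inter> box c d = box p q" by (auto simp: in_box_complex_iff p_def q_def)
      then have "(LINT z:box c d|lborel. indicat_real (box a b) z *\<^sub>R V z) = (LINT z:box p q|lborel. V z)"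
        unfolding set_lebesgue_integral_def
        by (intro Bochner_Integration.integral_cong) (auto simp: indicator_def)
      moreover have "cbox p q \<subseteq> U"
        using ab by (auto simp: in_cbox_complex_iff p_def q_def)
      ultimately show "(LINT z:box c d|lborel. indicat_real (box a b) z *\<^sub>R V z) = 0"
        using box0 by simp
    qed
    then show ?thesis by (auto simp: indicator_def elim!: eventually_mono)
  qed
  \<comment> \<open>Countably many boxes with rational corners exhaust U.\<close>
  define Q where "Q = {z. Re z \<in> \<rat> \<and> Im z \<in> \<rat>}"
  define I where "I = {p \<in> Q \<times> Q. cbox (fst p) (snd p) \<subseteq> U}"
  have "Q = (\<lambda>(x, y). Complex x y) ` (\<rat> \<times> \<rat>)"
    unfolding Q_def by (force simp: image_iff)
  then have "countable Q"
    by (metis countable_image countable_SIGMA countable_rat)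
  then have "countable (Q \<times> Q)" by (metis countable_SIGMA)
  then have I1: "countable I"
    by (rule countable_subset[rotated]) (auto simp: I_def)
  have I3: "\<exists>p\<in>I. z \<in> box (fst p) (snd p)" if "z \<in> U" for z
  proof -
    from U that obtain e where e: "e > 0" "ball z e \<subseteq> U" by (meson openE)
    have "e / 2 > 0" using e by simp
    from rational_boxes[OF this, of z]
    obtain a b where ab: "\<forall>i\<in>Basis. inner a i \<in> \<rat> \<and> inner b i \<in> \<rat>" "z \<in> box a b"
      "box a b \<subseteq> ball z (e / 2)" by (elim exE conjE)
    have "cbox a b = closure (box a b)" using ab(2) by (intro closure_box[symmetric]) auto
    also have "\<dots> \<subseteq> cball z (e / 2)"
      using order_trans[OF ab(3) ball_subset_cball] by (rule closure_minimal) simp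
    also have "\<dots> \<subseteq> ball z e" using e by auto
    finally have cU: "cbox a b \<subseteq> U" using e(2) by (rule order_trans)
    have "a \<in> Q" "b \<in> Q"
      using ab(1) by (simp_all add: Q_def Basis_complex_def inner_complex_def)
    with cU have "(a, b) \<in> I" by (simp add: I_def)
    with ab(2) show ?thesis by (intro bexI[of _ "(a, b)"]) simp_all
  qed
  have "AE z in lborel. \<forall>p\<in>I. z \<in> box (fst p) (snd p) \<longrightarrow> V z = 0"
    using AEbox by (intro AE_ball_countable[OF I1, THEN iffD2] ballI) (simp add: I_def)
  then show ?thesis
  proof (rule eventually_mono)
    fix z assume *: "\<forall>p\<in>I. z \<in> box (fst p) (snd p) \<longrightarrow> V z = 0"
    show "z \<in> U \<longrightarrow> v (complex_coords z) = 0"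
    proof
      assume "z \<in> U"
      then obtain p where "p \<in> I" "z \<in> box (fst p) (snd p)" using I3 by blast
      then show "v (complex_coords z) = 0" using bspec[OF *, of p] by (simp add: V_def)
    qed
  qed
qed

text \<open>
  The difference of two weak derivatives of the same function integrates to 0 against every test
  function.
\<close>
lemma weak_partial_unique:
  fixes u v v' :: "coords \<Rightarrow> 'b::{banach, second_countable_topology}"
  assumes U: "open U"
    and v: "weak_partial 2 (complex_coords ` U) i u v" and v': "weak_partial 2 (complex_coords ` U) i u v'"
  shows "AE z in lborel. z \<in> U \<longrightarrow> v (complex_coords z) = v' (complex_coords z)"
proof -
  have loc: "loc_integrable 2 (complex_coords ` U) v" "loc_integrable 2 (complex_coords ` U) v'"
    using v v' by (auto simp: weak_partial_def)
  have "AE z in lborel. z \<in> U \<longrightarrow> v (complex_coords z) - v' (complex_coords z) = 0"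
  proof (rule test_integrals_zero_imp_AE_zero[OF U])
    show "loc_integrable 2 (complex_coords ` U) (\<lambda>y. v y - v' y)"
      using loc unfolding loc_integrable_def by (blast intro: set_integral_diff)
    fix \<eta> assume \<eta>: "test_function 2 (complex_coords ` U) \<eta>"
    then obtain C where C: "compact C" "C \<subseteq> U" "\<And>z. z \<notin> C \<Longrightarrow> \<eta> (complex_coords z) = 0"
      by (rule test_function_planarE) blast
    have "C_diff 2 0 (topspace (Euclidean_space 2)) \<eta>"
      using \<eta> unfolding test_function_def smooth_on_def by blast
    then have cont: "continuous_on UNIV (\<lambda>z. \<eta> (complex_coords z))"
      using continuous_map_complex_coords[of UNIV euclideanreal \<eta>] by (simp add: range_complex_coords)
    have int: "set_integrable (leb 2) (complex_coords ` U) (\<lambda>y. \<eta> y *\<^sub>R w y)"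
      if w: "loc_integrable 2 (complex_coords ` U) w" for w :: "coords \<Rightarrow> 'b"
    proof -
      note CU = C(2)
      then have si: "integrable lborel (\<lambda>z. indicator C z *\<^sub>R w (complex_coords z))"
        using w C(1) unfolding loc_integrable_complex_coords set_integrable_def by blast
      have "compact ((\<lambda>z. \<eta> (complex_coords z)) ` C)"
        using cont C(1) by (meson compact_continuous_image continuous_on_subset top_greatest)
      from compact_imp_bounded[OF this]
      obtain B where "\<forall>x\<in>(\<lambda>z. \<eta> (complex_coords z)) ` C. norm x \<le> B" unfolding bounded_iff by blast
      then have B: "\<And>z. z \<in> C \<Longrightarrow> \<bar>\<eta> (complex_coords z)\<bar> \<le> B" by simp
      have "integrable lborel (\<lambda>z. \<eta> (complex_coords z) *\<^sub>R (indicator C z *\<^sub>R w (complex_coords z)))"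
      proof (rule Bochner_Integration.integrable_bound[OF integrable_norm[OF integrable_scaleR_right[of B, OF si]]])
        show "(\<lambda>z. \<eta> (complex_coords z) *\<^sub>R (indicator C z *\<^sub>R w (complex_coords z))) \<in> borel_measurable lborel"
          using borel_measurable_continuous_onI[OF cont] borel_measurable_integrable[OF si]
          by - (rule borel_measurable_scaleR; simp)
        show "AE z in lborel. norm (\<eta> (complex_coords z) *\<^sub>R (indicator C z *\<^sub>R w (complex_coords z)))
            \<le> norm (norm (B *\<^sub>R (indicator C z *\<^sub>R w (complex_coords z))))"
        proof (rule AE_I2)
          fix z show "norm (\<eta> (complex_coords z) *\<^sub>R (indicator C z *\<^sub>R w (complex_coords z)))
            \<le> norm (norm (B *\<^sub>R (indicator C z *\<^sub>R w (complex_coords z))))"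
          proof (cases "z \<in> C")
            case True
            from B[OF True] have "\<bar>\<eta> (complex_coords z)\<bar> * norm (w (complex_coords z)) \<le> \<bar>B\<bar> * norm (w (complex_coords z))"
              by (intro mult_right_mono) auto
            then show ?thesis using True by simp
          qed simp
        qed
      qed
      moreover have "(\<lambda>z. \<eta> (complex_coords z) *\<^sub>R (indicator C z *\<^sub>R w (complex_coords z)))
          = (\<lambda>z. indicator U z *\<^sub>R (\<eta> (complex_coords z) *\<^sub>R w (complex_coords z)))"
      proof (rule ext)
        fix z show "\<eta> (complex_coords z) *\<^sub>R (indicator C z *\<^sub>R w (complex_coords z))
          = indicator U z *\<^sub>R (\<eta> (complex_coords z) *\<^sub>R w (complex_coords z))"
          using C(3)[of z] CU by (cases "z \<in> C") (auto simp: indicator_def)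
      qed
      ultimately have "integrable lborel (\<lambda>z. indicator U z *\<^sub>R (\<eta> (complex_coords z) *\<^sub>R w (complex_coords z)))"
        by (simp only:)
      then have "set_integrable lborel U (\<lambda>z. \<eta> (complex_coords z) *\<^sub>R w (complex_coords z))"
        by (simp only: set_integrable_def)
      then show ?thesis
        by (rule iffD2[OF set_integrable_leb_2[OF borel_open[OF U], of "\<lambda>y. \<eta> y *\<^sub>R w y"]])
    qed
    have "(LINT y:complex_coords ` U|leb 2. \<eta> y *\<^sub>R v y) = (LINT y:complex_coords ` U|leb 2. \<eta> y *\<^sub>R v' y)"
      using mp[OF spec[OF conjunct2[OF conjunct2[OF v[unfolded weak_partial_def]]]] \<eta>]
        mp[OF spec[OF conjunct2[OF conjunct2[OF v'[unfolded weak_partial_def]]]] \<eta>]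
      by (simp only: neg_equal_iff_equal)
    then show "(LINT y:complex_coords ` U|leb 2. \<eta> y *\<^sub>R (v y - v' y)) = 0"
      using set_integral_diff(2)[OF int[OF loc(1)] int[OF loc(2)]] by (simp add: scaleR_diff_right)
  qed
  then show ?thesis by simp
qed

subsection \<open>Classical derivatives are weak derivatives\<close>

text \<open>
  Translation invariance makes the difference quotients of g integrate to zero, and by dominated
  convergence so does the directional derivative.
\<close>
lemma integral_directional_derivative_eq_0:
  fixes g g' :: "complex \<Rightarrow> 'b::{banach, second_countable_topology}"
  assumes C: "compact C" and g0: "\<And>z. z \<notin> C \<Longrightarrow> g z = 0" and g'0: "\<And>z. z \<notin> C \<Longrightarrow> g' z = 0"
    and g: "continuous_on UNIV g" and g': "continuous_on UNIV g'"
    and d: "\<And>z. ((\<lambda>s. g (z + s *\<^sub>R e)) has_vector_derivative g' z) (at 0)"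
  shows "(LINT z|lborel. g' z) = 0"
proof -
  have "compact (g' ` C)" using g' C by (meson compact_continuous_image continuous_on_subset top_greatest)
  then obtain B0 where "\<And>z. z \<in> C \<Longrightarrow> norm (g' z) \<le> B0"
    by (metis compact_imp_bounded bounded_iff image_eqI)
  then have B: "norm (g' z) \<le> max B0 0" for z using g'0[of z] by (cases "z \<in> C") fastforce+
  obtain R where R: "\<And>z. z \<in> C \<Longrightarrow> norm z \<le> R"
    using compact_imp_bounded[OF C] by (auto simp: bounded_iff)
  \<comment> \<open>Contains the supports of all difference quotients of step at most 1, so a constant on D dominates them.\<close>
  define D where "D = cball (0::complex) (R + norm e)"
  have int: "integrable lborel g"
  proof -
    have "(\<lambda>z. indicator C z *\<^sub>R g z) = g" using g0 by (auto simp: indicator_def fun_eq_iff)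
    then show ?thesis
      using borel_integrable_compact[OF C continuous_on_subset[OF g]] by simp
  qed
  have shift: "integrable lborel (\<lambda>z. g (z + c))" "(LINT z|lborel. g (z + c)) = (LINT z|lborel. g z)" for c
  proof -
    have "integrable (distr lborel borel ((+) c)) g" using int by (simp add: lborel_distr_plus)
    then show "integrable lborel (\<lambda>z. g (z + c))"
      by (subst (asm) integrable_distr_eq) (auto simp: borel_measurable_continuous_onI[OF g] add.commute)
    have "(LINT z|lborel. g z) = (LINT z|distr lborel borel ((+) c). g z)" by (simp add: lborel_distr_plus)
    also have "\<dots> = (LINT z|lborel. g (c + z))"
      by (rule integral_distr) (auto simp: borel_measurable_continuous_onI[OF g])
    finally show "(LINT z|lborel. g (z + c)) = (LINT z|lborel. g z)" by (simp add: add.commute)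
  qed
  define q where "q n z = real (Suc n) *\<^sub>R (g (z + (1 / real (Suc n)) *\<^sub>R e) - g z)" for n z
  have q0: "(LINT z|lborel. q n z) = 0" for n
    unfolding q_def using shift int by simp
  have lip: "norm (q n z) \<le> indicator D z *\<^sub>R max B0 0" for n z
  proof (cases "z \<in> D")
    case True
    let ?h = "1 / real (Suc n)"
    have "norm (g (z + ?h *\<^sub>R e) - g (z + 0 *\<^sub>R e)) \<le> max B0 0 * norm (?h - 0)"
    proof (rule differentiable_bound[where S = UNIV and f' = "\<lambda>s t. t *\<^sub>R g' (z + s *\<^sub>R e)"])
      fix s :: real
      have "((\<lambda>s. s - s') has_vector_derivative 1) (at s)" for s'
        by (auto intro!: derivative_eq_intros)
      from vector_diff_chain_at[OF this[of s], of "\<lambda>r. g ((z + s *\<^sub>R e) + r *\<^sub>R e)" "g' (z + s *\<^sub>R e)"]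
      have "((\<lambda>r. g ((z + s *\<^sub>R e) + (r - s) *\<^sub>R e)) has_vector_derivative g' (z + s *\<^sub>R e)) (at s)"
        using d[of "z + s *\<^sub>R e"] by (simp add: o_def)
      then show "((\<lambda>s. g (z + s *\<^sub>R e)) has_derivative (\<lambda>t. t *\<^sub>R g' (z + s *\<^sub>R e))) (at s within UNIV)"
        by (simp add: has_vector_derivative_def algebra_simps)
      show "onorm (\<lambda>t. t *\<^sub>R g' (z + s *\<^sub>R e)) \<le> max B0 0"
        using B by (intro onorm_le) (metis mult.commute mult_left_mono norm_ge_zero norm_scaleR real_norm_def)
    qed auto
    moreover have "norm (q n z) = real (Suc n) * norm (g (z + ?h *\<^sub>R e) - g z)"
      unfolding q_def norm_scaleR by simp
    ultimately show ?thesis using True by (simp add: pos_le_divide_eq mult.commute del: of_nat_Suc)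
  next
    case False
    then have z: "norm z > R + norm e" by (simp add: D_def)
    have "norm ((1 / real (Suc n)) *\<^sub>R e) \<le> norm e"
      by (simp add: divide_le_eq mult_le_cancel_left1)
    then have "norm (z + (1 / real (Suc n)) *\<^sub>R e) > R"
      using z norm_diff_ineq[of z "(1 / real (Suc n)) *\<^sub>R e"] by linarith
    moreover have "norm z > R" using z by (smt (verit) norm_ge_zero)
    ultimately show ?thesis using R g0 False unfolding q_def by (metis diff_zero indicator_simps(2) norm_zero not_less order_refl scaleR_zero_left scaleR_zero_right)
  qed
  have "(\<lambda>n. LINT z|lborel. q n z) \<longlonglongrightarrow> (LINT z|lborel. g' z)"
  proof (rule integral_dominated_convergence[where w = "\<lambda>z. indicator D z *\<^sub>R max B0 0"])
    show "integrable lborel (\<lambda>z. indicat_real D z *\<^sub>R max B0 0)"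
      by (rule borel_integrable_compact) (auto simp: D_def)
    show "AE z in lborel. norm (q n z) \<le> indicator D z *\<^sub>R max B0 0" for n using lip by simp
    show "AE z in lborel. (\<lambda>n. q n z) \<longlonglongrightarrow> g' z"
    proof (rule AE_I2)
      fix z
      have "((\<lambda>s. (g (z + s *\<^sub>R e) - g z) /\<^sub>R s) \<longlongrightarrow> g' z) (at 0)"
      proof -
        have "((\<lambda>s. norm (g (z + s *\<^sub>R e) - g z - s *\<^sub>R g' z) / norm s) \<longlongrightarrow> 0) (at 0)"
          using d[of z] unfolding has_vector_derivative_def has_derivative_at by simp
        moreover have "\<forall>\<^sub>F s in at 0. norm (g (z + s *\<^sub>R e) - g z - s *\<^sub>R g' z) / norm s
            = norm ((g (z + s *\<^sub>R e) - g z) /\<^sub>R s - g' z)"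
        proof (rule eventually_at_filter[THEN iffD2], rule always_eventually, safe)
          fix s :: real assume s: "s \<noteq> 0"
          have "(g (z + s *\<^sub>R e) - g z) /\<^sub>R s - g' z = (1 / s) *\<^sub>R (g (z + s *\<^sub>R e) - g z - s *\<^sub>R g' z)"
            using s by (simp add: scaleR_diff_right divide_inverse)
          then show "norm (g (z + s *\<^sub>R e) - g z - s *\<^sub>R g' z) / norm s
            = norm ((g (z + s *\<^sub>R e) - g z) /\<^sub>R s - g' z)" by simp
        qed
        ultimately have "((\<lambda>s. norm ((g (z + s *\<^sub>R e) - g z) /\<^sub>R s - g' z)) \<longlongrightarrow> 0) (at 0)"
          by (rule Lim_transform_eventually)
        then show ?thesis by (rule LIM_zero_cancel[OF tendsto_norm_zero_cancel])
      qed
      then have "(\<lambda>n. (g (z + (1 / real (Suc n)) *\<^sub>R e) - g z) /\<^sub>R (1 / real (Suc n))) \<longlonglongrightarrow> g' z"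
      proof (rule filterlim_compose)
        have "(\<lambda>n. 1 / real (Suc n)) \<longlonglongrightarrow> 0"
          using LIMSEQ_inverse_real_of_nat by (simp only: inverse_eq_divide)
        then show "filterlim (\<lambda>n. 1 / real (Suc n)) (at 0) sequentially"
          by (simp add: filterlim_at del: of_nat_Suc)
      qed
      then show "(\<lambda>n. q n z) \<longlonglongrightarrow> g' z" by (simp add: q_def)
    qed
    show "q n \<in> borel_measurable lborel" for n
    proof -
      have "continuous_on UNIV (q n)"
        unfolding q_def[abs_def] by (intro continuous_intros continuous_on_compose2[OF g]) auto
      from borel_measurable_continuous_onI[OF this] show ?thesis by simp
    qed
    show "g' \<in> borel_measurable lborel"
      using borel_measurable_continuous_onI[OF g'] by simp
  qed
  then show ?thesis using q0 LIMSEQ_unique[OF _ tendsto_const] by simp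
qed

lemma continuous_on_extend_zero:
  fixes w :: "complex \<Rightarrow> 'b::real_normed_vector"
  assumes U: "open U" and C: "compact C" "C \<subseteq> U" and w: "continuous_on U w"
    and w0: "\<And>z. z \<in> U \<Longrightarrow> z \<notin> C \<Longrightarrow> w z = 0"
  shows "continuous_on UNIV (\<lambda>z. if z \<in> U then w z else 0)" (is "continuous_on _ ?w")
proof -
  have "continuous_on U ?w" by (rule continuous_on_eq[OF w]) auto
  moreover have "continuous_on (- C) ?w"
    by (rule continuous_on_eq[OF continuous_on_const[of _ 0]]) (use w0 in auto)
  ultimately have "continuous_on (U \<union> - C) ?w"
    using U C(1) by (intro continuous_on_open_Un) (auto intro: compact_imp_closed open_Compl)
  moreover have "U \<union> - C = UNIV" using C(2) by auto
  ultimately show ?thesis by simp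
qed

lemma loc_integrable_continuous:
  fixes u :: "coords \<Rightarrow> 'b::{banach, second_countable_topology}"
  assumes "continuous_on U (\<lambda>z. u (complex_coords z))"
  shows "loc_integrable 2 (complex_coords ` U) u"
  unfolding loc_integrable_complex_coords set_integrable_def
  by (intro allI impI borel_integrable_compact continuous_on_subset[OF assms])

text \<open>
  Integration by parts: the product of u with a test function extends by zero to a compactly supported
  function on the whole plane, and the integral of its directional derivative vanishes.
\<close>
lemma weak_partialI:
  fixes u v :: "coords \<Rightarrow> 'b::{banach, second_countable_topology}"
  assumes U: "open U" and i: "i < 2"
    and u: "continuous_on U (\<lambda>z. u (complex_coords z))" and v: "continuous_on U (\<lambda>z. v (complex_coords z))"
    and d: "\<And>z. z \<in> U \<Longrightarrow>
      ((\<lambda>s. u ((complex_coords z)(i := s))) has_vector_derivative v (complex_coords z)) (at (complex_coords z i))"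
  shows "weak_partial 2 (complex_coords ` U) i u v"
  unfolding weak_partial_def
proof (intro conjI allI impI)
  show "loc_integrable 2 (complex_coords ` U) u" "loc_integrable 2 (complex_coords ` U) v"
    using u v by (auto intro: loc_integrable_continuous)
  fix \<eta> assume \<eta>: "test_function 2 (complex_coords ` U) \<eta>"
  then obtain C where C: "compact C" and CU: "C \<subseteq> U" and C0: "\<And>z. z \<notin> C \<Longrightarrow> \<eta> (complex_coords z) = 0"
    by (rule test_function_planarE) blast
  define h where "h z = \<eta> (complex_coords z)" for z
  define h' where "h' z = partial i \<eta> (complex_coords z)" for z
  have sm: "C_diff 2 (Suc 0) (topspace (Euclidean_space 2)) \<eta>"
    using \<eta> unfolding test_function_def smooth_on_def by blast
  have "continuous_map (subtopology (Euclidean_space 2) (range complex_coords)) euclideanreal \<eta>"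
    "continuous_map (subtopology (Euclidean_space 2) (range complex_coords)) euclideanreal (partial i \<eta>)"
    using sm i by (simp_all add: range_complex_coords)
  then have hc: "continuous_on UNIV h" "continuous_on UNIV h'"
    unfolding continuous_map_complex_coords h_def[abs_def] h'_def[abs_def] by simp_all
  have line: "((\<lambda>s. h (z + s *\<^sub>R axis_dir i)) has_real_derivative h' z) (at 0)" for z
  proof -
    have "(\<lambda>s. \<eta> ((complex_coords z)(i := s))) differentiable (at (complex_coords z i))"
      using sm i by simp
    then have "((\<lambda>s. \<eta> ((complex_coords z)(i := s))) has_real_derivative h' z) (at (0 + complex_coords z i))"
      unfolding h'_def partial_def by (simp add: DERIV_deriv_iff_real_differentiable)
    from this[unfolded DERIV_shift] show ?thesis
      using i by (simp add: complex_coords_update h_def)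
  qed
  have h0: "h z = 0" if "z \<notin> C" for z
    using C0 that by (simp add: h_def)
  have h'0: "h' z = 0" if z: "z \<notin> C" for z
  proof -
    have "((\<lambda>s. h (z + s *\<^sub>R axis_dir i)) has_real_derivative 0) (at 0)"
    proof (rule has_field_derivative_transform_within_open[of "\<lambda>_. 0" _ _ "(\<lambda>s. z + s *\<^sub>R axis_dir i) -` (- C)"])
      show "open ((\<lambda>s. z + s *\<^sub>R axis_dir i) -` (- C))"
        using C by (intro continuous_open_vimage continuous_intros) (auto intro: compact_imp_closed)
    qed (use z h0 in auto)
    then show ?thesis using line[of z] DERIV_unique by blast
  qed
  \<comment> \<open>A + B is the product rule for g = h u, extended by zero outside U.\<close>
  define A where "A z = (if z \<in> U then h' z *\<^sub>R u (complex_coords z) else 0)" for z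
  define B where "B z = (if z \<in> U then h z *\<^sub>R v (complex_coords z) else 0)" for z
  define g where "g z = (if z \<in> U then h z *\<^sub>R u (complex_coords z) else 0)" for z
  have cA: "continuous_on UNIV A" unfolding A_def[abs_def]
    by (rule continuous_on_extend_zero[OF U C CU])
       (use h'0 u hc in \<open>auto intro!: continuous_intros intro: continuous_on_subset\<close>)
  have cB: "continuous_on UNIV B" unfolding B_def[abs_def]
    by (rule continuous_on_extend_zero[OF U C CU])
       (use h0 v hc in \<open>auto intro!: continuous_intros intro: continuous_on_subset\<close>)
  have cg: "continuous_on UNIV g" unfolding g_def[abs_def]
    by (rule continuous_on_extend_zero[OF U C CU])
       (use h0 u hc in \<open>auto intro!: continuous_intros intro: continuous_on_subset\<close>)
  have z: "A z = 0" "B z = 0" "g z = 0" if "z \<notin> C" for z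
    using h0[OF that] h'0[OF that] by (auto simp: A_def B_def g_def)
  have int: "integrable lborel w" if "continuous_on UNIV w" "\<And>z. z \<notin> C \<Longrightarrow> w z = 0" for w :: "complex \<Rightarrow> 'b"
  proof -
    have "(\<lambda>z. indicator C z *\<^sub>R w z) = w" using that(2) by (auto simp: indicator_def fun_eq_iff)
    then show ?thesis
      using borel_integrable_compact[OF C continuous_on_subset[OF that(1)]] by simp
  qed
  have "(LINT z|lborel. A z + B z) = 0"
  proof (rule integral_directional_derivative_eq_0[OF C, of g _ "axis_dir i"])
    show "continuous_on UNIV (\<lambda>z. A z + B z)" using cA cB by (intro continuous_intros)
    fix z show "((\<lambda>s. g (z + s *\<^sub>R axis_dir i)) has_vector_derivative A z + B z) (at 0)"
    proof (cases "z \<in> U")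
      case True
      let ?S = "(\<lambda>s. z + s *\<^sub>R axis_dir i) -` U"
      have S: "open ?S" using U by (intro continuous_open_vimage continuous_intros) auto
      have sh: "((\<lambda>s. complex_coords z i + s) has_vector_derivative 1) (at 0)"
        by (auto intro!: derivative_eq_intros)
      have "((\<lambda>s. u (complex_coords (z + s *\<^sub>R axis_dir i))) has_vector_derivative v (complex_coords z)) (at 0)"
        using vector_diff_chain_at[OF sh, of "\<lambda>s. u ((complex_coords z)(i := s))" "v (complex_coords z)"]
          d[OF True] i by (simp add: o_def complex_coords_update)
      from has_vector_derivative_scaleR[OF line[of z] this]
      have "((\<lambda>s. h (z + s *\<^sub>R axis_dir i) *\<^sub>R u (complex_coords (z + s *\<^sub>R axis_dir i)))
          has_vector_derivative A z + B z) (at 0)"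
        using True by (simp add: A_def B_def add.commute)
      then show ?thesis
        by (rule has_vector_derivative_transform_within_open[OF _ S]) (use True in \<open>auto simp: g_def\<close>)
    next
      case False
      let ?S = "(\<lambda>s. z + s *\<^sub>R axis_dir i) -` (- C)"
      have S: "open ?S"
        using C by (intro continuous_open_vimage continuous_intros) (auto intro: compact_imp_closed)
      have "((\<lambda>_. 0) has_vector_derivative A z + B z) (at 0)"
        using False CU z by (simp add: A_def B_def)
      then show ?thesis
        by (rule has_vector_derivative_transform_within_open[OF _ S]) (use z False CU in auto)
    qed
  qed (use z cg in auto)
  then have "(LINT z|lborel. A z) = - (LINT z|lborel. B z)"
    using int[OF cA z(1)] int[OF cB z(2)] by (simp add: eq_neg_iff_add_eq_0)
  moreover have "(LINT y:complex_coords ` U|leb 2. partial i \<eta> y *\<^sub>R u y) = (LINT z|lborel. A z)"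
    using U by (simp add: set_integral_leb_2 borel_open, unfold set_lebesgue_integral_def)
      (auto simp: A_def h'_def indicator_def intro!: Bochner_Integration.integral_cong)
  moreover have "(LINT y:complex_coords ` U|leb 2. \<eta> y *\<^sub>R v y) = (LINT z|lborel. B z)"
    using U by (simp add: set_integral_leb_2 borel_open, unfold set_lebesgue_integral_def)
      (auto simp: B_def h_def indicator_def intro!: Bochner_Integration.integral_cong)
  ultimately show "(LINT y:complex_coords ` U|leb 2. partial i \<eta> y *\<^sub>R u y)
      = - (LINT y:complex_coords ` U|leb 2. \<eta> y *\<^sub>R v y)" by simp
qed

lemma weak_partial_grad_deriv:
  fixes u a b :: "complex \<Rightarrow> 'b::{banach, second_countable_topology}"
  assumes U: "open U" and d: "\<And>z. z \<in> U \<Longrightarrow> grad_deriv u z (a z) (b z)"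
    and ab: "continuous_on U a" "continuous_on U b" and i: "i < 2"
    and fu: "\<And>z. z \<in> U \<Longrightarrow> fu (complex_coords z) = u z"
    and fv: "\<And>z. z \<in> U \<Longrightarrow> fv (complex_coords z) = (if i = 0 then a z else b z)"
  shows "weak_partial 2 (complex_coords ` U) i fu fv"
proof (rule weak_partialI[OF U i])
  have "continuous_on U u"
    using d unfolding grad_deriv_def by (meson continuous_at_imp_continuous_on has_derivative_continuous)
  then show "continuous_on U (\<lambda>z. fu (complex_coords z))" using fu by (simp cong: continuous_on_cong)
  have "continuous_on U (\<lambda>z. if i = 0 then a z else b z)" using ab by (cases "i = 0") simp_all
  then show "continuous_on U (\<lambda>z. fv (complex_coords z))" using fv by (simp cong: continuous_on_cong)
  fix z assume z: "z \<in> U"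
  let ?x = "complex_coords z"
  let ?S = "(\<lambda>s. z + (s - ?x i) *\<^sub>R axis_dir i) -` U"
  have S: "open ?S" using U by (intro continuous_open_vimage continuous_intros) auto
  have "((\<lambda>s. u (cpoint (?x(i := s)))) has_vector_derivative fv ?x) (at (?x i))"
    using grad_deriv_coord_line[of u z "\<lambda>j. if j = 0 then a z else b z" i] d[OF z] i fv[OF z] by simp
  then show "((\<lambda>s. fu (?x(i := s))) has_vector_derivative fv ?x) (at (?x i))"
    by (rule has_vector_derivative_transform_within_open[OF _ S])
       (use z i fu in \<open>auto simp: complex_coords_update\<close>)
qed

section \<open>Topology and holomorphic maps of the sphere\<close>

lemma sphere_param_simps:
  "sphere_param 0 z = Some z" "sphere_param (Suc 0) z = (if z = 0 then None else Some (1 / z))"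
  by (auto simp: sphere_param_def)

text \<open>
  The neighbourhoods of infinity in the one-point compactification contain the complement of a disc,
  because compact sets of the plane are bounded.
\<close>
lemma openin_sphere_at_infinity:
  "openin sphere_top V \<longleftrightarrow> open (Some -` V) \<and> (None \<in> V \<longrightarrow> (\<exists>R. \<forall>z. cmod z > R \<longrightarrow> Some z \<in> V))"
proof
  assume "openin sphere_top V"
  then consider U where "open U" "V = Some ` U" | C where "compact C" "closed C" "V = insert None (Some ` (UNIV - C))"
    by (auto simp: openin_Alexandroff_compactification)
  then show "open (Some -` V) \<and> (None \<in> V \<longrightarrow> (\<exists>R. \<forall>z. cmod z > R \<longrightarrow> Some z \<in> V))"
  proof cases
    case 1
    then show ?thesis by (auto simp: inj_vimage_image_eq)
  next
    case 2
    then have "Some -` V = - C" by auto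
    moreover obtain R where "\<forall>z\<in>C. cmod z \<le> R" using compact_imp_bounded[OF 2(1)] by (auto simp: bounded_iff)
    ultimately show ?thesis using 2 by (auto intro!: exI[of _ R]) force
  qed
next
  assume *: "open (Some -` V) \<and> (None \<in> V \<longrightarrow> (\<exists>R. \<forall>z. cmod z > R \<longrightarrow> Some z \<in> V))"
  show "openin sphere_top V"
  proof (cases "None \<in> V")
    case False
    have "V = Some ` (Some -` V)"
    proof (rule Set.set_eqI)
      fix x show "x \<in> V \<longleftrightarrow> x \<in> Some ` (Some -` V)" using False by (cases x) auto
    qed
    then show ?thesis using * by (metis openin_Alexandroff_compactification open_openin)
  next
    case True
    with * obtain R where R: "\<And>z. cmod z > R \<Longrightarrow> Some z \<in> V" by blast
    define C where "C = - (Some -` V)"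
    have "closed C" using * by (simp add: C_def closed_Compl)
    moreover have "bounded C" unfolding bounded_iff C_def using R by (metis ComplD not_le vimageI)
    moreover have "V = insert None (Some ` (UNIV - C))"
    proof (rule Set.set_eqI)
      fix x show "x \<in> V \<longleftrightarrow> x \<in> insert None (Some ` (UNIV - C))" using True by (cases x) (auto simp: C_def)
    qed
    ultimately show ?thesis
      unfolding openin_Alexandroff_compactification
      by (metis closed_closedin compact_eq_bounded_closed compactin_euclidean_iff topspace_euclidean)
  qed
qed

lemma continuous_on_inverse_complex: "continuous_on (- {0}) (\<lambda>z::complex. 1 / z)"
  by (auto intro!: continuous_intros)

lemma open_inverse_preimage: "open U \<Longrightarrow> open {z::complex. z \<noteq> 0 \<and> 1 / z \<in> U}"
proof -
  assume U: "open U"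
  have "open (- {0::complex} \<inter> (\<lambda>z. 1 / z) -` U)"
    by (rule continuous_open_preimage[OF continuous_on_inverse_complex _ U]) auto
  moreover have "- {0::complex} \<inter> (\<lambda>z. 1 / z) -` U = {z. z \<noteq> 0 \<and> 1 / z \<in> U}" by auto
  ultimately show ?thesis by simp
qed

text \<open>The two charts determine the topology, so continuity can be checked chart by chart.\<close>
lemma openin_sphere: "openin sphere_top V \<longleftrightarrow> (\<forall>i<2. open (sphere_param i -` V))"
proof -
  have "open (sphere_param 1 -` V) \<longleftrightarrow> (None \<in> V \<longrightarrow> (\<exists>R. \<forall>z. cmod z > R \<longrightarrow> Some z \<in> V))"
    if o: "open (Some -` V)"
  proof -
    have e: "sphere_param 1 -` V = {z. z \<noteq> 0 \<and> 1 / z \<in> Some -` V} \<union> (if None \<in> V then {0} else {})"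
      by (auto simp: sphere_param_simps split: if_splits)
    show ?thesis
    proof (cases "None \<in> V")
      case False
      then show ?thesis using e open_inverse_preimage[OF o] by simp
    next
      case True
      show ?thesis
      proof
        assume "open (sphere_param 1 -` V)"
        moreover have "0 \<in> sphere_param 1 -` V" using True by (simp add: sphere_param_simps)
        ultimately obtain d where d: "d > 0" "ball 0 d \<subseteq> sphere_param 1 -` V" by (meson openE)
        have "Some z \<in> V" if "cmod z > 1 / d" for z
        proof -
          have "cmod (1 / z) < d" "z \<noteq> 0"
            using that d(1) by (auto simp: norm_divide divide_simps mult.commute split: if_splits)
          then have "1 / z \<in> sphere_param 1 -` V" using d(2) by auto
          then show ?thesis using \<open>z \<noteq> 0\<close> by (simp add: sphere_param_simps)
        qed
        then show "None \<in> V \<longrightarrow> (\<exists>R. \<forall>z. cmod z > R \<longrightarrow> Some z \<in> V)" by blast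
      next
        assume "None \<in> V \<longrightarrow> (\<exists>R. \<forall>z. cmod z > R \<longrightarrow> Some z \<in> V)"
        with True obtain R where R: "\<And>z. cmod z > R \<Longrightarrow> Some z \<in> V" by blast
        define d where "d = 1 / (\<bar>R\<bar> + 1)"
        have d: "d > 0" by (simp add: d_def)
        have "ball 0 d \<subseteq> sphere_param 1 -` V"
        proof
          fix z :: complex assume "z \<in> ball 0 d"
          then have z: "cmod z * (\<bar>R\<bar> + 1) < 1" by (simp add: d_def field_simps)
          show "z \<in> sphere_param 1 -` V"
          proof (cases "z = 0")
            case False
            have "R < cmod (1 / z)"
              using z False by (simp add: norm_divide pos_less_divide_eq)
                 (smt (verit) mult.commute mult_left_mono norm_ge_zero distrib_left)
            then show ?thesis using R False by (simp add: sphere_param_simps)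
          qed (use True in \<open>simp add: sphere_param_simps\<close>)
        qed
        then have "sphere_param 1 -` V = {z. z \<noteq> 0 \<and> 1 / z \<in> Some -` V} \<union> ball 0 d"
          using e d by auto
        then show "open (sphere_param 1 -` V)" using open_inverse_preimage[OF o] by auto
      qed
    qed
  qed
  moreover have "sphere_param 0 -` V = Some -` V" by (auto simp: sphere_param_simps)
  ultimately show ?thesis
    unfolding openin_sphere_at_infinity by (auto simp: numeral_2_eq_2 less_Suc_eq)
qed

lemma continuous_map_from_sphere:
  "continuous_map sphere_top X f \<longleftrightarrow> (\<forall>i<2. continuous_map euclidean X (\<lambda>z. f (sphere_param i z)))"
proof -
  have "(\<forall>x. f x \<in> topspace X) \<longleftrightarrow> (\<forall>i<2. \<forall>z. f (sphere_param i z) \<in> topspace X)"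
  proof safe
    fix x assume *: "\<forall>i<2. \<forall>z. f (sphere_param i z) \<in> topspace X"
    show "f x \<in> topspace X"
    proof (cases x)
      case None
      then show ?thesis using *[rule_format, of 1 0] by (simp add: sphere_param_simps)
    next
      case (Some z)
      then show ?thesis using *[rule_format, of 0 z] by (simp add: sphere_param_simps)
    qed
  qed auto
  then show ?thesis
    unfolding continuous_map_def by (auto simp: openin_sphere vimage_def)
qed

lemma continuous_map_sphere_param: "continuous_map euclidean sphere_top (sphere_param i)"
proof -
  have "i < 2 \<Longrightarrow> ?thesis"
    using continuous_map_from_sphere[of sphere_top id] by (simp add: continuous_map_id[unfolded id_def] id_def)
  moreover have "\<not> i < 2 \<Longrightarrow> sphere_param i = sphere_param 1" by (auto simp: sphere_param_def fun_eq_iff)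
  moreover have "continuous_map euclidean sphere_top (sphere_param 1)"
    using continuous_map_from_sphere[of sphere_top id] by (simp add: continuous_map_id[unfolded id_def] id_def)
  ultimately show ?thesis by metis
qed

lemma openin_sphere_param_image:
  assumes "open U" "i < 2" shows "openin sphere_top (sphere_param i ` U)"
proof -
  have "open (sphere_param j -` sphere_param i ` U)" if j: "j < 2" for j
  proof (cases "i = j")
    case True
    then have "sphere_param j -` sphere_param i ` U = U" by auto
    with assms show ?thesis by simp
  next
    case False
    have "sphere_param j -` sphere_param i ` U = {z. z \<noteq> 0 \<and> 1 / z \<in> U}"
    proof (rule Set.set_eqI)
      fix z
      have "sphere_param j z = sphere_param i w \<longleftrightarrow> z \<noteq> 0 \<and> w = 1 / z" for w
      proof -
        consider "i = 0" "j = 1" | "i = 1" "j = 0" using False j assms(2) by linarith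
        then show ?thesis
        proof cases
          case 1
          then show ?thesis by (cases "z = 0") (auto simp: sphere_param_def)
        next
          case 2
          then show ?thesis by (cases "w = 0") (auto simp: sphere_param_def)
        qed
      qed
      then show "z \<in> sphere_param j -` sphere_param i ` U \<longleftrightarrow> z \<in> {z. z \<noteq> 0 \<and> 1 / z \<in> U}"
        by (auto simp: image_iff)
    qed
    then show ?thesis using open_inverse_preimage[OF assms(1)] by simp
  qed
  then show ?thesis by (simp add: openin_sphere)
qed

lemma range_sphere_param: "range (sphere_param i) = dom riemann_sphere i"
  by (metis (no_types, lifting) Set.set_eqI imageE rangeI sphere_param_coord sphere_param_in_dom)

lemma openin_dom: "openin sphere_top (dom riemann_sphere i)"
proof -
  have "dom riemann_sphere i = sphere_param (if i = 0 then 0 else 1) ` UNIV"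
    by (subst range_sphere_param) auto
  then show ?thesis using openin_sphere_param_image[OF open_UNIV, of "if i = 0 then 0 else 1"] by simp
qed

lemma homeomorphic_map_sphere_param:
  assumes "i < 2"
  shows "homeomorphic_map euclidean (subtopology sphere_top (dom riemann_sphere i)) (sphere_param i)"
proof -
  have "embedding_map euclidean sphere_top (sphere_param i)"
  proof (rule injective_open_imp_embedding_map[OF continuous_map_sphere_param])
    show "open_map euclidean sphere_top (sphere_param i)"
      using openin_sphere_param_image assms by (auto simp: open_map_def)
  qed (auto simp: inj_on_def)
  then show ?thesis unfolding embedding_map_def range_sphere_param[symmetric] by simp
qed

lemma homeomorphic_map_coord:
  assumes "i < 2"
  shows "homeomorphic_map (subtopology sphere_top (dom riemann_sphere i))
      (subtopology (Euclidean_space 2) (coord riemann_sphere i ` dom riemann_sphere i)) (coord riemann_sphere i)"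
proof -
  have "homeomorphic_maps euclidean (subtopology sphere_top (dom riemann_sphere i)) (sphere_param i) (sphere_coord i)"
  proof -
    from homeomorphic_map_sphere_param[OF assms]
    obtain g where g: "homeomorphic_maps euclidean (subtopology sphere_top (dom riemann_sphere i)) (sphere_param i) g"
      unfolding homeomorphic_map_maps by blast
    have "g x = sphere_coord i x" if "x \<in> dom riemann_sphere i" for x
      using g sphere_param_coord[OF that] unfolding homeomorphic_maps_def
      by (metis UNIV_I topspace_euclidean)
    then show ?thesis
      by (intro homeomorphic_maps_eq[OF g]) (auto simp del: riemann_sphere_simps)
  qed
  then have "homeomorphic_map (subtopology sphere_top (dom riemann_sphere i)) euclidean (sphere_coord i)"
    using homeomorphic_maps_map homeomorphic_maps_sym by blast
  from homeomorphic_map_compose[OF this homeomorphic_map_complex_coords]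
  show ?thesis
    unfolding coord_image_dom_UNIV range_complex_coords
    by (simp add: o_def del: riemann_sphere_simps(4)) (simp add: riemann_sphere_def o_def)
qed

text \<open>The point with homogeneous coordinates [P : Q].\<close>
definition hpoint :: "complex \<Rightarrow> complex \<Rightarrow> complex option" where
  "hpoint P Q = (if Q = 0 then None else Some (P / Q))"

lemma sphere_param_hpoint: "sphere_param 0 z = hpoint z 1" "sphere_param (Suc 0) z = hpoint 1 z"
  by (auto simp: sphere_param_simps hpoint_def)

lemma sphere_coord_hpoint:
  "sphere_coord 0 (hpoint P Q) = P / Q" "sphere_coord (Suc 0) (hpoint P Q) = Q / P"
  by (auto simp: sphere_coord_def hpoint_def)

lemma continuous_map_hpoint:
  assumes "continuous_on UNIV P" "continuous_on UNIV Q" "\<And>z::complex. P z \<noteq> 0 \<or> Q z \<noteq> 0"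
  shows "continuous_map euclidean sphere_top (\<lambda>z. hpoint (P z) (Q z))"
  unfolding continuous_map_def
proof (intro conjI allI impI)
  fix V assume "openin sphere_top V"
  then have o: "open (sphere_param 0 -` V)" "open (sphere_param 1 -` V)" by (auto simp: openin_sphere)
  have nz: "open (- (P -` {0}))" "open (- (Q -` {0}))"
    using assms(1,2) by (auto intro!: open_Compl continuous_closed_vimage simp: continuous_on_eq_continuous_at)
  have "open (- (Q -` {0}) \<inter> (\<lambda>z. P z / Q z) -` (sphere_param 0 -` V))"
    by (rule continuous_open_preimage[OF _ nz(2) o(1)])
       (auto intro!: continuous_intros continuous_on_subset[OF assms(1)] continuous_on_subset[OF assms(2)])
  moreover have "open (- (P -` {0}) \<inter> (\<lambda>z. Q z / P z) -` (sphere_param 1 -` V))"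
    by (rule continuous_open_preimage[OF _ nz(1) o(2)])
       (auto intro!: continuous_intros continuous_on_subset[OF assms(1)] continuous_on_subset[OF assms(2)])
  moreover have "{x. hpoint (P x) (Q x) \<in> V} = (- (Q -` {0}) \<inter> (\<lambda>z. P z / Q z) -` (sphere_param 0 -` V))
      \<union> (- (P -` {0}) \<inter> (\<lambda>z. Q z / P z) -` (sphere_param 1 -` V))"
    using assms(3) by (auto simp: hpoint_def sphere_param_simps)
  ultimately show "openin euclidean {x \<in> topspace euclidean. hpoint (P x) (Q x) \<in> V}" by auto
qed auto

definition chart_expr :: "(complex option \<Rightarrow> complex option) \<Rightarrow> nat \<Rightarrow> nat \<Rightarrow> complex \<Rightarrow> complex" where
  "chart_expr f i j z = sphere_coord j (f (sphere_param i z))"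

definition chart_dom :: "(complex option \<Rightarrow> complex option) \<Rightarrow> nat \<Rightarrow> nat \<Rightarrow> complex set" where
  "chart_dom f i j = {z. f (sphere_param i z) \<in> dom riemann_sphere j}"

definition sphere_holomorphic :: "(complex option \<Rightarrow> complex option) \<Rightarrow> bool" where
  "sphere_holomorphic f \<longleftrightarrow> continuous_map sphere_top sphere_top f \<and>
     (\<forall>i<2. \<forall>j<2. chart_expr f i j holomorphic_on chart_dom f i j)"

lemma open_chart_dom:
  assumes "continuous_map sphere_top sphere_top f" shows "open (chart_dom f i j)"
  using continuous_map_compose[OF continuous_map_sphere_param[of i] assms] openin_dom[of j]
  unfolding chart_dom_def continuous_map_def o_def by simp

lemma sphere_holomorphic_compose:
  assumes f: "sphere_holomorphic f" and g: "sphere_holomorphic g"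
  shows "sphere_holomorphic (g \<circ> f)"
  unfolding sphere_holomorphic_def
proof (intro conjI allI impI)
  show c: "continuous_map sphere_top sphere_top (g \<circ> f)"
    using f g unfolding sphere_holomorphic_def by (blast intro: continuous_map_compose)
  fix i j :: nat assume ij: "i < 2" "j < 2"
  let ?W = "\<lambda>l. chart_dom f i l \<inter> chart_dom (g \<circ> f) i j"
  have W: "open (?W l)" for l
    using open_chart_dom[of f i l] open_chart_dom[OF c, of i j] f unfolding sphere_holomorphic_def by blast
  have h: "chart_expr (g \<circ> f) i j holomorphic_on ?W l" if l: "l < 2" for l
  proof -
    have "(chart_expr g l j \<circ> chart_expr f i l) holomorphic_on ?W l"
    proof (rule holomorphic_on_compose_gen[where t = "chart_dom g l j"])
      show "chart_expr f i l holomorphic_on ?W l"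
        using f ij l unfolding sphere_holomorphic_def by (blast intro: holomorphic_on_subset)
      show "chart_expr g l j holomorphic_on chart_dom g l j"
        using g ij l unfolding sphere_holomorphic_def by blast
      show "chart_expr f i l ` ?W l \<subseteq> chart_dom g l j"
        by (auto simp: chart_expr_def chart_dom_def sphere_param_coord simp del: riemann_sphere_simps)
    qed
    then show ?thesis
      by (rule holomorphic_transform)
         (auto simp: chart_expr_def chart_dom_def sphere_param_coord simp del: riemann_sphere_simps)
  qed
  have "chart_dom (g \<circ> f) i j = ?W 0 \<union> ?W 1"
    by (auto simp: chart_dom_def)
  then show "chart_expr (g \<circ> f) i j holomorphic_on chart_dom (g \<circ> f) i j"
    using holomorphic_on_Un[OF h[of 0] h[of 1] W W] by simp
qed

text \<open>
  Writing the map in homogeneous coordinates without common zeros avoids the case distinctions on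
  zeros and poles: every expression in charts is a quotient of P and Q or its inverse.
\<close>
lemma sphere_holomorphic_hpoint:
  assumes P: "\<And>i. i < 2 \<Longrightarrow> P i holomorphic_on UNIV" and Q: "\<And>i. i < 2 \<Longrightarrow> Q i holomorphic_on UNIV"
    and nz: "\<And>i z. i < 2 \<Longrightarrow> P i z \<noteq> 0 \<or> Q i z \<noteq> 0"
    and f: "\<And>i z. i < 2 \<Longrightarrow> f (sphere_param i z) = hpoint (P i z) (Q i z)"
  shows "sphere_holomorphic f"
  unfolding sphere_holomorphic_def
proof (intro conjI allI impI)
  show "continuous_map sphere_top sphere_top f"
    unfolding continuous_map_from_sphere
    using P Q nz by (auto simp: f intro!: continuous_map_hpoint holomorphic_on_imp_continuous_on)
  fix i j :: nat assume ij: "i < 2" "j < 2"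
  then consider "j = 0" | "j = 1" by linarith
  then show "chart_expr f i j holomorphic_on chart_dom f i j"
  proof cases
    case 1
    have "chart_dom f i j = {z. Q i z \<noteq> 0}" using nz ij 1 by (auto simp: chart_dom_def f hpoint_def)
    moreover have "(\<lambda>z. P i z / Q i z) holomorphic_on {z. Q i z \<noteq> 0}"
      using P Q ij by (intro holomorphic_intros) (auto intro: holomorphic_on_subset)
    ultimately show ?thesis
      using ij 1 by (simp add: chart_expr_def[abs_def] f sphere_coord_hpoint)
  next
    case 2
    have "chart_dom f i j = {z. P i z \<noteq> 0}" using nz[of i] ij 2 by (auto simp: chart_dom_def f hpoint_def)
    moreover have "(\<lambda>z. Q i z / P i z) holomorphic_on {z. P i z \<noteq> 0}"
      using P Q ij by (intro holomorphic_intros) (auto intro: holomorphic_on_subset)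
    ultimately show ?thesis
      using ij 2 by (simp add: chart_expr_def[abs_def] f sphere_coord_hpoint)
  qed
qed

lemma sphere_holomorphic_id: "sphere_holomorphic (\<lambda>x. x)"
proof (rule sphere_holomorphic_hpoint[where P = "\<lambda>i z. if i = 0 then z else 1" and Q = "\<lambda>i z. if i = 0 then 1 else z"])
  fix i :: nat and z assume "i < 2"
  then show "sphere_param i z = hpoint (if i = 0 then z else 1) (if i = 0 then 1 else z)"
    by (auto simp: sphere_param_hpoint less_2_cases_iff)
  show "(\<lambda>z. if i = 0 then z else 1) holomorphic_on UNIV"
    by (cases "i = 0") (auto intro!: holomorphic_intros)
  show "(\<lambda>z. if i = 0 then 1 else z) holomorphic_on UNIV"
    by (cases "i = 0") (auto intro!: holomorphic_intros)
qed auto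

lemma sphere_holomorphic_funpow:
  assumes "sphere_holomorphic f" shows "sphere_holomorphic (f ^^ k)"
proof (induction k)
  case 0 show ?case using sphere_holomorphic_id by (simp add: id_def)
next
  case (Suc k)
  show ?case unfolding funpow.simps by (rule sphere_holomorphic_compose[OF Suc assms])
qed

lemma grad_deriv_Re_holomorphic:
  assumes "h holomorphic_on U" "open U" "z \<in> U"
  shows "grad_deriv (\<lambda>z. Re (c * h z)) z (Re (c * deriv h z)) (Re (c * \<i> * deriv h z))"
proof -
  have "(h has_field_derivative deriv h z) (at z)" using holomorphic_derivI[OF assms(1,2,3)] by simp
  then have "(h has_derivative (\<lambda>d. deriv h z * d)) (at z)" by (simp add: has_field_derivative_def)
  then have "((\<lambda>z. Re (c * h z)) has_derivative (\<lambda>d. Re (c * (deriv h z * d)))) (at z)"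
    by (auto intro!: derivative_eq_intros)
  then show ?thesis unfolding grad_deriv_def
    by (rule has_derivative_eq_rhs) (auto simp: fun_eq_iff algebra_simps)
qed

text \<open>
  Both coordinates of a holomorphic map have the form Re (c h) with c = 1 or c = - \<i>, and this form
  is preserved by partial derivatives: they multiply the derivative of h by 1 or \<i>.
\<close>
lemma smooth_on_Re_holomorphic:
  assumes "h holomorphic_on U" "open U" "\<And>z. z \<in> U \<Longrightarrow> g (complex_coords z) = Re (c * h z)"
  shows "smooth_on 2 (complex_coords ` U) g"
proof (rule smooth_on_planar_coinduct[where S = "{\<lambda>z. Re (c * h z) | c h. h holomorphic_on U}"])
  fix u assume "u \<in> {\<lambda>z. Re (c * h z) | c h. h holomorphic_on U}"
  then obtain c h where u: "u = (\<lambda>z. Re (c * h z))" "h holomorphic_on U" by blast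
  have dh: "deriv h holomorphic_on U" using u(2) assms(2) by (rule holomorphic_deriv)
  show "\<exists>ux\<in>{\<lambda>z. Re (c * h z) | c h. h holomorphic_on U}. \<exists>uy\<in>{\<lambda>z. Re (c * h z) | c h. h holomorphic_on U}.
      \<forall>z\<in>U. grad_deriv u z (ux z) (uy z)"
  proof (intro bexI ballI)
    show "grad_deriv u z (Re (c * deriv h z)) (Re (c * \<i> * deriv h z))" if "z \<in> U" for z
      unfolding u(1) by (rule grad_deriv_Re_holomorphic[OF u(2) assms(2) that])
    show "(\<lambda>z. Re (c * deriv h z)) \<in> {\<lambda>z. Re (c * h z) | c h. h holomorphic_on U}"
      by (intro CollectI exI[of _ c] exI[of _ "deriv h"] conjI refl dh)
    show "(\<lambda>z. Re (c * \<i> * deriv h z)) \<in> {\<lambda>z. Re (c * h z) | c h. h holomorphic_on U}"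
      by (intro CollectI exI[of _ "c * \<i>"] exI[of _ "deriv h"] conjI refl dh)
  qed
qed (use assms in auto)

section \<open>The sphere as a Riemannian manifold\<close>

lemma complex_coords_component: "a < 2 \<Longrightarrow> complex_coords w a = Re ((if a = 0 then 1 else - \<i>) * w)"
  by (auto simp: complex_coords_def)

text \<open>The real matrix of multiplication by a complex number.\<close>
definition cmat :: "complex \<Rightarrow> real mat" where
  "cmat d = Matrix.mat 2 2 (\<lambda>(a, b). Re ((if a = 0 then 1 else - \<i>) * axis_dir b * d))"

lemma cmat_carrier [simp]: "cmat d \<in> carrier_mat 2 2" "dim_row (cmat d) = 2" "dim_col (cmat d) = 2"
  by (simp_all add: cmat_def)

lemma cmat_index: "cmat d $$ (0, 0) = Re d" "cmat d $$ (0, Suc 0) = - Im d"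
  "cmat d $$ (Suc 0, 0) = Im d" "cmat d $$ (Suc 0, Suc 0) = Re d"
  by (simp_all add: cmat_def axis_dir_def)

lemma cmat_index_gen: "a < 2 \<Longrightarrow> b < 2 \<Longrightarrow>
    cmat d $$ (a, b) = Re ((if a = 0 then 1 else - \<i>) * axis_dir b * d)"
  by (simp add: cmat_def)

lemma det_2:
  assumes "A \<in> carrier_mat 2 2"
  shows "Determinant.det A = A $$ (0, 0) * A $$ (1, 1) - A $$ (0, 1) * A $$ (1, 0)"
proof -
  have "{p. p permutes {0..<2::nat}} = {id, Transposition.transpose 0 1}"
    using permutes_doubleton_iff[of _ "0::nat" 1] by (auto simp: numeral_2_eq_2 atLeast0_lessThan_Suc insert_commute)
  moreover have "(id :: nat \<Rightarrow> nat) \<noteq> Transposition.transpose 0 1"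
    by (metis id_apply transpose_apply_first zero_neq_one)
  ultimately show ?thesis
    using assms by (simp add: Determinant.det_def sign_id sign_swap_id numeral_2_eq_2 atLeast0_lessThan_Suc mult.commute)
qed

lemma det_cmat: "Determinant.det (cmat d) = (cmod d)\<^sup>2"
  unfolding cmod_power2 by (simp add: det_2 cmat_index power2_eq_square)

lemma scalar_prod_2: "w \<in> carrier_vec 2 \<Longrightarrow> scalar_prod v w = vec_index v 0 * vec_index w 0 + vec_index v (Suc 0) * vec_index w (Suc 0)"
  by (simp add: scalar_prod_def numeral_2_eq_2)

lemma mult_mat_vec_2:
  assumes "A \<in> carrier_mat 2 2" "v \<in> carrier_vec 2" "a < 2"
  shows "vec_index (A *\<^sub>v v) a = A $$ (a, 0) * vec_index v 0 + A $$ (a, Suc 0) * vec_index v (Suc 0)"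
proof -
  have "vec_index (A *\<^sub>v v) a = scalar_prod (Matrix.row A a) v" using assms by simp
  also have "\<dots> = A $$ (a, 0) * vec_index v 0 + A $$ (a, Suc 0) * vec_index v (Suc 0)"
    using assms by (simp add: scalar_prod_2)
  finally show ?thesis .
qed

lemma cmat_conformal:
  assumes "v \<in> carrier_vec 2" "w \<in> carrier_vec 2"
  shows "scalar_prod (cmat d *\<^sub>v v) (cmat d *\<^sub>v w) = (cmod d)\<^sup>2 * scalar_prod v w"
proof -
  have "cmat d *\<^sub>v w \<in> carrier_vec 2" using assms by (metis cmat_carrier(1) mult_mat_vec_carrier)
  then show ?thesis
    using assms by (simp add: scalar_prod_2 mult_mat_vec_2 cmat_index cmod_power2 del: index_mult_mat_vec)
      (simp add: power2_eq_square algebra_simps)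
qed

lemma smult_one_mult_vec:
  fixes c :: real
  assumes "v \<in> carrier_vec 2" shows "(c \<cdot>\<^sub>m 1\<^sub>m 2) *\<^sub>v v = c \<cdot>\<^sub>v v"
  using assms by (intro eq_vecI) (auto simp: scalar_prod_2 less_2_cases_iff)

lemma scalar_prod_smult_one:
  fixes c :: real
  assumes "v \<in> carrier_vec 2" "w \<in> carrier_vec 2"
  shows "scalar_prod v ((c \<cdot>\<^sub>m 1\<^sub>m 2) *\<^sub>v w) = c * scalar_prod v w"
  using assms by (simp add: smult_one_mult_vec scalar_prod_2 algebra_simps)

lemma cmat_transpose_smult_cmat:
  "transpose_mat (cmat d) * (c \<cdot>\<^sub>m 1\<^sub>m 2) * cmat d = (c * (cmod d)\<^sup>2) \<cdot>\<^sub>m 1\<^sub>m 2"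
proof -
  have colc: "Matrix.col (cmat d) k \<in> carrier_vec 2" for k by (rule carrier_vecI) simp
  have "transpose_mat (cmat d) * (c \<cdot>\<^sub>m 1\<^sub>m 2) = c \<cdot>\<^sub>m transpose_mat (cmat d)"
    using mult_smult_distrib[of "transpose_mat (cmat d)" 2 2 "1\<^sub>m 2" 2 c]
      right_mult_one_mat[of "transpose_mat (cmat d)" 2 2] by simp
  then have "transpose_mat (cmat d) * (c \<cdot>\<^sub>m 1\<^sub>m 2) * cmat d = c \<cdot>\<^sub>m (transpose_mat (cmat d) * cmat d)"
    using mult_smult_assoc_mat[of "transpose_mat (cmat d)" 2 2 "cmat d" 2 c] by simp
  also have "transpose_mat (cmat d) * cmat d = (cmod d)\<^sup>2 \<cdot>\<^sub>m 1\<^sub>m 2"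
  proof (rule eq_matI)
    fix i j :: nat assume "i < dim_row ((cmod d)\<^sup>2 \<cdot>\<^sub>m 1\<^sub>m 2 :: real mat)" "j < dim_col ((cmod d)\<^sup>2 \<cdot>\<^sub>m 1\<^sub>m 2 :: real mat)"
    then have "i < 2" "j < 2" by simp_all
    then show "(transpose_mat (cmat d) * cmat d) $$ (i, j) = ((cmod d)\<^sup>2 \<cdot>\<^sub>m 1\<^sub>m 2) $$ (i, j)"
      unfolding cmod_power2
      by (auto simp: scalar_prod_2[OF colc] less_2_cases_iff cmat_index power2_eq_square)
  qed simp_all
  also have "c \<cdot>\<^sub>m ((cmod d)\<^sup>2 \<cdot>\<^sub>m 1\<^sub>m 2) = (c * (cmod d)\<^sup>2) \<cdot>\<^sub>m 1\<^sub>m 2"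
    by (rule eq_matI) auto
  finally show ?thesis .
qed

lemma partial_of_Re_holomorphic:
  assumes h: "h holomorphic_on U" "open U" "z \<in> U" and b: "b < 2"
    and F: "\<And>z. z \<in> U \<Longrightarrow> F (complex_coords z) = Re (c * h z)"
  shows "partial b F (complex_coords z) = Re (c * axis_dir b * deriv h z)"
proof -
  let ?x = "complex_coords z"
  let ?S = "(\<lambda>s. z + (s - ?x b) *\<^sub>R axis_dir b) -` U"
  have S: "open ?S" using h(2) by (intro continuous_open_vimage continuous_intros) auto
  have "((\<lambda>s. (\<lambda>z. Re (c * h z)) (cpoint (?x(b := s)))) has_vector_derivative Re (c * axis_dir b * deriv h z)) (at (?x b))"
    using grad_deriv_coord_line[of "\<lambda>z. Re (c * h z)" z "\<lambda>j. Re (c * axis_dir j * deriv h z)" b] b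
      grad_deriv_Re_holomorphic[OF h, of c] by (simp add: axis_dir_def)
  then have "((\<lambda>s. F (?x(b := s))) has_vector_derivative Re (c * axis_dir b * deriv h z)) (at (?x b))"
    by (rule has_vector_derivative_transform_within_open[OF _ S])
       (use h b F in \<open>auto simp: complex_coords_update\<close>)
  then show ?thesis
    unfolding partial_def by (simp add: DERIV_imp_deriv has_real_derivative_iff_has_vector_derivative)
qed

lemma transition_jac_riemann_sphere:
  assumes "i < 2" "j < 2" "x \<in> dom riemann_sphere i" "x \<in> dom riemann_sphere j"
  shows "transition_jac riemann_sphere i j x = cmat (deriv (chart_expr (\<lambda>x. x) i j) (sphere_coord i x))"
proof -
  define z where "z = sphere_coord i x"
  have x: "x = sphere_param i z" using assms(3) by (simp add: z_def sphere_param_coord del: riemann_sphere_simps)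
  have hol: "chart_expr (\<lambda>x. x) i j holomorphic_on chart_dom (\<lambda>x. x) i j"
    and op: "open (chart_dom (\<lambda>x. x) i j)"
    using sphere_holomorphic_id assms(1,2) open_chart_dom unfolding sphere_holomorphic_def by blast+
  have z: "z \<in> chart_dom (\<lambda>x. x) i j" using assms(4) x by (simp add: chart_dom_def del: riemann_sphere_simps)
  have "partial b (\<lambda>y. coord riemann_sphere j (param riemann_sphere i y) a) (complex_coords z)
      = Re ((if a = 0 then 1 else - \<i>) * axis_dir b * deriv (chart_expr (\<lambda>x. x) i j) z)" if "a < 2" "b < 2" for a b
    by (rule partial_of_Re_holomorphic[OF hol op z that(2)])
       (use complex_coords_component[OF that(1)] in \<open>simp add: chart_expr_def\<close>)
  then show ?thesis
    unfolding transition_jac_def cmat_def z_def[symmetric]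
    by (intro cong_mat) (auto simp: z_def)
qed

text \<open>
  An algebra of functions that contains the conformal factor of the spherical metric and is closed
  under partial derivatives, so that the metric is smooth by coinduction.
\<close>
inductive_set spherical_algebra :: "(complex \<Rightarrow> real) set" where
  const: "(\<lambda>_. c) \<in> spherical_algebra"
| Re: "Re \<in> spherical_algebra"
| Im: "Im \<in> spherical_algebra"
| inv: "(\<lambda>z. 1 / (1 + (cmod z)\<^sup>2)) \<in> spherical_algebra"
| add: "u \<in> spherical_algebra \<Longrightarrow> v \<in> spherical_algebra \<Longrightarrow> (\<lambda>z. u z + v z) \<in> spherical_algebra"
| mult: "u \<in> spherical_algebra \<Longrightarrow> v \<in> spherical_algebra \<Longrightarrow> (\<lambda>z. u z * v z) \<in> spherical_algebra"

lemma spherical_algebra_closed_deriv: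
  "u \<in> spherical_algebra \<Longrightarrow> \<exists>ux\<in>spherical_algebra. \<exists>uy\<in>spherical_algebra. \<forall>z. grad_deriv u z (ux z) (uy z)"
proof (induction rule: spherical_algebra.induct)
  case (const c)
  have "grad_deriv (\<lambda>_. c) z 0 0" for z by (simp add: grad_deriv_def)
  then show ?case
    by (intro bexI[of _ "\<lambda>_. 0"]) (auto intro: spherical_algebra.const)
next
  case Re
  have "grad_deriv Re z 1 0" for z
    unfolding grad_deriv_def by (auto intro!: derivative_eq_intros)
  then show ?case
    by (intro bexI[of _ "\<lambda>_. 0"] bexI[of _ "\<lambda>_. 1"]) (auto intro: spherical_algebra.const)
next
  case Im
  have "grad_deriv Im z 0 1" for z
    unfolding grad_deriv_def by (auto intro!: derivative_eq_intros)
  then show ?case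
    by (intro bexI[of _ "\<lambda>_. 0"] bexI[of _ "\<lambda>_. 1"]) (auto intro: spherical_algebra.const)
next
  case inv
  define Q where "Q z = 1 / (1 + (cmod z)\<^sup>2)" for z
  have pos: "1 + ((Re z)\<^sup>2 + (Im z)\<^sup>2) \<noteq> 0" for z by (smt (verit) zero_le_power2)
  have "((\<lambda>z. 1 / (1 + ((Re z)\<^sup>2 + (Im z)\<^sup>2))) has_derivative
      (\<lambda>h. - (2 * Re z * Re h + 2 * Im z * Im h) / (1 + ((Re z)\<^sup>2 + (Im z)\<^sup>2))\<^sup>2)) (at z)" for z
    using pos[of z] by (auto intro!: derivative_eq_intros simp: fun_eq_iff power2_eq_square field_simps)
  then have "grad_deriv Q z (- 2 * Re z * (Q z * Q z)) (- 2 * Im z * (Q z * Q z))" for z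
    unfolding grad_deriv_def Q_def cmod_power2
    by (rule has_derivative_eq_rhs) (auto simp: fun_eq_iff power2_eq_square add_divide_distrib[symmetric] diff_divide_distrib[symmetric] algebra_simps)
  moreover have "(\<lambda>z. - 2 * Re z * (Q z * Q z)) \<in> spherical_algebra" "(\<lambda>z. - 2 * Im z * (Q z * Q z)) \<in> spherical_algebra"
    unfolding Q_def by (intro spherical_algebra.intros)+
  ultimately show ?case unfolding Q_def
    by (intro bexI allI)
next
  case (add u v)
  then obtain ux uy vx vy where m: "ux \<in> spherical_algebra" "uy \<in> spherical_algebra" "vx \<in> spherical_algebra" "vy \<in> spherical_algebra"
    and d: "\<And>z. grad_deriv u z (ux z) (uy z)" "\<And>z. grad_deriv v z (vx z) (vy z)" by blast
  have "grad_deriv (\<lambda>z. u z + v z) z (ux z + vx z) (uy z + vy z)" for z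
    using has_derivative_add[OF d[unfolded grad_deriv_def]] unfolding grad_deriv_def
    by (rule has_derivative_eq_rhs) (auto simp: fun_eq_iff algebra_simps)
  with m show ?case
    by (intro bexI[of _ "\<lambda>z. ux z + vx z"] bexI[of _ "\<lambda>z. uy z + vy z"]) (auto intro: spherical_algebra.add)
next
  case (mult u v)
  then obtain ux uy vx vy where m: "ux \<in> spherical_algebra" "uy \<in> spherical_algebra" "vx \<in> spherical_algebra" "vy \<in> spherical_algebra"
    and d: "\<And>z. grad_deriv u z (ux z) (uy z)" "\<And>z. grad_deriv v z (vx z) (vy z)" by blast
  have "grad_deriv (\<lambda>z. u z * v z) z (u z * vx z + ux z * v z) (u z * vy z + uy z * v z)" for z
    using has_derivative_mult[OF d[unfolded grad_deriv_def]] unfolding grad_deriv_def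
    by (rule has_derivative_eq_rhs) (auto simp: fun_eq_iff algebra_simps)
  with m mult.hyps show ?case
    by (intro bexI[of _ "\<lambda>z. u z * vx z + ux z * v z"] bexI[of _ "\<lambda>z. u z * vy z + uy z * v z"])
       (auto intro!: spherical_algebra.add spherical_algebra.mult)
qed

lemma sphere_density_in_spherical_algebra: "sphere_density \<in> spherical_algebra"
proof -
  have "(\<lambda>z. 4 * ((1 / (1 + (cmod z)\<^sup>2)) * (1 / (1 + (cmod z)\<^sup>2)))) \<in> spherical_algebra"
    by (intro spherical_algebra.intros)
  then show ?thesis by (simp add: sphere_density_def[abs_def] power2_eq_square)
qed

lemma gram_riemann_sphere: "gram riemann_sphere i x = sphere_density (sphere_coord i x) \<cdot>\<^sub>m 1\<^sub>m 2"
  by (simp add: sphere_density_def)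

lemma connected_space_sphere: "connected_space sphere_top"
proof -
  have "connectedin sphere_top (Some ` UNIV)"
    by (rule connectedin_continuous_map_image[OF continuous_map_Some[of euclidean]])
       (use connected_UNIV[where 'a = complex] in \<open>simp only: connectedin_iff_connected\<close>)
  moreover have "\<not> compact_space (euclidean :: complex topology)"
    by (simp add: compact_space_def)
  then have "sphere_top closure_of (Some ` UNIV) = UNIV"
    using Alexandroff_compactification_dense[of "euclidean :: complex topology"] by simp
  ultimately have "connectedin sphere_top UNIV"
    using connectedin_closure_of by metis
  then show ?thesis using connectedin_topspace[of sphere_top] by simp
qed

lemma Hausdorff_space_sphere: "Hausdorff_space sphere_top"
  by (simp add: Hausdorff_space_Alexandroff_compactification Hausdorff_space_euclidean
      locally_compact_space_euclidean)

text \<open>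
  The inversion 1/z is an isometry of the spherical metric; this makes the Gram matrices of the two
  charts compatible.
\<close>
lemma sphere_density_inverse: "z \<noteq> 0 \<Longrightarrow> sphere_density (1 / z) * (cmod (- 1 / z\<^sup>2))\<^sup>2 = sphere_density z"
proof -
  assume "z \<noteq> 0"
  then have r: "cmod z > 0" by simp
  have p: "1 + (cmod z)\<^sup>2 > 0" by (smt (verit) zero_le_power2)
  have "sphere_density (1 / z) = 4 * (cmod z) ^ 4 / (1 + (cmod z)\<^sup>2)\<^sup>2"
    using r p by (simp add: sphere_density_def norm_divide divide_simps power2_eq_square power4_eq_xxxx algebra_simps)
  moreover have "(cmod (- 1 / z\<^sup>2))\<^sup>2 = 1 / (cmod z) ^ 4"
    by (simp add: norm_divide norm_power power_divide power2_eq_square power4_eq_xxxx norm_mult mult.assoc)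
  ultimately show ?thesis using r by (simp add: sphere_density_def)
qed

lemma gram_transition:
  assumes "i < 2" "j < 2" "x \<in> dom riemann_sphere i" "x \<in> dom riemann_sphere j"
  defines "d \<equiv> deriv (chart_expr (\<lambda>x. x) i j) (sphere_coord i x)"
  shows "d \<noteq> 0 \<and> sphere_density (sphere_coord j x) * (cmod d)\<^sup>2 = sphere_density (sphere_coord i x)"
proof (cases "i = j")
  case True
  then have "chart_expr (\<lambda>x. x) i j = (\<lambda>z. z)" by (simp add: chart_expr_def fun_eq_iff)
  then have "d = 1" by (simp add: d_def)
  then show ?thesis using True by simp
next
  case False
  define z where "z = sphere_coord i x"
  have x: "x = sphere_param i z" using assms(3) by (simp add: z_def sphere_param_coord del: riemann_sphere_simps)
  have z0: "z \<noteq> 0" using False x assms by (auto simp: sphere_param_def less_2_cases_iff split: if_splits)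
  have "chart_expr (\<lambda>x. x) i j w = 1 / w" for w
    using False assms(1,2) by (auto simp: chart_expr_def sphere_param_def sphere_coord_def less_2_cases_iff)
  then have e: "chart_expr (\<lambda>x. x) i j = (\<lambda>w. 1 / w)" by (simp add: fun_eq_iff)
  have "d = - 1 / z\<^sup>2"
    unfolding d_def e z_def[symmetric]
    by (rule DERIV_imp_deriv) (use z0 in \<open>auto intro!: derivative_eq_intros simp: power2_eq_square field_simps\<close>)
  moreover have "sphere_coord j x = 1 / z" using e x by (metis chart_expr_def)
  ultimately show ?thesis using z0 sphere_density_inverse[OF z0] by (simp add: z_def)
qed

lemma chart_overlap_image:
  "coord riemann_sphere i ` (dom riemann_sphere i \<inter> dom riemann_sphere j)
     = complex_coords ` chart_dom (\<lambda>x. x) i j"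
  using coord_image_dom_Collect[of i "\<lambda>x. x \<in> dom riemann_sphere j"]
  unfolding chart_dom_def by (simp add: Int_def del: riemann_sphere_simps)

lemma closed_connected_oriented_riemannian_sphere: "closed_connected_oriented_riemannian riemann_sphere"
  unfolding closed_connected_oriented_riemannian_def
proof (intro conjI allI impI ballI)
  show "topspace (mtop riemann_sphere) \<noteq> {}" "compact_space (mtop riemann_sphere)"
    "connected_space (mtop riemann_sphere)" "Hausdorff_space (mtop riemann_sphere)"
    by (simp_all add: connected_space_sphere Hausdorff_space_sphere)
  show "topspace (mtop riemann_sphere) = (\<Union>i<nch riemann_sphere. dom riemann_sphere i)"
    by (auto simp: numeral_2_eq_2 lessThan_Suc)
  fix i assume i: "i < nch riemann_sphere"
  then have i2: "i < 2" by simp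
  show "openin (mtop riemann_sphere) (dom riemann_sphere i)"
    using openin_dom[of i] by simp
  show "openin (Euclidean_space (mdim riemann_sphere)) (coord riemann_sphere i ` dom riemann_sphere i)"
    unfolding coord_image_dom_UNIV using openin_complex_coords[of UNIV] by simp
  show "homeomorphic_map (subtopology (mtop riemann_sphere) (dom riemann_sphere i))
       (subtopology (Euclidean_space (mdim riemann_sphere)) (coord riemann_sphere i ` dom riemann_sphere i)) (coord riemann_sphere i)"
    using homeomorphic_map_coord[OF i2] unfolding riemann_sphere_simps(1,2) .
  {
    fix j assume j: "j < nch riemann_sphere"
    then have j2: "j < 2" by simp
    have hol: "chart_expr (\<lambda>x. x) i j holomorphic_on chart_dom (\<lambda>x. x) i j"
      and op: "open (chart_dom (\<lambda>x. x) i j)"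
      using sphere_holomorphic_id i2 j2 open_chart_dom unfolding sphere_holomorphic_def by blast+
    fix a assume a: "a < mdim riemann_sphere"
    show "smooth_on (mdim riemann_sphere) (coord riemann_sphere i ` (dom riemann_sphere i \<inter> dom riemann_sphere j))
        (\<lambda>y. coord riemann_sphere j (param riemann_sphere i y) a)"
      unfolding chart_overlap_image riemann_sphere_simps(2)
      by (rule smooth_on_Re_holomorphic[OF hol op])
         (use complex_coords_component[of a] a in \<open>simp add: chart_expr_def\<close>)
  next
    fix j x assume j: "j < nch riemann_sphere" and x: "x \<in> dom riemann_sphere i \<inter> dom riemann_sphere j"
    then have j2: "j < 2" and x1: "x \<in> dom riemann_sphere i" and x2: "x \<in> dom riemann_sphere j" by simp_all
    note t = transition_jac_riemann_sphere[OF i2 j2 x1 x2] gram_transition[OF i2 j2 x1 x2]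
    show "0 < Determinant.det (transition_jac riemann_sphere i j x)"
      using t by (simp add: det_cmat)
    show "gram riemann_sphere i x = transpose_mat (transition_jac riemann_sphere i j x) * gram riemann_sphere j x *
        transition_jac riemann_sphere i j x"
      unfolding t(1) gram_riemann_sphere cmat_transpose_smult_cmat using t(2) by simp
  next
    fix x assume "x \<in> dom riemann_sphere i"
    show "gram riemann_sphere i x \<in> carrier_mat (mdim riemann_sphere) (mdim riemann_sphere)" by simp
    show "transpose_mat (gram riemann_sphere i x) = gram riemann_sphere i x"
      unfolding gram_riemann_sphere by (rule eq_matI) auto
    fix v :: "real vec" assume v: "v \<in> carrier_vec (mdim riemann_sphere)" "v \<noteq> 0\<^sub>v (mdim riemann_sphere)"
    then have v2: "v \<in> carrier_vec 2" by simp
    have "vec_index v 0 \<noteq> 0 \<or> vec_index v (Suc 0) \<noteq> 0"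
    proof (rule ccontr)
      assume "\<not> ?thesis"
      then have "v = 0\<^sub>v 2" using v2 by (intro eq_vecI) (auto simp: less_2_cases_iff)
      with v show False by simp
    qed
    then have "0 < scalar_prod v v"
      using v2 by (simp add: scalar_prod_2 sum_squares_gt_zero_iff)
    then show "0 < scalar_prod v (gram riemann_sphere i x *\<^sub>v v)"
      unfolding gram_riemann_sphere using v2 by (simp add: scalar_prod_smult_one)
  next
    fix a b assume ab: "a < mdim riemann_sphere" "b < mdim riemann_sphere"
    have e: "gram riemann_sphere i (param riemann_sphere i (complex_coords z)) $$ (a, b) = (if a = b then 1 else 0) * sphere_density z" for z
      using ab by (simp add: gram_riemann_sphere del: riemann_sphere_simps(6))
    have "(\<lambda>z. (if a = b then 1 else 0) * sphere_density z) \<in> spherical_algebra"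
      by (intro spherical_algebra.mult spherical_algebra.const sphere_density_in_spherical_algebra)
    then show "smooth_on (mdim riemann_sphere) (coord riemann_sphere i ` dom riemann_sphere i)
        (\<lambda>y. gram riemann_sphere i (param riemann_sphere i y) $$ (a, b))"
      unfolding coord_image_dom_UNIV riemann_sphere_simps(2)
      by (rule smooth_on_planar_coinduct[OF open_UNIV])
         (use spherical_algebra_closed_deriv e in \<open>blast, simp only:\<close>)
  }
qed

section \<open>Null sets and the normalized area of the sphere\<close>

lemma sets_None_sphere [simp]: "{None} \<in> sets sphere_borel"
proof -
  have "openin sphere_top (range Some)" using openin_dom[of 0] by simp
  then have "range Some \<in> sets sphere_borel" by (auto simp: sets_borel_of)
  then have "space sphere_borel - range Some \<in> sets sphere_borel" by (rule sets.compl_sets)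
  moreover have "space sphere_borel - range Some = {None}" by (auto simp: notin_range_Some)
  ultimately show ?thesis by simp
qed

lemma insert_None_sphere [intro]: "A \<in> sets sphere_borel \<Longrightarrow> insert None A \<in> sets sphere_borel"
  using sets.Un[OF sets_None_sphere] by simp

lemma UNIV_in_sphere_borel [simp]: "UNIV \<in> sets sphere_borel"
  using sets.top[of sphere_borel] by simp

lemma borel_measurable_sphere_coord: "sphere_coord i \<in> borel_measurable sphere_borel"
proof (rule borel_measurableI)
  fix S :: "complex set" assume S: "open S"
  show "sphere_coord i -` S \<inter> space sphere_borel \<in> sets sphere_borel"
  proof (cases "i = 0")
    case True
    have "sphere_coord i -` S \<inter> space sphere_borel = Some ` S \<union> (if 0 \<in> S then {None} else {})"
    proof (rule Set.set_eqI)
      fix x show "x \<in> sphere_coord i -` S \<inter> space sphere_borel \<longleftrightarrow> x \<in> Some ` S \<union> (if 0 \<in> S then {None} else {})"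
        using True by (cases x) (auto simp: sphere_coord_def)
    qed
    moreover have "Some ` S \<in> sets sphere_borel"
      using S openin_sphere_param_image[OF S, of 0] by (auto simp: sets_borel_of sphere_param_simps image_def)
    ultimately show ?thesis by auto
  next
    case False
    let ?S0 = "{z. z \<noteq> 0 \<and> 1 / z \<in> S}"
    have Z: "{Some 0} \<in> sets sphere_borel"
    proof -
      have "openin sphere_top (UNIV - {Some 0})" using openin_dom[of 1] by simp
      then have "UNIV - {Some 0} \<in> sets sphere_borel" by (auto simp: sets_borel_of)
      from sets.compl_sets[OF this] show ?thesis by (simp add: Diff_Diff_Int)
    qed
    have e: "sphere_coord i -` S \<inter> space sphere_borel = Some ` ?S0 \<union> (if 0 \<in> S then {None, Some 0} else {})"
    proof (rule Set.set_eqI)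
      fix x show "x \<in> sphere_coord i -` S \<inter> space sphere_borel \<longleftrightarrow> x \<in> Some ` ?S0 \<union> (if 0 \<in> S then {None, Some 0} else {})"
      proof (cases x)
        case None
        then show ?thesis using False by (simp add: sphere_coord_def image_iff)
      next
        case (Some z)
        then show ?thesis using False by (cases "z = 0") (simp_all add: sphere_coord_def image_iff)
      qed
    qed
    have S0: "Some ` ?S0 \<in> sets sphere_borel"
      using openin_sphere_param_image[OF open_inverse_preimage[OF S], of 0]
      by (auto simp: sets_borel_of sphere_param_simps image_def)
    have "{None, Some 0} \<in> sets sphere_borel" using Z by (rule insert_None_sphere)
    then show ?thesis unfolding e using S0 by (cases "0 \<in> S") (simp_all only: if_True if_False sets.Un Un_empty_right)
  qed
qed

lemma sets_Some_image_sphere: "A \<in> sets borel \<Longrightarrow> Some ` A \<in> sets sphere_borel"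
proof -
  assume A: "A \<in> sets borel"
  have "Some ` A = (sphere_coord 0 -` A \<inter> space sphere_borel) - {None}"
  proof (rule Set.set_eqI)
    fix x show "x \<in> Some ` A \<longleftrightarrow> x \<in> (sphere_coord 0 -` A \<inter> space sphere_borel) - {None}"
      by (cases x) (auto simp: sphere_coord_def)
  qed
  then show ?thesis
    using measurable_sets[OF borel_measurable_sphere_coord[of 0] A] by auto
qed

text \<open>
  A single point of the sphere does not matter for measurability.
\<close>
lemma measurable_on_sphere:
  assumes h: "(\<lambda>z. h (Some z)) \<in> measurable borel N" and "h None \<in> space N"
  shows "h \<in> measurable sphere_borel N"
proof (rule measurableI)
  fix x show "h x \<in> space N"
    using assms(2) measurable_space[OF h] by (cases x) auto
next
  fix S assume "S \<in> sets N"
  then have "(\<lambda>z. h (Some z)) -` S \<in> sets borel" using measurable_sets[OF h, of S] by simp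
  then have "Some ` ((\<lambda>z. h (Some z)) -` S) \<in> sets sphere_borel" by (rule sets_Some_image_sphere)
  moreover have "h -` S \<inter> space sphere_borel = Some ` ((\<lambda>z. h (Some z)) -` S) \<union> (if h None \<in> S then {None} else {})"
  proof (rule Set.set_eqI)
    fix x show "x \<in> h -` S \<inter> space sphere_borel \<longleftrightarrow> x \<in> Some ` ((\<lambda>z. h (Some z)) -` S) \<union> (if h None \<in> S then {None} else {})"
      by (cases x) auto
  qed
  ultimately show "h -` S \<inter> space sphere_borel \<in> sets sphere_borel" by auto
qed

lemma measure_of_borel_of_eq:
  assumes "sets N = sets (borel_of X)" "\<And>A. A \<in> sets (borel_of X) \<Longrightarrow> g A = emeasure N A"
  shows "measure_of (topspace X) {U. openin X U} g = N"
proof -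
  have sub: "{U. openin X U} \<subseteq> Pow (topspace X)" by (auto dest: openin_subset)
  have "measure_of (topspace X) {U. openin X U} g = measure_of (topspace X) {U. openin X U} (emeasure N)"
    by (rule measure_of_eq[OF sub]) (use assms(2) in \<open>simp add: sets_borel_of\<close>)
  also have "\<dots> = measure_of (topspace X) (sigma_sets (topspace X) {U. openin X U}) (emeasure N)"
  proof -
    have "sigma_sets (topspace X) {U. openin X U} \<subseteq> Pow (topspace X)" using sigma_sets_into_sp[OF sub] by blast
    then show ?thesis using sub by (simp add: measure_of_def sigma_sets_sigma_sets_eq)
  qed
  also have "\<dots> = N"
    using measure_of_of_measure[of N] sets_eq_imp_space_eq[OF assms(1)] assms(1)
    by (simp add: sets_borel_of space_borel_of)
  finally show ?thesis .
qed

lemma AE_density_nonneg: "AE z in lborel. P z \<Longrightarrow> \<rho> \<in> borel_measurable borel \<Longrightarrow> AE z in density lborel (\<rho> :: complex \<Rightarrow> ennreal). P z"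
  by (subst AE_density) (auto elim: eventually_mono)

lemma AE_distr_Some:
  assumes "sets M = sets borel" "AE z in M. P (Some z)"
  shows "AE x in distr M sphere_borel Some. P x"
proof -
  from assms(2) obtain N where N: "N \<in> null_sets M" "{z \<in> space M. \<not> P (Some z)} \<subseteq> N"
    by (auto elim!: AE_E simp: null_sets_def)
  have sp: "space M = UNIV" using sets_eq_imp_space_eq[OF assms(1)] by simp
  have NB: "N \<in> sets borel" using N(1) assms(1) by (auto simp: null_sets_def)
  have mS: "Some \<in> measurable M sphere_borel"
    using measurable_Some_sphere by (simp add: measurable_cong_sets[OF assms(1) refl])
  have "insert None (Some ` N) \<in> null_sets (distr M sphere_borel Some)"
  proof (rule null_setsI)
    have i: "insert None (Some ` N) \<in> sets sphere_borel"
      using sets.Un[OF sets_None_sphere sets_Some_image_sphere[OF NB]] by simp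
    then show "insert None (Some ` N) \<in> sets (distr M sphere_borel Some)" by simp
    have "Some -` insert None (Some ` N) = N" by auto
    then show "emeasure (distr M sphere_borel Some) (insert None (Some ` N)) = 0"
      using N(1) sp by (simp add: emeasure_distr[OF mS i] null_sets_def)
  qed
  moreover have "{x \<in> space (distr M sphere_borel Some). \<not> P x} \<subseteq> insert None (Some ` N)"
  proof
    fix x assume "x \<in> {x \<in> space (distr M sphere_borel Some). \<not> P x}"
    then show "x \<in> insert None (Some ` N)" using N(2) sp by (cases x) auto
  qed
  ultimately show ?thesis by (rule AE_I')
qed

lemma AE_vol_sphere: "AE z in lborel. P (Some z) \<Longrightarrow> AE x in vol riemann_sphere. P x"
  unfolding vol_riemann_sphere
  by (rule AE_distr_Some) (auto intro: AE_density_nonneg)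

definition sphere_area :: real where
  "sphere_area = enn2real (\<integral>\<^sup>+ z. ennreal (sphere_density z) \<partial>lborel)"

text \<open>
  Bounds the spherical density by a product of two Cauchy densities (up to a factor), whose integrals
  over the line are finite.
\<close>
lemma product_density_bound:
  fixes a b :: real
  assumes "0 \<le> a" "0 \<le> b"
  shows "4 / (1 + (a + b))\<^sup>2 \<le> (2 * inverse (1 + a)) * (2 * inverse (1 + b))"
proof -
  have "(1 + (a + b))\<^sup>2 - (1 + a) * (1 + b) = a + b + a * a + b * b + a * b"
    by (simp add: power2_eq_square algebra_simps)
  also have "\<dots> \<ge> 0" using assms by (intro add_nonneg_nonneg mult_nonneg_nonneg)
  finally have le: "(1 + a) * (1 + b) \<le> (1 + (a + b))\<^sup>2" by simp
  have p: "0 < (1 + a) * (1 + b)" using assms by (intro mult_pos_pos) linarith+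
  have "0 < (1 + (a + b))\<^sup>2" using assms by (intro zero_less_power) linarith
  then have "4 / (1 + (a + b))\<^sup>2 \<le> 4 / ((1 + a) * (1 + b))"
    by (intro divide_left_mono[OF le] mult_pos_pos p) simp_all
  then show ?thesis by (simp add: divide_inverse)
qed

lemma sphere_density_integral_finite: "(\<integral>\<^sup>+ z. ennreal (sphere_density z) \<partial>lborel) < \<infinity>"
proof -
  interpret product_sigma_finite "\<lambda>_::nat. lborel :: real measure" by standard
  have m: "(\<lambda>x. Complex (x 0) (x 1)) \<in> measurable (\<Pi>\<^sub>M i\<in>{..<2::nat}. lborel) borel"
    unfolding Complex_eq by measurable
  have one: "(\<integral>\<^sup>+ x. ennreal (2 * inverse (1 + x\<^sup>2)) \<partial>(lborel :: real measure)) < \<infinity>"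
  proof -
    have "set_integrable lborel (einterval (-\<infinity>) \<infinity>) (\<lambda>x. inverse (1 + x\<^sup>2 :: real))"
      by (rule integrable_inverse_1_plus_square)
    then have "integrable lborel (\<lambda>x::real. 2 * inverse (1 + x\<^sup>2))" by (simp add: set_integrable_def)
    then have "(\<integral>\<^sup>+ x. ennreal (norm (2 * inverse (1 + x\<^sup>2))) \<partial>(lborel :: real measure)) < \<infinity>"
      unfolding integrable_iff_bounded by blast
    moreover have "norm (2 * inverse (1 + x\<^sup>2)) = 2 * inverse (1 + x\<^sup>2)" for x :: real
      by simp
    ultimately show ?thesis by (simp only:)
  qed
  have "(\<integral>\<^sup>+ z. ennreal (sphere_density z) \<partial>lborel)
      = (\<integral>\<^sup>+ x. ennreal (sphere_density (Complex (x 0) (x 1))) \<partial>(\<Pi>\<^sub>M i\<in>{..<2::nat}. lborel))"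
    by (subst lborel_complex_eq_distr_PiM) (rule nn_integral_distr[OF m], simp)
  also have "\<dots> \<le> (\<integral>\<^sup>+ x. (\<Prod>i<2. ennreal (2 * inverse (1 + (x i)\<^sup>2))) \<partial>(\<Pi>\<^sub>M i\<in>{..<2::nat}. lborel))"
  proof (rule nn_integral_mono)
    fix x :: "nat \<Rightarrow> real"
    let ?a = "(x 0)\<^sup>2" and ?b = "(x 1)\<^sup>2"
    have ab: "0 \<le> ?a" "0 \<le> ?b" by simp_all
    have "4 / (1 + (?a + ?b))\<^sup>2 \<le> (2 * inverse (1 + ?a)) * (2 * inverse (1 + ?b))"
      using ab by (rule product_density_bound)
    then have "ennreal (sphere_density (Complex (x 0) (x 1))) \<le> ennreal ((2 * inverse (1 + ?a)) * (2 * inverse (1 + ?b)))"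
      unfolding sphere_density_def cmod_power2 by (intro ennreal_leI) simp
    also have "\<dots> = (\<Prod>i<2. ennreal (2 * inverse (1 + (x i)\<^sup>2)))"
      using ab by (subst ennreal_mult) (auto simp: numeral_2_eq_2)
    finally show "ennreal (sphere_density (Complex (x 0) (x 1))) \<le> (\<Prod>i<2. ennreal (2 * inverse (1 + (x i)\<^sup>2)))" .
  qed
  also have "\<dots> = (\<Prod>i<2::nat. \<integral>\<^sup>+ x. ennreal (2 * inverse (1 + x\<^sup>2)) \<partial>(lborel :: real measure))"
    by (rule product_nn_integral_prod) auto
  also have "\<dots> < \<infinity>"
    using one by (simp add: numeral_2_eq_2 ennreal_mult_less_top)
  finally show ?thesis .
qed

lemma sphere_area_pos: "0 < sphere_area"
proof -
  have "(\<integral>\<^sup>+ z. ennreal (sphere_density z) \<partial>lborel) \<noteq> 0"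
  proof
    assume "(\<integral>\<^sup>+ z. ennreal (sphere_density z) \<partial>lborel) = 0"
    then have "AE z in (lborel :: complex measure). ennreal (sphere_density z) = 0" by (subst (asm) nn_integral_0_iff_AE) auto
    then have "AE z in (lborel :: complex measure). False" by (rule eventually_mono) (metis ennreal_eq_0_iff not_le sphere_density_pos)
    then have "ae_filter (lborel :: complex measure) = bot" by (simp add: trivial_limit_def)
    then show False by (simp add: ae_filter_eq_bot_iff emeasure_lborel_UNIV)
  qed
  then show ?thesis using sphere_density_integral_finite
    by (simp add: sphere_area_def enn2real_positive_iff less_top[symmetric] zero_less_iff_neq_zero)
qed

lemma measurable_Some_density [measurable]: "Some \<in> measurable (density lborel g) sphere_borel"
  using measurable_Some_sphere by (simp add: measurable_cong_sets[of "density lborel g" borel sphere_borel sphere_borel])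

lemma sets_vol_sphere [simp]: "sets (vol riemann_sphere) = sets sphere_borel"
  by (simp add: vol_riemann_sphere)

lemma emeasure_vol_sphere: "emeasure (vol riemann_sphere) UNIV = ennreal sphere_area"
  unfolding vol_riemann_sphere using sphere_density_integral_finite
  by (simp add: emeasure_distr[OF measurable_Some_density] emeasure_density sphere_area_def)

lemma normalized_vol_sphere:
  "normalized_vol riemann_sphere = distr (density lborel (\<lambda>z. sphere_density z / sphere_area)) sphere_borel Some"
proof (rule measure_eqI)
  show "sets (normalized_vol riemann_sphere) = sets (distr (density lborel (\<lambda>z. sphere_density z / sphere_area)) sphere_borel Some)"
    by (simp add: normalized_vol_def uniform_measure_def vol_riemann_sphere)
  fix A assume "A \<in> sets (normalized_vol riemann_sphere)"
  then have A: "A \<in> sets sphere_borel" by (simp add: normalized_vol_def uniform_measure_def vol_riemann_sphere)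
  have sA: "Some -` A \<in> sets borel" using measurable_sets[OF measurable_Some_sphere A] by simp
  have "emeasure (normalized_vol riemann_sphere) A = emeasure (vol riemann_sphere) A / ennreal sphere_area"
    using A emeasure_uniform_measure[of UNIV "vol riemann_sphere" A]
    unfolding normalized_vol_def riemann_sphere_simps(1) topspace_sphere by (simp add: emeasure_vol_sphere)
  also have "emeasure (vol riemann_sphere) A = (\<integral>\<^sup>+ z. ennreal (sphere_density z) * indicator (Some -` A) z \<partial>lborel)"
    using A sA by (simp add: vol_riemann_sphere emeasure_distr emeasure_density)
  also have "\<dots> / ennreal sphere_area = (\<integral>\<^sup>+ z. ennreal (sphere_density z) * indicator (Some -` A) z / ennreal sphere_area \<partial>lborel)"
    using sA by (subst nn_integral_divide) auto
  also have "\<dots> = (\<integral>\<^sup>+ z. ennreal (sphere_density z / sphere_area) * indicator (Some -` A) z \<partial>lborel)"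
    by (intro nn_integral_cong) (auto simp: indicator_def divide_ennreal sphere_area_pos)
  also have "\<dots> = emeasure (distr (density lborel (\<lambda>z. sphere_density z / sphere_area)) sphere_borel Some) A"
    using A sA by (simp add: emeasure_distr emeasure_density)
  finally show "emeasure (normalized_vol riemann_sphere) A = emeasure (distr (density lborel (\<lambda>z. sphere_density z / sphere_area)) sphere_borel Some) A" .
qed

lemma sets_normalized_vol [simp, measurable_cong]: "sets (normalized_vol riemann_sphere) = sets sphere_borel"
  by (simp add: normalized_vol_sphere)

lemma prob_space_normalized_vol: "prob_space (normalized_vol riemann_sphere)"
  unfolding normalized_vol_def riemann_sphere_simps(1) topspace_sphere
  by (rule prob_space_uniform_measure) (simp_all add: emeasure_vol_sphere sphere_area_pos ennreal_eq_0_iff not_le)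

lemma AE_normalized_vol: "AE z in lborel. P (Some z) \<Longrightarrow> AE x in normalized_vol riemann_sphere. P x"
  unfolding normalized_vol_sphere
  by (rule AE_distr_Some) (auto intro: AE_density_nonneg)

section \<open>Quasiregularity of holomorphic maps\<close>

lemma weak_tangent_sphere_holomorphic:
  assumes f: "sphere_holomorphic f"
  shows "weak_tangent riemann_sphere f (\<lambda>i j x. cmat (deriv (chart_expr f i j) (sphere_coord i x)))"
  unfolding weak_tangent_def Let_def
proof (intro conjI allI impI)
  fix i j :: nat and x
  show "cmat (deriv (chart_expr f i j) (sphere_coord i x)) \<in> carrier_mat (mdim riemann_sphere) (mdim riemann_sphere)"
    by simp
next
  fix i j a b assume "i < nch riemann_sphere" "j < nch riemann_sphere" "a < mdim riemann_sphere" "b < mdim riemann_sphere"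
  then have ij: "i < 2" "j < 2" and ab: "a < 2" "b < 2" by simp_all
  let ?U = "chart_dom f i j" and ?c = "if a = 0 then 1 else - \<i>"
  have hol: "chart_expr f i j holomorphic_on ?U" and op: "open ?U"
    using f ij open_chart_dom unfolding sphere_holomorphic_def by blast+
  have dom: "coord riemann_sphere i ` {x \<in> dom riemann_sphere i. f x \<in> dom riemann_sphere j} = complex_coords ` ?U"
    unfolding chart_dom_def by (rule coord_image_dom_Collect)
  have dc: "continuous_on ?U (deriv (chart_expr f i j))"
    using holomorphic_deriv[OF hol op] by (rule holomorphic_on_imp_continuous_on)
  have entry: "cmat (deriv (chart_expr f i j) (sphere_coord i (param riemann_sphere i (complex_coords z)))) $$ (a, b)
      = Re (?c * axis_dir b * deriv (chart_expr f i j) z)" for z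
    using ab by (simp only: param_riemann_sphere sphere_coord_param cmat_index_gen)
  show "weak_partial (mdim riemann_sphere) (coord riemann_sphere i ` {x \<in> dom riemann_sphere i. f x \<in> dom riemann_sphere j}) b
      (\<lambda>y. coord riemann_sphere j (f (param riemann_sphere i y)) a)
      (\<lambda>y. cmat (deriv (chart_expr f i j) (sphere_coord i (param riemann_sphere i y))) $$ (a, b))"
    unfolding dom riemann_sphere_simps(2)
  proof (rule weak_partial_grad_deriv[OF op _ _ _ ab(2)])
    show "grad_deriv (\<lambda>z. Re (?c * chart_expr f i j z)) z (Re (?c * deriv (chart_expr f i j) z)) (Re (?c * \<i> * deriv (chart_expr f i j) z))"
      if "z \<in> ?U" for z by (rule grad_deriv_Re_holomorphic[OF hol op that])
    show "continuous_on ?U (\<lambda>z. Re (?c * deriv (chart_expr f i j) z))"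
      "continuous_on ?U (\<lambda>z. Re (?c * \<i> * deriv (chart_expr f i j) z))"
      using dc by (auto intro!: continuous_intros)
    show "coord riemann_sphere j (f (param riemann_sphere i (complex_coords z))) a = Re (?c * chart_expr f i j z)" for z
      using complex_coords_component[OF ab(1)] by (simp add: chart_expr_def)
    show "cmat (deriv (chart_expr f i j) (sphere_coord i (param riemann_sphere i (complex_coords z)))) $$ (a, b)
      = (if b = 0 then Re (?c * deriv (chart_expr f i j) z) else Re (?c * \<i> * deriv (chart_expr f i j) z))" for z
      unfolding entry using ab by (simp add: axis_dir_def)
  qed
  show "loc_integrable (mdim riemann_sphere) (coord riemann_sphere i ` {x \<in> dom riemann_sphere i. f x \<in> dom riemann_sphere j})
      (\<lambda>y. \<bar>cmat (deriv (chart_expr f i j) (sphere_coord i (param riemann_sphere i y))) $$ (a, b)\<bar> ^ mdim riemann_sphere)"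
    unfolding dom riemann_sphere_simps(2)
    by (rule loc_integrable_continuous) (unfold entry, use dc in \<open>auto intro!: continuous_intros\<close>)
qed

text \<open>
  The tangent map is a choice among all weak derivatives. By uniqueness it agrees almost everywhere
  with the classical derivative, which acts as multiplication by a complex number.
\<close>
lemma AE_tangent_map:
  assumes f: "sphere_holomorphic f" and fin: "AE z in lborel. f (Some z) \<noteq> None"
  shows "AE z in lborel. (\<exists>w. f (Some z) = Some w) \<and>
    tangent_map riemann_sphere f (Some z) = cmat (deriv (chart_expr f 0 0) z)"
proof -
  define G where "G = (\<lambda>i j x. cmat (deriv (chart_expr f i j) (sphere_coord i x)))"
  define F where "F = (SOME F. weak_tangent riemann_sphere f F)"
  have G: "weak_tangent riemann_sphere f G" unfolding G_def by (rule weak_tangent_sphere_holomorphic[OF f])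
  then have F: "weak_tangent riemann_sphere f F" unfolding F_def by (rule someI[where P = "weak_tangent riemann_sphere f"])
  let ?U = "chart_dom f 0 0"
  have op: "open ?U" using f open_chart_dom unfolding sphere_holomorphic_def by blast
  have dom: "coord riemann_sphere 0 ` {x \<in> dom riemann_sphere 0. f x \<in> dom riemann_sphere 0} = complex_coords ` ?U"
    unfolding chart_dom_def by (rule coord_image_dom_Collect)
  have wp: "weak_partial 2 (complex_coords ` ?U) b (\<lambda>y. coord riemann_sphere 0 (f (param riemann_sphere 0 y)) a)
      (\<lambda>y. H 0 0 (param riemann_sphere 0 y) $$ (a, b))" if "weak_tangent riemann_sphere f H" "a < 2" "b < 2" for H a b
  proof -
    have "weak_partial (mdim riemann_sphere) (coord riemann_sphere 0 ` {x \<in> dom riemann_sphere 0. f x \<in> dom riemann_sphere 0}) b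
      (\<lambda>y. coord riemann_sphere 0 (f (param riemann_sphere 0 y)) a) (\<lambda>y. H 0 0 (param riemann_sphere 0 y) $$ (a, b))"
      using that(1)[unfolded weak_tangent_def Let_def, THEN conjunct2, rule_format, of 0 0 a b] that(2,3) by simp
    then show ?thesis unfolding dom riemann_sphere_simps(2) .
  qed
  have ent: "AE z in lborel. z \<in> ?U \<longrightarrow> F 0 0 (Some z) $$ (a, b) = G 0 0 (Some z) $$ (a, b)" if "a < 2" "b < 2" for a b
    using weak_partial_unique[OF op wp[OF F that] wp[OF G that]]
    unfolding param_riemann_sphere sphere_param_simps .
  have car: "F 0 0 x \<in> carrier_mat 2 2" for x
    using F[unfolded weak_tangent_def, THEN conjunct1, rule_format, of 0 0 x] by simp
  have e00: "AE z in lborel. z \<in> ?U \<longrightarrow> F 0 0 (Some z) $$ (0, 0) = G 0 0 (Some z) $$ (0, 0)" by (rule ent) simp_all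
  have e01: "AE z in lborel. z \<in> ?U \<longrightarrow> F 0 0 (Some z) $$ (0, Suc 0) = G 0 0 (Some z) $$ (0, Suc 0)" by (rule ent) simp_all
  have e10: "AE z in lborel. z \<in> ?U \<longrightarrow> F 0 0 (Some z) $$ (Suc 0, 0) = G 0 0 (Some z) $$ (Suc 0, 0)" by (rule ent) simp_all
  have e11: "AE z in lborel. z \<in> ?U \<longrightarrow> F 0 0 (Some z) $$ (Suc 0, Suc 0) = G 0 0 (Some z) $$ (Suc 0, Suc 0)" by (rule ent) simp_all
  from e00 e01 e10 e11 fin show ?thesis
  proof eventually_elim
    case (elim z)
    then obtain w where w: "f (Some z) = Some w" by blast
    then have z: "z \<in> ?U" by (simp add: chart_dom_def sphere_param_simps)
    have "F 0 0 (Some z) = G 0 0 (Some z)"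
    proof (rule eq_matI)
      fix i j assume "i < dim_row (G 0 0 (Some z))" "j < dim_col (G 0 0 (Some z))"
      then have "i < 2" "j < 2" by (simp_all add: G_def)
      then show "F 0 0 (Some z) $$ (i, j) = G 0 0 (Some z) $$ (i, j)"
        using elim z by (auto simp: less_2_cases_iff)
    qed (use car[of "Some z"] in \<open>auto simp: G_def\<close>)
    then show ?case using w by (simp add: tangent_map_def F_def[symmetric] G_def sphere_coord_def)
  qed
qed

lemma sphere_density_nz [simp]: "sphere_density z \<noteq> 0"
  by (metis less_irrefl sphere_density_pos)

lemma ginner_sphere:
  "v \<in> carrier_vec 2 \<Longrightarrow> w \<in> carrier_vec 2 \<Longrightarrow> ginner riemann_sphere (Some z) v w = sphere_density z * scalar_prod v w"
  unfolding ginner_def gram_at_def gram_riemann_sphere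
  by (simp add: scalar_prod_smult_one sphere_coord_def)

lemma unit_gnorm_exists:
  "\<exists>v\<in>carrier_vec 2. gnorm riemann_sphere (Some z) v = 1"
proof
  let ?v = "Matrix.vec 2 (\<lambda>i. if i = 0 then 1 / sqrt (sphere_density z) else 0)"
  show "?v \<in> carrier_vec 2" by simp
  show "gnorm riemann_sphere (Some z) ?v = 1"
    using sphere_density_pos[of z] by (simp add: gnorm_def ginner_sphere scalar_prod_2)
qed

text \<open>
  Multiplication by a complex number is a similarity, so the two dilatation inequalities hold
  with constant 1.
\<close>
lemma holomorphic_dilatation:
  assumes w: "f (Some z) = Some w" and t: "tangent_map riemann_sphere f (Some z) = cmat d"
  defines "l \<equiv> cmod d * sqrt (sphere_density w / sphere_density z)"
  shows "op_norm riemann_sphere f (Some z) = l" "min_stretch riemann_sphere f (Some z) = l"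
    "jacobian riemann_sphere f (Some z) = l\<^sup>2"
proof -
  have "gnorm riemann_sphere (Some w) (cmat d *\<^sub>v v) = l" if v: "v \<in> carrier_vec 2" "gnorm riemann_sphere (Some z) v = 1" for v :: "real vec"
  proof -
    have cv: "cmat d *\<^sub>v v \<in> carrier_vec 2" using v by (metis cmat_carrier(1) mult_mat_vec_carrier)
    have "sphere_density z * scalar_prod v v = 1"
      using v by (simp add: gnorm_def ginner_sphere)
    then have "scalar_prod v v = 1 / sphere_density z"
      by (simp add: eq_divide_eq mult.commute)
    then have "sphere_density w * scalar_prod (cmat d *\<^sub>v v) (cmat d *\<^sub>v v) = (cmod d)\<^sup>2 * (sphere_density w / sphere_density z)"
      using v by (simp add: cmat_conformal)
    then show ?thesis using cv by (simp add: gnorm_def ginner_sphere l_def real_sqrt_mult real_sqrt_divide)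
  qed
  then have S: "{gnorm riemann_sphere (f (Some z)) (tangent_map riemann_sphere f (Some z) *\<^sub>v v) | v.
     v \<in> carrier_vec (mdim riemann_sphere) \<and> gnorm riemann_sphere (Some z) v = 1} = {l}"
    using unit_gnorm_exists[of z] unfolding w t riemann_sphere_simps(2) by auto
  show "op_norm riemann_sphere f (Some z) = l" "min_stretch riemann_sphere f (Some z) = l"
    unfolding op_norm_def min_stretch_def S by simp_all
  have g: "sqrt (Determinant.det (gram_at riemann_sphere (Some u))) = sphere_density u" for u
    using sqrt_det_gram[of 0 u] by (simp add: gram_at_def sphere_param_simps del: riemann_sphere_simps(6))
  have "l\<^sup>2 = (cmod d)\<^sup>2 * (sphere_density w / sphere_density z)"
    unfolding l_def power_mult_distrib by (simp add: less_imp_le)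
  then show "jacobian riemann_sphere f (Some z) = l\<^sup>2"
    unfolding jacobian_def w t det_cmat g by simp
qed

lemma quasiregular_sphere_holomorphic:
  assumes f: "sphere_holomorphic f" and fin: "AE z in lborel. f (Some z) \<noteq> None"
  shows "quasiregular riemann_sphere f" "max_dilatation riemann_sphere f \<le> 1"
proof -
  have ae: "AE x in vol riemann_sphere. op_norm riemann_sphere f x ^ mdim riemann_sphere \<le> 1 * jacobian riemann_sphere f x
      \<and> jacobian riemann_sphere f x \<le> 1 * min_stretch riemann_sphere f x ^ mdim riemann_sphere"
    by (rule AE_vol_sphere, rule eventually_mono[OF AE_tangent_map[OF f fin]])
       (auto simp: holomorphic_dilatation)
  have o: "outer_dilatation riemann_sphere f \<le> ereal 1"
    unfolding outer_dilatation_def by (rule Inf_lower) (use ae in \<open>auto intro!: exI[of _ 1] elim: eventually_mono\<close>)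
  moreover have "inner_dilatation riemann_sphere f \<le> ereal 1"
    unfolding inner_dilatation_def by (rule Inf_lower) (use ae in \<open>auto intro!: exI[of _ 1] elim: eventually_mono\<close>)
  ultimately show "max_dilatation riemann_sphere f \<le> 1"
    unfolding max_dilatation_def by (simp add: one_ereal_def)
  have "outer_dilatation riemann_sphere f < \<infinity>" using o by (rule order_le_less_trans) simp
  then show "quasiregular riemann_sphere f"
    using f weak_tangent_sphere_holomorphic[OF f] unfolding quasiregular_def sphere_holomorphic_def by auto
qed

lemma uniformly_quasiregular_sphere:
  assumes "sphere_holomorphic f" "\<And>k. AE z in lborel. (f ^^ k) (Some z) \<noteq> None"
  shows "uniformly_quasiregular riemann_sphere 1 f"
  unfolding uniformly_quasiregular_def
  using quasiregular_sphere_holomorphic[OF sphere_holomorphic_funpow[OF assms(1)] assms(2)]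
  by (simp add: one_ereal_def)

lemma ginner_standard: "v \<in> carrier_vec 2 \<Longrightarrow> ginner riemann_sphere x (standard_structure riemann_sphere y *\<^sub>v v) w = ginner riemann_sphere x v w"
  by (simp add: standard_structure_def)

lemma conformal_structure_standard: "conformal_structure riemann_sphere (standard_structure riemann_sphere)"
proof -
  have g: "0 < ginner riemann_sphere (Some z) v v" if "v \<in> carrier_vec 2" "v \<noteq> 0\<^sub>v 2" for z and v :: "real vec"
  proof -
    have "vec_index v 0 \<noteq> 0 \<or> vec_index v (Suc 0) \<noteq> 0"
    proof (rule ccontr)
      assume "\<not> ?thesis"
      then have "v = 0\<^sub>v 2" using that by (intro eq_vecI) (auto simp: less_2_cases_iff)
      with that show False by simp
    qed
    then have "0 < scalar_prod v v" using that by (simp add: scalar_prod_2 sum_squares_gt_zero_iff)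
    then show ?thesis using that by (simp add: ginner_sphere)
  qed
  have a: "AE x in vol riemann_sphere. Determinant.det (standard_structure riemann_sphere x) = 1 \<and>
        (\<forall>v\<in>carrier_vec 2. \<forall>w\<in>carrier_vec 2.
           ginner riemann_sphere x (standard_structure riemann_sphere x *\<^sub>v v) w = ginner riemann_sphere x v (standard_structure riemann_sphere x *\<^sub>v w)) \<and>
        (\<forall>v\<in>carrier_vec 2. v \<noteq> 0\<^sub>v 2 \<longrightarrow> 0 < ginner riemann_sphere x (standard_structure riemann_sphere x *\<^sub>v v) v)"
    by (rule AE_vol_sphere) (simp add: standard_structure_def g)
  have b: "AE x in vol riemann_sphere. \<forall>v\<in>carrier_vec 2.
        ginner riemann_sphere x v v / 1 \<le> ginner riemann_sphere x (standard_structure riemann_sphere x *\<^sub>v v) v \<and>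
        ginner riemann_sphere x (standard_structure riemann_sphere x *\<^sub>v v) v \<le> 1 * ginner riemann_sphere x v v"
    by (simp add: standard_structure_def)
  show ?thesis
    unfolding conformal_structure_def riemann_sphere_simps(2)
  proof (intro conjI)
    show "\<exists>L\<ge>1. AE x in vol riemann_sphere. \<forall>v\<in>carrier_vec 2.
        ginner riemann_sphere x v v / L \<le> ginner riemann_sphere x (standard_structure riemann_sphere x *\<^sub>v v) v \<and>
        ginner riemann_sphere x (standard_structure riemann_sphere x *\<^sub>v v) v \<le> L * ginner riemann_sphere x v v"
      using b by (intro exI[of _ 1]) simp
  qed (use a in \<open>simp_all add: standard_structure_def\<close>)
qed

text \<open>
  Multiplication by a complex number scales the metric by the Jacobian to the power 2/n, here n = 2.
\<close>
lemma invariant_structure_standard: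
  assumes f: "sphere_holomorphic f" and fin: "\<And>k. AE z in lborel. (f ^^ k) (Some z) \<noteq> None"
  shows "invariant_structure riemann_sphere f (standard_structure riemann_sphere)"
  unfolding invariant_structure_def riemann_sphere_simps(2)
proof (intro allI impI)
  fix k :: nat
  let ?g = "f ^^ k"
  show "AE x in vol riemann_sphere. \<forall>v\<in>carrier_vec 2. \<forall>w\<in>carrier_vec 2.
      ginner riemann_sphere (?g x) (standard_structure riemann_sphere (?g x) *\<^sub>v (tangent_map riemann_sphere ?g x *\<^sub>v v))
        (tangent_map riemann_sphere ?g x *\<^sub>v w)
      = jacobian riemann_sphere ?g x powr (2 / real 2) * ginner riemann_sphere x (standard_structure riemann_sphere x *\<^sub>v v) w"
  proof (rule AE_vol_sphere, rule eventually_mono[OF AE_tangent_map[OF sphere_holomorphic_funpow[OF f] fin]], elim conjE exE, intro ballI)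
    fix z w and v u :: "real vec" assume w: "?g (Some z) = Some w" and t: "tangent_map riemann_sphere ?g (Some z) = cmat (deriv (chart_expr ?g 0 0) z)"
      and v: "v \<in> carrier_vec 2" and u: "u \<in> carrier_vec 2"
    let ?d = "deriv (chart_expr ?g 0 0) z"
    have c: "cmat ?d *\<^sub>v v \<in> carrier_vec 2" "cmat ?d *\<^sub>v u \<in> carrier_vec 2"
      using v u by (metis cmat_carrier(1) mult_mat_vec_carrier)+
    have j: "jacobian riemann_sphere ?g (Some z) = (cmod ?d)\<^sup>2 * (sphere_density w / sphere_density z)"
      unfolding holomorphic_dilatation(3)[of ?g z w, OF w t] power_mult_distrib by (simp add: less_imp_le)
    then have "jacobian riemann_sphere ?g (Some z) powr (2 / real 2) = (cmod ?d)\<^sup>2 * (sphere_density w / sphere_density z)"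
      by (simp add: less_imp_le)
    then show "ginner riemann_sphere (?g (Some z)) (standard_structure riemann_sphere (?g (Some z)) *\<^sub>v (tangent_map riemann_sphere ?g (Some z) *\<^sub>v v))
        (tangent_map riemann_sphere ?g (Some z) *\<^sub>v u)
      = jacobian riemann_sphere ?g (Some z) powr (2 / real 2) * ginner riemann_sphere (Some z) (standard_structure riemann_sphere (Some z) *\<^sub>v v) u"
      unfolding w t ginner_standard[OF c(1)] ginner_standard[OF v] ginner_sphere[OF c] ginner_sphere[OF v u] cmat_conformal[OF v u]
      using sphere_density_pos[of z] by simp
  qed
qed

section \<open>The quadratic maps and their inverse branches\<close>

lemma f_num_eq: "f_num = [:0, -1, 1:]"
  by (simp add: f_num_def)

lemma f_den_eq: "f_den t = [:of_real t - 2, 2:]"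
  by (simp add: f_den_def numeral_poly)

lemma rational_degree_f: "rational_degree f_num (f_den t) = 2"
  unfolding rational_degree_def f_num_eq f_den_eq by simp

text \<open>
  The bound 1/1000 leaves room in the estimates for the inverse branches, for instance
  64 t \<le> 1/15 in the contraction estimate.
\<close>
locale small_parameter =
  fixes t :: real
  assumes t_pos: "0 < t" and t_small: "t \<le> 1 / 1000"
begin

definition pole :: complex where "pole = of_real (1 - t / 2)"

definition f :: "complex option \<Rightarrow> complex option" where
  "f = rational_map f_num (f_den t)"

text \<open>
  The value pole (1 - pole).
\<close>
definition \<kappa> :: real where "\<kappa> = (1 - t / 2) * (t / 2)"

lemma kappa_pos: "0 < \<kappa>" using t_pos t_small by (simp add: \<kappa>_def)

lemma kappa_le: "\<kappa> \<le> t / 2"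
  using t_pos t_small unfolding \<kappa>_def by (simp add: mult_le_cancel_right1)

lemma pole_kappa: "pole * (pole - 1) = - of_real \<kappa>"
  by (simp add: pole_def \<kappa>_def algebra_simps)

lemma pole_nz: "pole \<noteq> 0" "pole \<noteq> 1"
  using pole_kappa kappa_pos by auto

lemma f_Some: "f (Some z) = hpoint (z * (z - 1)) (2 * (z - pole))"
proof -
  have "poly f_num z = z * (z - 1)" by (simp add: f_num_def algebra_simps)
  moreover have "poly (f_den t) z = 2 * (z - pole)"
    by (simp add: f_den_def pole_def algebra_simps)
  ultimately show ?thesis by (simp add: f_def rational_map_def hpoint_def)
qed

lemma f_None: "f None = None"
proof -
  have "coeff (f_den t) 2 = 0" unfolding f_den_eq by (simp add: numeral_2_eq_2)
  then show ?thesis by (simp add: f_def rational_map_def rational_degree_f)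
qed

lemma f_chart_1: "f (sphere_param (Suc 0) w) = hpoint (1 - w) (2 * w * (1 - pole * w))"
  using pole_nz by (auto simp: sphere_param_simps f_None f_Some hpoint_def field_simps)

lemma sphere_holomorphic_f: "sphere_holomorphic f"
proof (rule sphere_holomorphic_hpoint[where P = "\<lambda>i z. if i = 0 then z * (z - 1) else 1 - z"
      and Q = "\<lambda>i z. if i = 0 then 2 * (z - pole) else 2 * z * (1 - pole * z)"])
  fix i :: nat and z assume i: "i < 2"
  show "(\<lambda>z. if i = 0 then z * (z - 1) else 1 - z) holomorphic_on UNIV"
    by (cases "i = 0") (auto intro!: holomorphic_intros)
  show "(\<lambda>z. if i = 0 then 2 * (z - pole) else 2 * z * (1 - pole * z)) holomorphic_on UNIV"
    by (cases "i = 0") (auto intro!: holomorphic_intros)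
  show "(if i = 0 then z * (z - 1) else 1 - z) \<noteq> 0 \<or> (if i = 0 then 2 * (z - pole) else 2 * z * (1 - pole * z)) \<noteq> 0"
    using pole_nz by auto
  show "f (sphere_param i z) = hpoint (if i = 0 then z * (z - 1) else 1 - z) (if i = 0 then 2 * (z - pole) else 2 * z * (1 - pole * z))"
    using i f_Some[of z] f_chart_1[of z] by (auto simp: sphere_param_simps(1) less_2_cases_iff)
qed

text \<open>
  The solutions z of z (z - 1) = 2 y (z - pole), so that both preimages of a finite point y are
  given by measurable functions.
\<close>
definition root_plus :: "complex \<Rightarrow> complex" where
  "root_plus y = ((1 + 2 * y) + csqrt ((1 + 2 * y)\<^sup>2 - 8 * pole * y)) / 2"

definition root_minus :: "complex \<Rightarrow> complex" where
  "root_minus y = ((1 + 2 * y) - csqrt ((1 + 2 * y)\<^sup>2 - 8 * pole * y)) / 2"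

text \<open>
  Telling the roots apart by their distance to the pole makes the near root stay close to 1 for every
  y, and gives branches that contract near infinity.
\<close>
definition far_root :: "complex \<Rightarrow> complex" where
  "far_root y = (if cmod (root_minus y - pole) \<le> cmod (root_plus y - pole) then root_plus y else root_minus y)"

definition near_root :: "complex \<Rightarrow> complex" where
  "near_root y = 1 + 2 * y - far_root y"

lemma root_sum: "far_root y + near_root y = 1 + 2 * y"
  by (simp add: near_root_def)

lemma near_root_alt: "near_root y = (if cmod (root_minus y - pole) \<le> cmod (root_plus y - pole) then root_minus y else root_plus y)"
  by (auto simp: near_root_def far_root_def root_plus_def root_minus_def field_simps)

lemma near_le_far: "cmod (near_root y - pole) \<le> cmod (far_root y - pole)"
  by (auto simp: near_root_alt far_root_def)

lemma root_prod: "far_root y * near_root y = 2 * pole * y"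
proof -
  have "root_plus y * root_minus y = ((1 + 2 * y)\<^sup>2 - (csqrt ((1 + 2 * y)\<^sup>2 - 8 * pole * y))\<^sup>2) / 4"
    by (simp add: root_plus_def root_minus_def power2_eq_square algebra_simps)
  also have "\<dots> = 2 * pole * y" by simp
  finally show ?thesis by (auto simp: near_root_alt far_root_def mult.commute)
qed

text \<open>
  The key identity: since the right side does not depend on the point and is of size t / 2, one of
  the two preimages of every point lies within the square root of \<kappa> of the pole, hence near 1,
  and it does so within O(t) once the other preimage stays away from the pole.
\<close>
lemma root_pole_prod: "(far_root y - pole) * (near_root y - pole) = - of_real \<kappa>"
proof -
  have "(far_root y - pole) * (near_root y - pole) = far_root y * near_root y - pole * (far_root y + near_root y) + pole * pole"
    by (simp add: algebra_simps)
  also have "\<dots> = pole * (pole - 1)" unfolding root_prod root_sum by (simp add: algebra_simps)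
  finally show ?thesis by (simp add: pole_kappa)
qed

lemma root_ne_pole: "far_root y \<noteq> pole" "near_root y \<noteq> pole"
  using root_pole_prod[of y] kappa_pos by auto

definition branch :: "bool \<Rightarrow> complex option \<Rightarrow> complex option" where
  "branch b x = (case x of None \<Rightarrow> if b then Some pole else None
     | Some y \<Rightarrow> Some (if b then near_root y else far_root y))"

lemma branch_simps [simp]:
  "branch True None = Some pole" "branch False None = None"
  "branch True (Some y) = Some (near_root y)" "branch False (Some y) = Some (far_root y)"
  by (simp_all add: branch_def)

lemma f_eq_None_iff: "f x = None \<longleftrightarrow> x = None \<or> x = Some pole"
  by (cases x) (auto simp: f_None f_Some hpoint_def)

lemma f_eq_Some_iff: "f (Some z) = Some y \<longleftrightarrow> z = far_root y \<or> z = near_root y"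
proof -
  have "f (Some z) = Some y \<longleftrightarrow> z \<noteq> pole \<and> z * (z - 1) = 2 * y * (z - pole)"
    by (auto simp: f_Some hpoint_def field_simps)
  also have "\<dots> \<longleftrightarrow> z * (z - 1) = 2 * y * (z - pole)"
    using pole_nz by auto
  also have "\<dots> \<longleftrightarrow> (z - far_root y) * (z - near_root y) = 0"
  proof -
    have "(z - far_root y) * (z - near_root y) = z * z - z * (far_root y + near_root y) + far_root y * near_root y"
      by (simp add: algebra_simps)
    also have "\<dots> = z * (z - 1) - 2 * y * (z - pole)" unfolding root_prod root_sum by (simp add: algebra_simps)
    finally show ?thesis by simp
  qed
  finally show ?thesis by auto
qed

lemma f_eq_iff: "f x = y \<longleftrightarrow> x = branch False y \<or> x = branch True y"
proof (cases y)
  case None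
  then show ?thesis using f_eq_None_iff[of x] by auto
next
  case (Some v)
  then show ?thesis using f_eq_Some_iff[of _ v] by (cases x) (auto simp: f_None)
qed

lemma f_branch [simp]: "f (branch b y) = y"
  using f_eq_iff[of "branch b y" y] by (cases b) auto

section \<open>Multiplicities\<close>

text \<open>
  The deck involution of f. Solving \<open>root_pole_prod\<close> for one of the two roots shows that it is a
  Moebius map. It turns statements on injectivity of f and on multiplicities into statements on its
  fixed points.
\<close>
definition deck :: "complex option \<Rightarrow> complex option" where
  "deck x = (case x of None \<Rightarrow> Some pole | Some z \<Rightarrow> hpoint (pole * (z - pole) - of_real \<kappa>) (z - pole))"

lemma deck_branch: "deck (branch b y) = branch (\<not> b) y"
proof (cases y)
  case None
  then show ?thesis by (cases b) (auto simp: deck_def hpoint_def)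
next
  case (Some v)
  have "far_root v - pole \<noteq> 0" "near_root v - pole \<noteq> 0" using root_ne_pole[of v] by auto
  moreover have "- of_real \<kappa> = (far_root v - pole) * (near_root v - pole)" using root_pole_prod[of v] by simp
  ultimately have "(pole * (far_root v - pole) - of_real \<kappa>) / (far_root v - pole) = near_root v"
    "(pole * (near_root v - pole) - of_real \<kappa>) / (near_root v - pole) = far_root v"
    by (simp_all add: diff_conv_add_uminus[of _ "of_real \<kappa>"] del: add_uminus_conv_diff) (simp_all add: field_simps)
  then show ?thesis using Some root_ne_pole[of v] by (cases b) (auto simp: deck_def hpoint_def)
qed

lemma continuous_map_deck: "continuous_map sphere_top sphere_top deck"
proof -
  have "sphere_holomorphic deck"
  proof (rule sphere_holomorphic_hpoint[where P = "\<lambda>i z. if i = 0 then pole * (z - pole) - of_real \<kappa> else pole * (1 - pole * z) - of_real \<kappa> * z"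
        and Q = "\<lambda>i z. if i = 0 then z - pole else 1 - pole * z"])
    fix i :: nat and z assume i: "i < 2"
    show "(\<lambda>z. if i = 0 then pole * (z - pole) - of_real \<kappa> else pole * (1 - pole * z) - of_real \<kappa> * z) holomorphic_on UNIV"
      by (cases "i = 0") (auto intro!: holomorphic_intros)
    show "(\<lambda>z. if i = 0 then z - pole else 1 - pole * z) holomorphic_on UNIV"
      by (cases "i = 0") (auto intro!: holomorphic_intros)
    show "(if i = 0 then pole * (z - pole) - of_real \<kappa> else pole * (1 - pole * z) - of_real \<kappa> * z) \<noteq> 0
        \<or> (if i = 0 then z - pole else 1 - pole * z) \<noteq> 0"
      using kappa_pos pole_nz by auto
    show "deck (sphere_param i z) = hpoint (if i = 0 then pole * (z - pole) - of_real \<kappa> else pole * (1 - pole * z) - of_real \<kappa> * z)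
        (if i = 0 then z - pole else 1 - pole * z)"
    proof (cases "i = 0")
      case True then show ?thesis by (simp add: sphere_param_def deck_def)
    next
      case False
      show ?thesis
      proof (cases "z = 0")
        case True
        then show ?thesis using False by (simp add: sphere_param_def deck_def hpoint_def)
      next
        case nz: False
        have e: "pole * (1 - pole * z) - of_real \<kappa> * z = z * (pole * (1 / z - pole) - of_real \<kappa>)"
          "1 - pole * z = z * (1 / z - pole)" using nz by (simp_all add: field_simps)
        have "sphere_param i z = Some (1 / z)" using False nz by (simp add: sphere_param_def)
        moreover have "hpoint (z * (pole * (1 / z - pole) - of_real \<kappa>)) (z * (1 / z - pole)) = hpoint (pole * (1 / z - pole) - of_real \<kappa>) (1 / z - pole)"
          using nz by (simp add: hpoint_def)
        moreover have "hpoint (pole * (1 - pole * z) - of_real \<kappa> * z) (1 - pole * z)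
            = hpoint (z * (pole * (1 / z - pole) - of_real \<kappa>)) (z * (1 / z - pole))"
          by (rule arg_cong2[where f = hpoint, OF e])
        ultimately show ?thesis using False by (simp only: if_False deck_def option.case)
      qed
    qed
  qed
  then show ?thesis by (simp add: sphere_holomorphic_def)
qed

lemma f_deck: "f (deck x) = f x"
  using f_eq_iff[of x "f x"] deck_branch[of True "f x"] deck_branch[of False "f x"] by (metis f_branch)

lemma f_eq_f_iff: "f a = f b \<longleftrightarrow> b = a \<or> b = deck a"
proof
  assume "f a = f b"
  then show "b = a \<or> b = deck a"
    using f_eq_iff[of a "f a"] f_eq_iff[of b "f a"] deck_branch[of True "f a"] deck_branch[of False "f a"] by auto
qed (auto simp: f_deck)

text \<open>
  The critical values of f.
\<close>
definition branch_values :: "complex option set" where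
  "branch_values = {y. branch False y = branch True y}"

lemma deck_fixed: "deck x = x \<longleftrightarrow> f x \<in> branch_values"
  using f_eq_iff[of x "f x"] deck_branch[of True "f x"] deck_branch[of False "f x"]
  unfolding branch_values_def by auto

lemma finite_fixed_deck: "finite {x. deck x = x}"
proof -
  let ?P = "[: pole * pole + of_real \<kappa>, - 2 * pole, 1 :]"
  have "?P \<noteq> 0" by simp
  then have "finite {z. poly ?P z = 0}" by (rule poly_roots_finite)
  moreover have "{x. deck x = x} \<subseteq> Some ` {z. poly ?P z = 0}"
  proof
    fix x assume "x \<in> {x. deck x = x}"
    then obtain z where z: "x = Some z" "deck (Some z) = Some z" by (cases x) (auto simp: deck_def)
    then have "z \<noteq> pole" "pole * (z - pole) - of_real \<kappa> = z * (z - pole)"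
      by (auto simp: deck_def hpoint_def field_simps split: if_splits)
    then have "poly ?P z = 0" by (simp add: algebra_simps)
    with z show "x \<in> Some ` {z. poly ?P z = 0}" by blast
  qed
  ultimately show ?thesis by (meson finite_imageI finite_subset)
qed

lemma finite_branch_values: "finite branch_values"
proof -
  have "branch_values \<subseteq> f ` {x. deck x = x}"
  proof
    fix y assume "y \<in> branch_values"
    then have "deck (branch True y) = branch True y" by (simp add: deck_fixed)
    then show "y \<in> f ` {x. deck x = x}" by (intro image_eqI[of _ _ "branch True y"]) auto
  qed
  then show ?thesis using finite_fixed_deck by (meson finite_imageI finite_subset)
qed

text \<open>
  The critical values of the k-th iterate. They are finite in number, hence negligible for the area,
  and off them all preimages are simple.
\<close>
primrec exceptional :: "nat \<Rightarrow> complex option set" where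
  "exceptional 0 = {}"
| "exceptional (Suc k) = branch_values \<union> f ` exceptional k"

lemma finite_exceptional: "finite (exceptional k)"
  by (induction k) (auto simp: finite_branch_values)

lemma branch_not_exceptional: "y \<notin> exceptional (Suc k) \<Longrightarrow> branch b y \<notin> exceptional k"
  using f_branch[of b y] by (metis UnCI exceptional.simps(2) image_eqI)

lemma funpow_Suc_vimage: "(f ^^ Suc k) -` {y} = (f ^^ k) -` {branch False y} \<union> (f ^^ k) -` {branch True y}"
proof (rule Set.set_eqI)
  fix x show "x \<in> (f ^^ Suc k) -` {y} \<longleftrightarrow> x \<in> (f ^^ k) -` {branch False y} \<union> (f ^^ k) -` {branch True y}"
    using f_eq_iff[of "(f ^^ k) x" y] by simp
qed

lemma finite_funpow_vimage: "finite ((f ^^ k) -` {y})"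
proof (induction k arbitrary: y)
  case (Suc k)
  show ?case unfolding funpow_Suc_vimage using Suc by blast
qed simp

lemma openin_UNIV_sphere: "openin sphere_top UNIV"
  using openin_topspace[of sphere_top] by simp

text \<open>
  Near a point that is not fixed by the deck involution, a neighbourhood and its image under the
  involution can be separated.
\<close>
lemma locally_injective_f:
  assumes "f x \<notin> branch_values"
  shows "\<exists>U. openin sphere_top U \<and> x \<in> U \<and> inj_on f U"
proof -
  have "deck x \<noteq> x" using assms deck_fixed by blast
  then obtain A B where AB: "openin sphere_top A" "openin sphere_top B" "x \<in> A" "deck x \<in> B" "disjnt A B"
    using Hausdorff_space_sphere unfolding Hausdorff_space_def by (metis UNIV_I topspace_sphere)
  let ?U = "A \<inter> {x. deck x \<in> B}"
  have "openin sphere_top {x. deck x \<in> B}"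
    using continuous_map_deck AB(2) unfolding continuous_map_def by simp
  then have "openin sphere_top ?U" using AB(1) by blast
  moreover have "inj_on f ?U"
  proof (rule inj_onI)
    fix a b assume "a \<in> ?U" "b \<in> ?U" "f a = f b"
    then have "b \<noteq> deck a" using AB(5) by (auto simp: disjnt_def)
    with \<open>f a = f b\<close> show "a = b" using f_eq_f_iff[of a b] by simp
  qed
  ultimately show ?thesis using AB by blast
qed

lemma locally_injective_funpow:
  assumes "(f ^^ k) x \<notin> exceptional k"
  shows "\<exists>U. openin sphere_top U \<and> x \<in> U \<and> inj_on (f ^^ k) U"
  using assms
proof (induction k)
  case 0
  show ?case by (intro exI[of _ UNIV]) (simp add: openin_UNIV_sphere)
next
  case (Suc k)
  let ?x' = "(f ^^ k) x"
  have "f ?x' \<notin> branch_values" using Suc.prems by auto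
  then obtain W where W: "openin sphere_top W" "?x' \<in> W" "inj_on f W" using locally_injective_f by blast
  have "?x' \<notin> exceptional k" using Suc.prems by auto
  then obtain U where U: "openin sphere_top U" "x \<in> U" "inj_on (f ^^ k) U" using Suc.IH by blast
  let ?U = "U \<inter> {x. (f ^^ k) x \<in> W}"
  have "continuous_map sphere_top sphere_top (f ^^ k)"
    using sphere_holomorphic_funpow[OF sphere_holomorphic_f] by (simp add: sphere_holomorphic_def)
  then have "openin sphere_top {x. (f ^^ k) x \<in> W}" using W(1) unfolding continuous_map_def by simp
  then have "openin sphere_top ?U" using U(1) by blast
  moreover have "inj_on (f ^^ Suc k) ?U"
  proof (rule inj_onI)
    fix a b assume *: "a \<in> ?U" "b \<in> ?U" "(f ^^ Suc k) a = (f ^^ Suc k) b"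
    then have "(f ^^ k) a = (f ^^ k) b" using inj_onD[OF W(3)] by simp
    then show "a = b" using inj_onD[OF U(3)] * by blast
  qed
  ultimately show ?case using W(2) U(2) by blast
qed

lemma emeasure_count_le_1:
  assumes "\<And>a b. a \<in> S \<Longrightarrow> b \<in> S \<Longrightarrow> a = b" shows "emeasure (count_space UNIV) S \<le> 1"
proof (cases "S = {}")
  case False
  then obtain a where "S = {a}" using assms by blast
  then show ?thesis by simp
qed simp

lemma local_index_eq_1:
  assumes "(f ^^ k) x \<notin> exceptional k" shows "local_index sphere_top (f ^^ k) x = 1"
proof (rule antisym)
  obtain U where U: "openin sphere_top U" "x \<in> U" "inj_on (f ^^ k) U"
    using locally_injective_funpow[OF assms] by blast
  have "local_index sphere_top (f ^^ k) x \<le> (SUP y\<in>topspace sphere_top. emeasure (count_space UNIV) (U \<inter> (f ^^ k) -` {y}))"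
    unfolding local_index_def by (rule INF_lower) (use U in auto)
  also have "\<dots> \<le> 1"
    by (rule SUP_least, rule emeasure_count_le_1) (use U(3) in \<open>auto dest: inj_onD\<close>)
  finally show "local_index sphere_top (f ^^ k) x \<le> 1" .
  show "1 \<le> local_index sphere_top (f ^^ k) x"
    unfolding local_index_def
  proof (rule INF_greatest)
    fix U assume "U \<in> {U. openin sphere_top U \<and> x \<in> U}"
    then have "{x} \<subseteq> U \<inter> (f ^^ k) -` {(f ^^ k) x}" by auto
    then have "emeasure (count_space UNIV) {x} \<le> emeasure (count_space UNIV) (U \<inter> (f ^^ k) -` {(f ^^ k) x})"
      by (intro emeasure_mono) auto
    also have "\<dots> \<le> (SUP y\<in>topspace sphere_top. emeasure (count_space UNIV) (U \<inter> (f ^^ k) -` {y}))"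
      by (rule SUP_upper) simp
    finally show "1 \<le> (SUP y\<in>topspace sphere_top. emeasure (count_space UNIV) (U \<inter> (f ^^ k) -` {y}))" by simp
  qed
qed

lemma preimage_count_eq_card:
  assumes "y \<notin> exceptional k"
  shows "preimage_count sphere_top (f ^^ k) A y = emeasure (count_space UNIV) (A \<inter> (f ^^ k) -` {y})"
proof -
  let ?B = "A \<inter> (f ^^ k) -` {y}"
  have "preimage_count sphere_top (f ^^ k) A y = (\<integral>\<^sup>+ x. 1 \<partial>count_space ?B)"
    unfolding preimage_count_def
    by (rule nn_integral_cong) (use assms local_index_eq_1 in auto)
  also have "\<dots> = emeasure (count_space UNIV) ?B"
    using finite_funpow_vimage[of k y] by (simp add: emeasure_count_space)
  finally show ?thesis .
qed

text \<open>
  Every neighbourhood of a fixed point of the deck involution contains a pair of distinct points that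
  are exchanged by the involution, since it has only finitely many fixed points.
\<close>
lemma local_index_critical:
  assumes "deck x = x" shows "local_index sphere_top f x = 2"
proof (rule antisym)
  have "local_index sphere_top f x \<le> (SUP y\<in>topspace sphere_top. emeasure (count_space UNIV) (UNIV \<inter> f -` {y}))"
    unfolding local_index_def by (rule INF_lower) (simp add: openin_UNIV_sphere)
  also have "\<dots> \<le> 2"
  proof (rule SUP_least)
    fix y
    have "UNIV \<inter> f -` {y} = {branch False y, branch True y}" using f_eq_iff[of _ y] by auto
    then show "emeasure (count_space UNIV) (UNIV \<inter> f -` {y}) \<le> 2"
      by (cases "branch False y = branch True y") auto
  qed
  finally show "local_index sphere_top f x \<le> 2" .
  show "2 \<le> local_index sphere_top f x"
    unfolding local_index_def
  proof (rule INF_greatest)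
    fix U assume "U \<in> {U. openin sphere_top U \<and> x \<in> U}"
    then have U: "openin sphere_top U" "x \<in> U" by auto
    \<comment> \<open>In this neighbourhood, every point has its partner within U.\<close>
    let ?W = "U \<inter> {x. deck x \<in> U}"
    have "openin sphere_top {x. deck x \<in> U}" using continuous_map_deck U(1) unfolding continuous_map_def by simp
    then have W: "openin sphere_top ?W" using U(1) by blast
    have xW: "x \<in> ?W" using U assms by simp
    obtain z where z: "x = Some z" using assms by (cases x) (auto simp: deck_def)
    have o: "open (Some -` ?W)" using W openin_sphere_at_infinity by blast
    have "z \<in> Some -` ?W" using xW z by simp
    then have "infinite (Some -` ?W)" using o by (metis empty_iff finite_imp_not_open)
    then have "infinite (Some ` (Some -` ?W))" by (simp add: finite_image_iff)
    moreover have "Some ` (Some -` ?W) \<subseteq> ?W" by blast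
    ultimately have "infinite ?W" by (meson finite_subset)
    then have "\<not> ?W \<subseteq> {x. deck x = x}" using finite_fixed_deck finite_subset by blast
    then obtain a where a: "a \<in> ?W" "deck a \<noteq> a" by blast
    have "{a, deck a} \<subseteq> U \<inter> f -` {f a}" using a f_deck by auto
    then have "emeasure (count_space UNIV) {a, deck a} \<le> emeasure (count_space UNIV) (U \<inter> f -` {f a})"
      by (intro emeasure_mono) auto
    also have "\<dots> \<le> (SUP y\<in>topspace sphere_top. emeasure (count_space UNIV) (U \<inter> f -` {y}))"
      by (rule SUP_upper) simp
    finally show "2 \<le> (SUP y\<in>topspace sphere_top. emeasure (count_space UNIV) (U \<inter> f -` {y}))"
      using a(2) by simp
  qed
qed

lemma has_degree_f: "has_degree sphere_top f 2"
  unfolding has_degree_def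
proof
  fix y
  have vim: "f -` {y} = {branch False y, branch True y}" using f_eq_iff[of _ y] by auto
  show "preimage_count sphere_top f (topspace sphere_top) y = of_nat 2"
  proof (cases "y \<in> branch_values")
    case False
    then have "y \<notin> exceptional (Suc 0)" by simp
    from preimage_count_eq_card[OF this, of UNIV]
    have "preimage_count sphere_top f UNIV y = emeasure (count_space UNIV) (f -` {y})" by simp
    also have "\<dots> = 2" unfolding vim using False by (auto simp: branch_values_def)
    finally show ?thesis by simp
  next
    case True
    then have eq: "branch False y = branch True y" by (simp add: branch_values_def)
    have "deck (branch True y) = branch True y" using True by (simp add: deck_fixed)
    then have "local_index sphere_top f (branch True y) = 2" by (rule local_index_critical)
    moreover have "preimage_count sphere_top f UNIV y = (\<integral>\<^sup>+ x. local_index sphere_top f x \<partial>count_space {branch True y})"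
      unfolding preimage_count_def vim eq by simp
    ultimately show ?thesis by (simp add: nn_integral_count_space_finite)
  qed
qed

section \<open>Random backward orbits\<close>

definition coins :: "bool stream measure" where
  "coins = stream_space (measure_pmf (bernoulli_pmf (1 / 2)))"

text \<open>
  The branch chosen first is applied last, so that later choices enter through ever longer
  compositions of contractions and the orbit converges as its length grows; an orbit that applies
  the choices in the order in which they are made would only converge in distribution.
\<close>
primrec backward :: "nat \<Rightarrow> bool stream \<Rightarrow> complex option \<Rightarrow> complex option" where
  "backward 0 s y = y"
| "backward (Suc k) s y = branch (shd s) (backward k (stl s) y)"

lemma borel_measurable_csqrt: "csqrt \<in> borel_measurable borel"
proof -
  have "csqrt = (\<lambda>z. complex_of_real (sqrt ((cmod z + Re z) / 2)) + \<i> * complex_of_real ((if Im z < 0 then - 1 else 1) * sqrt ((cmod z - Re z) / 2)))"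
    by (rule ext, rule complex_eqI) (auto simp: sgn_real_def)
  moreover have "\<dots> \<in> borel_measurable borel" by measurable
  ultimately show ?thesis by simp
qed

lemma measurable_roots:
  "root_plus \<in> borel_measurable borel" "root_minus \<in> borel_measurable borel"
  "far_root \<in> borel_measurable borel" "near_root \<in> borel_measurable borel"
proof -
  have lin: "(\<lambda>y. 1 + 2 * y) \<in> borel_measurable (borel :: complex measure)"
    by (rule borel_measurable_continuous_onI) (intro continuous_intros)
  have "(\<lambda>y. (1 + 2 * y)\<^sup>2 - 8 * pole * y) \<in> borel_measurable (borel :: complex measure)"
    by (rule borel_measurable_continuous_onI) (intro continuous_intros)
  from measurable_compose[OF this borel_measurable_csqrt]
  have sq: "(\<lambda>y. csqrt ((1 + 2 * y)\<^sup>2 - 8 * pole * y)) \<in> borel_measurable borel" .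
  show rp: "root_plus \<in> borel_measurable borel"
    unfolding root_plus_def[abs_def] by (rule borel_measurable_divide[OF borel_measurable_add[OF lin sq] measurable_const]) simp
  show rm: "root_minus \<in> borel_measurable borel"
    unfolding root_minus_def[abs_def] by (rule borel_measurable_divide[OF borel_measurable_diff[OF lin sq] measurable_const]) simp
  have d: "(\<lambda>y. cmod (g y - pole)) \<in> borel_measurable borel" if "g \<in> borel_measurable borel" for g :: "complex \<Rightarrow> complex"
    using that by measurable
  have "{y \<in> space borel. cmod (root_minus y - pole) \<le> cmod (root_plus y - pole)} \<in> sets borel"
    by (rule borel_measurable_le[OF d[OF rm] d[OF rp]])
  then show fr: "far_root \<in> borel_measurable borel"
    unfolding far_root_def[abs_def] by (intro measurable_If rp rm)
  show "near_root \<in> borel_measurable borel"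
    unfolding near_root_def[abs_def] by (rule borel_measurable_diff[OF lin fr])
qed

lemma measurable_branch: "branch b \<in> measurable sphere_borel sphere_borel"
proof (rule measurable_on_sphere)
  show "(\<lambda>z. branch b (Some z)) \<in> measurable borel sphere_borel"
    using measurable_compose[OF measurable_roots(3) measurable_Some_sphere]
      measurable_compose[OF measurable_roots(4) measurable_Some_sphere]
    by (cases b) simp_all
qed simp

lemma prob_space_coins: "prob_space coins"
  unfolding coins_def by (intro prob_space.prob_space_stream_space measure_pmf.prob_space_axioms)

lemma space_coins [simp]: "space coins = UNIV"
  by (simp add: coins_def space_stream_space)

lemma measurable_shd_coins [measurable]: "shd \<in> measurable coins (count_space UNIV)"
  unfolding coins_def using measurable_shd[of "measure_pmf (bernoulli_pmf (1 / 2))"] by simp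

lemma measurable_stl_coins [measurable]: "stl \<in> measurable coins coins"
  unfolding coins_def by measurable

lemma measurable_backward:
  "(\<lambda>(y, s). backward k s y) \<in> measurable (sphere_borel \<Otimes>\<^sub>M coins) sphere_borel"
proof (induction k)
  case (Suc k)
  have "(\<lambda>w. backward k (stl (snd w)) (fst w)) \<in> measurable (sphere_borel \<Otimes>\<^sub>M coins) sphere_borel"
  proof -
    have "(\<lambda>w. (fst w, stl (snd w))) \<in> measurable (sphere_borel \<Otimes>\<^sub>M coins) (sphere_borel \<Otimes>\<^sub>M coins)" by measurable
    from measurable_compose[OF this Suc] show ?thesis by simp
  qed
  then have g: "(\<lambda>w. branch b (backward k (stl (snd w)) (fst w))) \<in> measurable (sphere_borel \<Otimes>\<^sub>M coins) sphere_borel" for b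
    by (rule measurable_compose[OF _ measurable_branch])
  have h: "(\<lambda>w. shd (snd w)) \<in> measurable (sphere_borel \<Otimes>\<^sub>M coins) (count_space UNIV)"
    by (rule measurable_compose[OF measurable_snd measurable_shd_coins])
  have "(\<lambda>w. branch (shd (snd w)) (backward k (stl (snd w)) (fst w))) \<in> measurable (sphere_borel \<Otimes>\<^sub>M coins) sphere_borel"
    using measurable_compose_countable[of "\<lambda>b w. branch b (backward k (stl (snd w)) (fst w))", OF g h] .
  then show ?case by (simp add: case_prod_unfold)
qed simp

lemma measurable_backward_point [measurable]: "(\<lambda>s. backward k s y) \<in> measurable coins sphere_borel"
  using measurable_compose[OF _ measurable_backward, of "\<lambda>s. (y, s)" coins k] by simp

lemma nn_integral_coins:
  assumes "u \<in> borel_measurable coins"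
  shows "(\<integral>\<^sup>+ s. u s \<partial>coins) = ((\<integral>\<^sup>+ s. u (False ## s) \<partial>coins) + (\<integral>\<^sup>+ s. u (True ## s) \<partial>coins)) / 2"
proof -
  have "(\<integral>\<^sup>+ s. u s \<partial>coins) = (\<integral>\<^sup>+ b. (\<integral>\<^sup>+ s. u (b ## s) \<partial>coins) \<partial>measure_pmf (bernoulli_pmf (1 / 2)))"
    unfolding coins_def
    by (rule prob_space.nn_integral_stream_space) (use assms in \<open>auto simp: coins_def measure_pmf.prob_space_axioms\<close>)
  also have "\<dots> = (\<integral>\<^sup>+ s. u (True ## s) \<partial>coins) * ennreal (1 / 2) + (\<integral>\<^sup>+ s. u (False ## s) \<partial>coins) * ennreal (1 - 1 / 2)"
    by (subst nn_integral_bernoulli_pmf) auto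
  also have "\<dots> = ((\<integral>\<^sup>+ s. u (False ## s) \<partial>coins) + (\<integral>\<^sup>+ s. u (True ## s) \<partial>coins)) / 2"
  proof -
    have "ennreal (1 / 2) = inverse 2"
      using divide_ennreal[of 1 2] by (simp add: divide_ennreal_def)
    moreover have "ennreal (1 - 1 / 2) = ennreal (1 / 2)" by simp
    ultimately show ?thesis by (simp only: divide_ennreal_def distrib_right add.commute)
  qed
  finally show ?thesis .
qed

text \<open>
  By definition the first choice is peeled off at the outer end. The choices being independent and
  identically distributed, the average may equally be split at the branch that is applied to y
  first, which is the form in which preimages are counted.
\<close>
lemma nn_integral_backward_rec:
  assumes "u \<in> borel_measurable sphere_borel"
  shows "(\<integral>\<^sup>+ s. u (backward (Suc k) s y) \<partial>coins)
    = ((\<integral>\<^sup>+ s. u (backward k s (branch False y)) \<partial>coins) + (\<integral>\<^sup>+ s. u (backward k s (branch True y)) \<partial>coins)) / 2"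
  using assms
proof (induction k arbitrary: u)
  have step: "(\<integral>\<^sup>+ s. u (backward (Suc k) s y) \<partial>coins)
    = ((\<integral>\<^sup>+ s. u (branch False (backward k s y)) \<partial>coins) + (\<integral>\<^sup>+ s. u (branch True (backward k s y)) \<partial>coins)) / 2"
    if "u \<in> borel_measurable sphere_borel" for u :: "complex option \<Rightarrow> ennreal" and k y
    using nn_integral_coins[OF measurable_compose[OF measurable_backward_point that], of "Suc k" y] by simp
  {
    case 0
    have "emeasure coins UNIV = 1" using prob_space.emeasure_space_1[OF prob_space_coins] by simp
    then show ?case using step[OF 0, of 0 y] by simp
  next
    case (Suc k)
    have m: "(\<lambda>x. u (branch b x)) \<in> borel_measurable sphere_borel" for b
      using measurable_compose[OF measurable_branch Suc(2)] .
    define J where "J k y = (\<integral>\<^sup>+ s. u (backward k s y) \<partial>coins)" for k y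
    define K where "K b k y = (\<integral>\<^sup>+ s. u (branch b (backward k s y)) \<partial>coins)" for b k y
    have e1: "J (Suc (Suc k)) y = (K False (Suc k) y + K True (Suc k) y) / 2"
      unfolding J_def K_def by (rule step[OF Suc(2)])
    have e2: "K b (Suc k) y = (K b k (branch False y) + K b k (branch True y)) / 2" for b
      unfolding K_def by (rule Suc.IH[OF m])
    have e3: "J (Suc k) x = (K False k x + K True k x) / 2" for x
      unfolding J_def K_def by (rule step[OF Suc(2)])
    have "J (Suc (Suc k)) y = (J (Suc k) (branch False y) + J (Suc k) (branch True y)) / 2"
      unfolding e1 e2 e3 by (simp add: add_divide_distrib_ennreal ac_simps)
    then show ?case unfolding J_def .
  }
qed

text \<open>
  Off the critical values, the 2^k compositions of branches enumerate the preimages without repetition,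
  so each preimage is hit with probability 2^(-k).
\<close>
lemma preimage_card_backward:
  assumes A: "A \<in> sets sphere_borel" and "y \<notin> exceptional k"
  shows "emeasure (count_space UNIV) (A \<inter> (f ^^ k) -` {y}) = 2 ^ k * (\<integral>\<^sup>+ s. indicator A (backward k s y) \<partial>coins)"
  using assms(2)
proof (induction k arbitrary: y)
  case 0
  have "emeasure coins UNIV = 1" using prob_space.emeasure_space_1[OF prob_space_coins] by simp
  moreover have "A \<inter> (f ^^ 0) -` {y} = (if y \<in> A then {y} else {})" by auto
  ultimately show ?case by (auto simp: indicator_def)
next
  case (Suc k)
  have ne: "branch False y \<noteq> branch True y" using Suc.prems by (auto simp: branch_values_def)
  have ind: "(indicator A :: _ \<Rightarrow> ennreal) \<in> borel_measurable sphere_borel" using A by simp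
  have "A \<inter> (f ^^ Suc k) -` {y} = (A \<inter> (f ^^ k) -` {branch False y}) \<union> (A \<inter> (f ^^ k) -` {branch True y})"
    unfolding funpow_Suc_vimage by blast
  then have "emeasure (count_space UNIV) (A \<inter> (f ^^ Suc k) -` {y})
      = emeasure (count_space UNIV) (A \<inter> (f ^^ k) -` {branch False y}) + emeasure (count_space UNIV) (A \<inter> (f ^^ k) -` {branch True y})"
    using ne by (subst plus_emeasure) auto
  also have "\<dots> = 2 ^ k * ((\<integral>\<^sup>+ s. indicator A (backward k s (branch False y)) \<partial>coins)
      + (\<integral>\<^sup>+ s. indicator A (backward k s (branch True y)) \<partial>coins))"
    using Suc.IH[OF branch_not_exceptional[OF Suc.prems]] by (simp add: distrib_left)
  also have "\<dots> = 2 ^ Suc k * (((\<integral>\<^sup>+ s. indicator A (backward k s (branch False y)) \<partial>coins)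
      + (\<integral>\<^sup>+ s. indicator A (backward k s (branch True y)) \<partial>coins)) / 2)"
  proof -
    have "2 * (S / 2) = S" for S :: ennreal
      by (simp add: ennreal_times_divide mult.commute[of 2] ennreal_mult_divide_eq)
    then show ?thesis by (simp only: power_Suc2 mult.assoc)
  qed
  finally show ?case unfolding nn_integral_backward_rec[OF ind] .
qed

definition backward_dist :: "nat \<Rightarrow> complex option measure" where
  "backward_dist k = distr (normalized_vol riemann_sphere \<Otimes>\<^sub>M coins) sphere_borel (\<lambda>(y, s). backward k s y)"

lemma sets_backward_dist [simp]: "sets (backward_dist k) = sets sphere_borel"
  by (simp add: backward_dist_def)

lemma measurable_backward_vol:
  "(\<lambda>(y, s). backward k s y) \<in> measurable (normalized_vol riemann_sphere \<Otimes>\<^sub>M coins) sphere_borel"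
  using measurable_backward[of k]
  by (simp add: measurable_cong_sets[OF sets_pair_measure_cong[OF sets_normalized_vol refl] refl])

lemma prob_space_pair: "prob_space (normalized_vol riemann_sphere \<Otimes>\<^sub>M coins)"
  by (intro prob_space_pair prob_space_normalized_vol prob_space_coins)

lemma prob_space_backward_dist: "prob_space (backward_dist k)"
  unfolding backward_dist_def by (rule prob_space.prob_space_distr[OF prob_space_pair measurable_backward_vol])

lemma AE_not_exceptional:
  assumes "finite S" shows "AE y in normalized_vol riemann_sphere. y \<notin> S"
proof (rule AE_normalized_vol)
  have "finite (Some -` S)" using assms by (rule finite_vimageI) simp
  then have "Some -` S \<in> null_sets lborel" by (rule finite_imp_null_set_lborel)
  then have "AE z in lborel. z \<notin> Some -` S" by (rule AE_not_in)
  then show "AE z in lborel. Some z \<notin> S" by simp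
qed

text \<open>
  The normalized pullback of the area is the law of the end of a random backward orbit of length k
  that starts at an area-distributed point.
\<close>
lemma pullback_measure_funpow:
  "scale_measure (1 / of_nat 2 ^ k) (pullback_measure sphere_top (f ^^ k) (normalized_vol riemann_sphere)) = backward_dist k"
proof -
  interpret C: prob_space coins by (rule prob_space_coins)
  have "pullback_measure sphere_top (f ^^ k) (normalized_vol riemann_sphere) = scale_measure (2 ^ k) (backward_dist k)"
    unfolding pullback_measure_def
  proof (rule measure_of_borel_of_eq)
    show "sets (scale_measure (2 ^ k) (backward_dist k)) = sets (borel_of sphere_top)" by simp
    fix A assume A: "A \<in> sets (borel_of sphere_top)"
    have "(\<integral>\<^sup>+ y. preimage_count sphere_top (f ^^ k) A y \<partial>normalized_vol riemann_sphere)
      = (\<integral>\<^sup>+ y. 2 ^ k * (\<integral>\<^sup>+ s. indicator A (backward k s y) \<partial>coins) \<partial>normalized_vol riemann_sphere)"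
      by (rule nn_integral_cong_AE, rule eventually_mono[OF AE_not_exceptional[OF finite_exceptional[of k]]])
         (simp add: preimage_count_eq_card preimage_card_backward[OF A])
    also have "\<dots> = 2 ^ k * (\<integral>\<^sup>+ y. (\<integral>\<^sup>+ s. indicator A (backward k s y) \<partial>coins) \<partial>normalized_vol riemann_sphere)"
    proof (rule nn_integral_cmult)
      have "(\<lambda>(y, s). indicator A (backward k s y) :: ennreal) \<in> borel_measurable (normalized_vol riemann_sphere \<Otimes>\<^sub>M coins)"
        using measurable_compose[OF measurable_backward_vol borel_measurable_indicator[OF A]] by (simp add: case_prod_unfold)
      then show "(\<lambda>y. \<integral>\<^sup>+ s. indicator A (backward k s y) \<partial>coins) \<in> borel_measurable (normalized_vol riemann_sphere)"
        by (rule C.borel_measurable_nn_integral)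
    qed
    also have "(\<integral>\<^sup>+ y. (\<integral>\<^sup>+ s. indicator A (backward k s y) \<partial>coins) \<partial>normalized_vol riemann_sphere)
      = (\<integral>\<^sup>+ w. indicator A (case w of (y, s) \<Rightarrow> backward k s y) \<partial>(normalized_vol riemann_sphere \<Otimes>\<^sub>M coins))"
    proof -
      have "(\<lambda>w. indicator A (case w of (y, s) \<Rightarrow> backward k s y) :: ennreal)
          \<in> borel_measurable (normalized_vol riemann_sphere \<Otimes>\<^sub>M coins)"
        by (rule measurable_compose[OF measurable_backward_vol borel_measurable_indicator[OF A]])
      from C.nn_integral_fst[OF this] show ?thesis by simp
    qed
    also have "\<dots> = emeasure (backward_dist k) A"
      unfolding backward_dist_def
      using A by (subst nn_integral_distr[OF measurable_backward_vol, symmetric]) (auto intro: nn_integral_indicator)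
    finally show "(\<integral>\<^sup>+ y. preimage_count sphere_top (f ^^ k) A y \<partial>normalized_vol riemann_sphere)
        = emeasure (scale_measure (2 ^ k) (backward_dist k)) A" by simp
  qed
  moreover have "1 / 2 ^ k * 2 ^ k = (1 :: ennreal)"
    by (metis ennreal_divide_times ennreal_mult_divide_eq ennreal_top_neq_one mult.commute mult_1 power_eq_top_ennreal top_neq_ennreal zero_neq_numeral power_eq_0_iff ennreal_numeral)
  ultimately show ?thesis by simp
qed

end

section \<open>Contraction of the inverse branches\<close>

context small_parameter
begin

text \<open>
  A neighbourhood of infinity that both branches map into itself; in terms of z it is |z| \<ge> 3/4
  together with infinity. The point 0 has to be excluded because its coordinate in the chart at
  infinity is 1/0 = 0.
\<close>
definition trap :: "complex option set" where
  "trap = {x. x \<noteq> Some 0 \<and> cmod (sphere_coord 1 x) \<le> 4 / 3}"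

lemma None_in_trap [simp]: "None \<in> trap"
  by (simp add: trap_def sphere_coord_def)

lemma Some_in_trap: "Some z \<in> trap \<longleftrightarrow> 3 / 4 \<le> cmod z"
proof (cases "z = 0")
  case False
  then have "1 / cmod z \<le> 4 / 3 \<longleftrightarrow> 3 / 4 \<le> cmod z" by (simp add: field_simps)
  then show ?thesis using False by (simp add: trap_def sphere_coord_def norm_divide)
qed (simp add: trap_def)

lemma trap_param: "x \<in> trap \<Longrightarrow> sphere_param 1 (sphere_coord 1 x) = x"
  by (rule sphere_param_coord) (auto simp: trap_def)

text \<open>
  The nearer root is at most the geometric mean of the two distances away, whose square is \<kappa>.
\<close>
lemma near_root_close: "cmod (near_root v - pole) \<le> 1 / 40"
proof -
  have "(cmod (near_root v - pole))\<^sup>2 \<le> cmod (far_root v - pole) * cmod (near_root v - pole)"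
    using near_le_far[of v] by (simp add: power2_eq_square mult_right_mono)
  also have "\<dots> = \<kappa>" using root_pole_prod[of v] kappa_pos by (metis abs_of_pos norm_minus_cancel norm_mult norm_of_real)
  also have "\<dots> \<le> (1 / 40)\<^sup>2" using kappa_le t_small by (simp add: power2_eq_square)
  finally show ?thesis by (rule power2_le_imp_le) simp
qed

lemma cmod_pole: "cmod (1 - pole) = t / 2" "cmod pole = 1 - t / 2"
proof -
  have "1 - pole = of_real (t / 2)" by (simp add: pole_def)
  then show "cmod (1 - pole) = t / 2" using t_pos by (metis abs_of_pos half_gt_zero norm_of_real)
  have "0 \<le> 1 - t / 2" using t_small by simp
  then show "cmod pole = 1 - t / 2" unfolding pole_def by (metis abs_of_nonneg norm_of_real)
qed

lemma near_root_bounds: "cmod (1 - near_root v) \<le> 1 / 38" "37 / 38 \<le> cmod (near_root v)"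
proof -
  have "1 - near_root v = (1 - pole) - (near_root v - pole)" by simp
  then have "cmod (1 - near_root v) \<le> cmod (1 - pole) + cmod (near_root v - pole)"
    by (metis norm_triangle_ineq4)
  then show c: "cmod (1 - near_root v) \<le> 1 / 38"
    using near_root_close[of v] t_small by (simp add: cmod_pole)
  have "cmod 1 \<le> cmod (1 - near_root v) + cmod (near_root v)"
    by (metis diff_add_cancel norm_triangle_ineq)
  then show "37 / 38 \<le> cmod (near_root v)" using c by simp
qed

lemma branch_True_in_trap: "branch True y \<in> trap"
proof (cases y)
  case None
  then show ?thesis using t_small by (simp add: Some_in_trap cmod_pole)
next
  case (Some v)
  then show ?thesis using near_root_bounds(2)[of v] by (simp add: Some_in_trap)
qed

text \<open>
  The roots have sum 1 + 2 v, and the near root is almost 1, so the far root is almost 2 v.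
\<close>
lemma far_root_bounds:
  assumes v: "3 / 4 \<le> cmod v"
  shows "7 / 16 \<le> cmod (far_root v - pole)" "3 / 4 \<le> cmod (far_root v)"
    "cmod (far_root v) \<le> 8 * cmod (1 - far_root v)"
proof -
  have f: "far_root v = 2 * v + (1 - near_root v)" by (simp add: near_root_def)
  have "cmod (2 * v) \<le> cmod (far_root v) + cmod (1 - near_root v)"
    unfolding f by (metis add_diff_cancel_right' norm_triangle_ineq4)
  then have a: "3 / 2 - 1 / 38 \<le> cmod (far_root v)" using near_root_bounds(1)[of v] v by (simp add: norm_mult)
  then show "3 / 4 \<le> cmod (far_root v)" by simp
  have "cmod (far_root v) \<le> cmod (far_root v - 1) + cmod 1"
    by (metis diff_add_cancel norm_triangle_ineq)
  then have b: "cmod (far_root v) - 1 \<le> cmod (far_root v - 1)" by simp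
  have "cmod (far_root v - 1) \<le> cmod (far_root v - pole) + cmod (1 - pole)"
    using norm_triangle_ineq4[of "far_root v - pole" "1 - pole"] by simp
  then show "7 / 16 \<le> cmod (far_root v - pole)" using a b t_small by (simp add: cmod_pole)
  have "cmod (1 - far_root v) = cmod (far_root v - 1)" by (rule norm_minus_commute)
  then show "cmod (far_root v) \<le> 8 * cmod (1 - far_root v)" using a b by simp
qed

text \<open>
  With the far root at a definite distance from the pole, the fixed product of the distances improves
  the bound for the near root from order sqrt t to order t.
\<close>
lemma near_root_very_close:
  assumes v: "3 / 4 \<le> cmod v" shows "cmod (1 - near_root v) \<le> 2 * t"
proof -
  have "cmod (far_root v - pole) * cmod (near_root v - pole) = \<kappa>"
    using root_pole_prod[of v] kappa_pos by (metis abs_of_pos norm_minus_cancel norm_mult norm_of_real)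
  moreover have "7 / 16 * cmod (near_root v - pole) \<le> cmod (far_root v - pole) * cmod (near_root v - pole)"
    using far_root_bounds(1)[OF v] by (intro mult_right_mono) auto
  ultimately have "cmod (near_root v - pole) \<le> 8 / 7 * t" using kappa_le by simp
  moreover have "cmod (1 - near_root v) \<le> cmod (1 - pole) + cmod (near_root v - pole)"
    using norm_triangle_ineq4[of "1 - pole" "near_root v - pole"] by simp
  ultimately show ?thesis using t_pos by (simp add: cmod_pole)
qed

lemma branch_False_in_trap: "y \<in> trap \<Longrightarrow> branch False y \<in> trap"
proof (cases y)
  case (Some v)
  then show "y \<in> trap \<Longrightarrow> branch False y \<in> trap"
    using far_root_bounds(2)[of v] by (simp add: Some_in_trap)
qed simp

lemma branch_in_trap: "y \<in> trap \<Longrightarrow> branch b y \<in> trap"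
  using branch_False_in_trap branch_True_in_trap by (cases b) auto

lemma branch_True_close: 
  assumes "y \<in> trap" shows "cmod (1 - sphere_coord 1 (branch True y)) \<le> 8 * t"
proof -
  have *: "cmod (1 - 1 / z) \<le> 8 * t" if "cmod (1 - z) \<le> 2 * t" "1 / 2 \<le> cmod z" for z
  proof -
    have "z \<noteq> 0" using that(2) by auto
    then have "cmod (1 - 1 / z) = cmod (1 - z) / cmod z"
      by (simp add: norm_divide[symmetric] diff_divide_distrib norm_minus_commute)
    also have "\<dots> \<le> (2 * t) / (1 / 2)" using that t_pos by (intro frac_le) auto
    finally show ?thesis using t_pos by simp
  qed
  show ?thesis
  proof (cases y)
    case None
    have "cmod (1 - pole) \<le> 2 * t" "1 / 2 \<le> cmod pole" using t_pos t_small by (simp_all add: cmod_pole)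
    from *[OF this] show ?thesis using None by (simp add: sphere_coord_def)
  next
    case (Some v)
    then have "3 / 4 \<le> cmod v" using assms by (simp add: Some_in_trap)
    from *[OF near_root_very_close[OF this]] near_root_bounds(2)[of v]
    show ?thesis using Some by (simp add: sphere_coord_def)
  qed
qed

lemma branch_False_apart:
  assumes "y \<in> trap" shows "1 / 8 \<le> cmod (1 - sphere_coord 1 (branch False y))"
proof (cases y)
  case None
  then show ?thesis by (simp add: sphere_coord_def)
next
  case (Some v)
  then have v: "3 / 4 \<le> cmod v" using assms by (simp add: Some_in_trap)
  let ?z = "far_root v"
  have z: "?z \<noteq> 0" using far_root_bounds(2)[OF v] by auto
  have "cmod (1 - 1 / ?z) = cmod (1 - ?z) / cmod ?z"
    using z by (simp add: norm_divide[symmetric] diff_divide_distrib norm_minus_commute)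
  also have "1 / 8 \<le> cmod (1 - ?z) / cmod ?z"
    using far_root_bounds(3)[OF v] z by (simp add: field_simps)
  finally show ?thesis using Some by (simp add: sphere_coord_def)
qed

lemma chart_1_f:
  assumes "x \<in> trap" "f x \<in> trap"
  defines "w \<equiv> sphere_coord 1 x"
  shows "w \<noteq> 1" "sphere_coord 1 (f x) = of_real (2 - t) * w - of_real t + of_real t / (1 - w)"
proof -
  have x: "x = sphere_param (Suc 0) w" using trap_param[OF assms(1)] by (simp add: w_def)
  then have fx: "f x = hpoint (1 - w) (2 * w * (1 - pole * w))" using f_chart_1 by simp
  show w1: "w \<noteq> 1"
  proof
    assume "w = 1"
    then have "f x = Some 0" using fx pole_nz by (simp add: hpoint_def)
    then show False using assms(2) by (simp add: trap_def)
  qed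
  have "sphere_coord 1 (f x) = 2 * w * (1 - pole * w) / (1 - w)"
    unfolding fx using sphere_coord_hpoint(2) by simp
  also have "\<dots> = of_real (2 - t) * w - of_real t + of_real t / (1 - w)"
    using w1 by (simp add: pole_def divide_simps) (simp add: algebra_simps)
  finally show "sphere_coord 1 (f x) = of_real (2 - t) * w - of_real t + of_real t / (1 - w)" .
qed

text \<open>
  In the coordinate w = 1/z, f is the map (2 - t) w - t + t / (1 - w). The pole at w = 1 only
  matters near 1: at the preimages that stay away from 1, f expands by nearly 2, and at those
  within 8 t of 1 the last term dominates and f expands by a factor of order at least 1/t. Both are read off
  from difference quotients, so no path between the two preimages has to be followed.
\<close>
lemma branch_contracts:
  assumes "y \<in> trap" "y' \<in> trap"
  shows "cmod (sphere_coord 1 (branch b y) - sphere_coord 1 (branch b y')) \<le> 2 / 3 * cmod (sphere_coord 1 y - sphere_coord 1 y')"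
proof -
  define w w' where "w = sphere_coord 1 (branch b y)" and "w' = sphere_coord 1 (branch b y')"
  have w: "w \<noteq> 1" "sphere_coord 1 y = of_real (2 - t) * w - of_real t + of_real t / (1 - w)"
    using chart_1_f[of "branch b y"] branch_in_trap assms(1) by (auto simp: w_def)
  have w': "w' \<noteq> 1" "sphere_coord 1 y' = of_real (2 - t) * w' - of_real t + of_real t / (1 - w')"
    using chart_1_f[of "branch b y'"] branch_in_trap assms(2) by (auto simp: w'_def)
  define q where "q = of_real t / ((1 - w) * (1 - w'))"
  have "of_real t / (1 - w) - of_real t / (1 - w') = (w - w') * q"
    using w(1) w'(1) unfolding q_def by (simp add: divide_simps) (simp add: algebra_simps)
  then have e: "sphere_coord 1 y - sphere_coord 1 y' = (w - w') * (of_real (2 - t) + q)"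
    unfolding w(2) w'(2) by (simp add: algebra_simps)
  have t2: "cmod (of_real (2 - t)) = 2 - t" using t_small by (metis abs_of_nonneg diff_ge_0_iff_ge norm_of_real order_trans zero_le_numeral one_le_numeral divide_le_eq_1_pos zero_less_numeral le_divide_eq_1_pos)
  have cq: "cmod q = t / (cmod (1 - w) * cmod (1 - w'))"
    using t_pos by (simp add: q_def norm_divide norm_mult)
  have pos: "0 < cmod (1 - w)" "0 < cmod (1 - w')" using w(1) w'(1) by auto
  have "3 / 2 \<le> cmod (of_real (2 - t) + q)"
  proof (cases b)
    case False
    then have "1 / 8 \<le> cmod (1 - w)" "1 / 8 \<le> cmod (1 - w')"
      using branch_False_apart assms by (auto simp: w_def w'_def)
    then have "1 / 8 * (1 / 8) \<le> cmod (1 - w) * cmod (1 - w')" by (intro mult_mono) auto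
    then have "cmod q \<le> t / (1 / 64)" unfolding cq using t_pos by (intro divide_left_mono) (auto intro: mult_pos_pos pos)
    moreover have "cmod (of_real (2 - t)) - cmod q \<le> cmod (of_real (2 - t) + q)" by (metis norm_diff_ineq)
    ultimately show ?thesis using t2 t_small by simp
  next
    case True
    then have "cmod (1 - w) \<le> 8 * t" "cmod (1 - w') \<le> 8 * t"
      using branch_True_close assms by (auto simp: w_def w'_def)
    then have "cmod (1 - w) * cmod (1 - w') \<le> (8 * t) * (8 * t)" using pos t_pos by (intro mult_mono) auto
    then have "t / ((8 * t) * (8 * t)) \<le> cmod q" unfolding cq using t_pos pos by (intro divide_left_mono) (auto intro: mult_pos_pos)
    moreover have "t / ((8 * t) * (8 * t)) = 1 / (64 * t)" using t_pos by simp
    moreover have "15 \<le> 1 / (64 * t)" using t_pos t_small by (simp add: field_simps)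
    moreover have "cmod q - cmod (of_real (2 - t)) \<le> cmod (of_real (2 - t) + q)" by (metis add.commute norm_diff_ineq)
    ultimately show ?thesis using t2 t_pos by simp
  qed
  then have "3 / 2 * cmod (w - w') \<le> cmod (sphere_coord 1 y - sphere_coord 1 y')"
    unfolding e norm_mult by (metis mult.commute mult_right_mono norm_ge_zero)
  then show ?thesis by (simp add: w_def w'_def)
qed

lemma backward_in_trap: "y \<in> trap \<Longrightarrow> backward k s y \<in> trap"
  by (induction k arbitrary: s) (auto intro: branch_in_trap)

lemma backward_contracts:
  assumes "y \<in> trap" "y' \<in> trap"
  shows "cmod (sphere_coord 1 (backward k s y) - sphere_coord 1 (backward k s y')) \<le> (2 / 3) ^ k * (8 / 3)"
proof (induction k arbitrary: s)
  case 0
  have "cmod (sphere_coord 1 y) \<le> 4 / 3" "cmod (sphere_coord 1 y') \<le> 4 / 3" using assms by (auto simp: trap_def)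
  then show ?case using norm_triangle_ineq4[of "sphere_coord 1 y" "sphere_coord 1 y'"] by simp
next
  case (Suc k)
  have "cmod (sphere_coord 1 (backward (Suc k) s y) - sphere_coord 1 (backward (Suc k) s y'))
      \<le> 2 / 3 * cmod (sphere_coord 1 (backward k (stl s) y) - sphere_coord 1 (backward k (stl s) y'))"
    unfolding backward.simps by (intro branch_contracts backward_in_trap assms)
  also have "\<dots> \<le> 2 / 3 * ((2 / 3) ^ k * (8 / 3))" using Suc.IH by (intro mult_left_mono) auto
  finally show ?case by simp
qed

lemma backward_add: "backward (k + m) s y = backward k s (backward m (sdrop k s) y)"
  by (induction k arbitrary: s) auto

lemma backward_Cauchy:
  assumes "y \<in> trap"
  shows "cmod (sphere_coord 1 (backward (k + m) s None) - sphere_coord 1 (backward k s y)) \<le> (2 / 3) ^ k * (8 / 3)"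
  unfolding backward_add by (intro backward_contracts backward_in_trap assms None_in_trap)

text \<open>The point coded by a sequence of branches, in the coordinate 1/z.\<close>
definition coded :: "bool stream \<Rightarrow> complex" where
  "coded s = lim (\<lambda>k. sphere_coord 1 (backward k s None))"

lemma coded_limit: "(\<lambda>k. sphere_coord 1 (backward k s None)) \<longlonglongrightarrow> coded s"
proof -
  have "Cauchy (\<lambda>k. sphere_coord 1 (backward k s None))"
  proof (rule CauchyI)
    fix e :: real assume e: "0 < e"
    have "(\<lambda>k. (2 / 3) ^ k * (16 / 3)) \<longlonglongrightarrow> 0 * (16 / 3 :: real)"
      by (intro tendsto_mult tendsto_const LIMSEQ_realpow_zero) auto
    then have "\<forall>\<^sub>F k in sequentially. (2 / 3) ^ k * (16 / 3) < e"
      using e by (intro order_tendstoD(2)) auto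
    then obtain N where N: "(2 / 3) ^ N * (16 / 3) < e" by (auto simp: eventually_sequentially)
    show "\<exists>M. \<forall>m\<ge>M. \<forall>n\<ge>M. cmod (sphere_coord 1 (backward m s None) - sphere_coord 1 (backward n s None)) < e"
    proof (intro exI[of _ N] allI impI)
      fix m n assume "N \<le> m" "N \<le> n"
      then obtain i j where "m = N + i" "n = N + j" by (metis le_iff_add)
      then have "cmod (sphere_coord 1 (backward m s None) - sphere_coord 1 (backward N s None)) \<le> (2 / 3) ^ N * (8 / 3)"
        "cmod (sphere_coord 1 (backward n s None) - sphere_coord 1 (backward N s None)) \<le> (2 / 3) ^ N * (8 / 3)"
        using backward_Cauchy[OF None_in_trap] by auto
      then show "cmod (sphere_coord 1 (backward m s None) - sphere_coord 1 (backward n s None)) < e"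
        using N norm_triangle_ineq4[of "sphere_coord 1 (backward m s None) - sphere_coord 1 (backward N s None)"
            "sphere_coord 1 (backward n s None) - sphere_coord 1 (backward N s None)"] by simp
    qed
  qed
  then show ?thesis unfolding coded_def by (simp add: Cauchy_convergent_iff convergent_LIMSEQ_iff)
qed

lemma coded_approx:
  assumes "y \<in> trap"
  shows "cmod (coded s - sphere_coord 1 (backward k s y)) \<le> (2 / 3) ^ k * (8 / 3)"
proof (rule LIMSEQ_le_const2)
  show "(\<lambda>m. cmod (sphere_coord 1 (backward (k + m) s None) - sphere_coord 1 (backward k s y))) \<longlonglongrightarrow> cmod (coded s - sphere_coord 1 (backward k s y))"
    using LIMSEQ_ignore_initial_segment[OF coded_limit, of k s] by (intro tendsto_intros) (simp add: add.commute)
qed (use backward_Cauchy[OF assms] in auto)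

lemma coded_bound: "cmod (coded s) \<le> 4 / 3"
proof (rule LIMSEQ_le_const2[OF tendsto_norm[OF coded_limit]])
  have "cmod (sphere_coord 1 (backward k s None)) \<le> 4 / 3" for k
    using backward_in_trap[OF None_in_trap, of k s] by (simp add: trap_def)
  then show "\<exists>N. \<forall>n\<ge>N. cmod (sphere_coord 1 (backward n s None)) \<le> 4 / 3" by blast
qed

text \<open>
  The first choice decides which branch is applied last, hence whether the coded point is near 1.
\<close>
lemma coded_True: "shd s \<Longrightarrow> cmod (1 - coded s) \<le> 8 * t"
proof (rule LIMSEQ_le_const2)
  show "(\<lambda>k. cmod (1 - sphere_coord 1 (backward (Suc k) s None))) \<longlonglongrightarrow> cmod (1 - coded s)"
    by (intro tendsto_intros LIMSEQ_Suc[OF coded_limit])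
  assume "shd s"
  then show "\<exists>N. \<forall>n\<ge>N. cmod (1 - sphere_coord 1 (backward (Suc n) s None)) \<le> 8 * t"
    using branch_True_close[OF backward_in_trap[OF None_in_trap]] by auto
qed

lemma coded_False: "\<not> shd s \<Longrightarrow> 1 / 8 \<le> cmod (1 - coded s)"
proof (rule LIMSEQ_le_const)
  show "(\<lambda>k. cmod (1 - sphere_coord 1 (backward (Suc k) s None))) \<longlonglongrightarrow> cmod (1 - coded s)"
    by (intro tendsto_intros LIMSEQ_Suc[OF coded_limit])
  assume "\<not> shd s"
  then show "\<exists>N. \<forall>n\<ge>N. 1 / 8 \<le> cmod (1 - sphere_coord 1 (backward (Suc n) s None))"
    using branch_False_apart[OF backward_in_trap[OF None_in_trap]] by auto
qed

lemma measurable_coded [measurable]: "coded \<in> borel_measurable coins"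
  by (rule borel_measurable_LIMSEQ_metric[OF _ coded_limit])
     (rule measurable_compose[OF measurable_backward_point borel_measurable_sphere_coord])

lemma measurable_sphere_param [measurable]: "sphere_param i \<in> measurable borel sphere_borel"
  using measurable_borel_of[OF continuous_map_sphere_param] by (simp add: borel_of_euclidean)

definition \<mu> :: "complex option measure" where
  "\<mu> = distr coins sphere_borel (\<lambda>s. sphere_param 1 (coded s))"

lemma sets_mu [simp, measurable_cong]: "sets \<mu> = sets sphere_borel"
  by (simp add: \<mu>_def)

lemma space_mu [simp]: "space \<mu> = UNIV"
  by (simp add: \<mu>_def)

lemma measurable_coded_point: "(\<lambda>s. sphere_param 1 (coded s)) \<in> measurable coins sphere_borel"
  by (rule measurable_compose[OF measurable_coded measurable_sphere_param])

lemma prob_space_mu: "prob_space \<mu>"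
  unfolding \<mu>_def by (rule prob_space.prob_space_distr[OF prob_space_coins measurable_coded_point])

section \<open>Equidistribution of preimages\<close>

definition bmean :: "(complex option \<Rightarrow> real) \<Rightarrow> nat \<Rightarrow> complex option \<Rightarrow> real" where
  "bmean \<phi> k y = (LINT s|coins. \<phi> (backward k s y))"

context
  fixes \<phi> :: "complex option \<Rightarrow> real" and B :: real
  assumes \<phi>: "continuous_map sphere_top euclideanreal \<phi>" and \<phi>0: "\<And>x. 0 \<le> \<phi> x" and \<phi>B: "\<And>x. \<phi> x \<le> B"
begin

lemma phi_measurable: "\<phi> \<in> borel_measurable sphere_borel"
  using measurable_borel_of[OF \<phi>] by (simp add: borel_of_euclidean)

lemma bmean_integrable: "integrable coins (\<lambda>s. \<phi> (backward k s y))"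
proof -
  interpret prob_space coins by (rule prob_space_coins)
  show ?thesis
    using \<phi>0 \<phi>B by (intro integrable_const_bound[of _ B] measurable_compose[OF measurable_backward_point phi_measurable]) auto
qed

lemma bmean_nn: "ennreal (bmean \<phi> k y) = (\<integral>\<^sup>+ s. ennreal (\<phi> (backward k s y)) \<partial>coins)"
  unfolding bmean_def using \<phi>0 by (intro nn_integral_eq_integral[symmetric] bmean_integrable) auto

lemma bmean_bounds: "0 \<le> bmean \<phi> k y" "bmean \<phi> k y \<le> B"
proof -
  interpret prob_space coins by (rule prob_space_coins)
  show "0 \<le> bmean \<phi> k y" unfolding bmean_def using \<phi>0 by (intro Bochner_Integration.integral_nonneg) auto
  have "bmean \<phi> k y \<le> (LINT s|coins. B)"
    unfolding bmean_def using \<phi>B by (intro integral_mono bmean_integrable) auto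
  then show "bmean \<phi> k y \<le> B" using prob_space by simp
qed

lemma bmean_rec: "bmean \<phi> (Suc k) y = (bmean \<phi> k (branch False y) + bmean \<phi> k (branch True y)) / 2"
proof -
  have "ennreal (bmean \<phi> (Suc k) y) = (ennreal (bmean \<phi> k (branch False y)) + ennreal (bmean \<phi> k (branch True y))) / 2"
    unfolding bmean_nn by (rule nn_integral_backward_rec) (use phi_measurable in simp)
  also have "\<dots> = ennreal ((bmean \<phi> k (branch False y) + bmean \<phi> k (branch True y)) / 2)"
    using bmean_bounds(1) by (simp add: ennreal_plus[symmetric] divide_ennreal[symmetric] del: ennreal_plus)
  finally show ?thesis using bmean_bounds(1) by (simp add: add_nonneg_nonneg)
qed

lemma mu_phi: "(LINT x|\<mu>. \<phi> x) = (LINT s|coins. \<phi> (sphere_param 1 (coded s)))"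
  unfolding \<mu>_def by (rule integral_distr[OF measurable_coded_point phi_measurable])

lemma phi_coded_integrable: "integrable coins (\<lambda>s. \<phi> (sphere_param 1 (coded s)))"
proof -
  interpret prob_space coins by (rule prob_space_coins)
  show ?thesis
    using \<phi>0 \<phi>B by (intro integrable_const_bound[of _ B] measurable_compose[OF measurable_coded_point phi_measurable]) auto
qed

text \<open>
  All backward orbits of length k that use the same choices and start in the trap end close to the
  point that these choices code, and \<phi> is uniformly continuous.
\<close>
lemma bmean_trap:
  assumes e: "0 < e"
  shows "\<exists>K. \<forall>k\<ge>K. \<forall>y\<in>trap. \<bar>bmean \<phi> k y - (LINT x|\<mu>. \<phi> x)\<bar> \<le> e"
proof -
  interpret prob_space coins by (rule prob_space_coins)
  let ?g = "\<lambda>w. \<phi> (sphere_param 1 w)"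
  have "continuous_on UNIV ?g"
    using continuous_map_compose[OF continuous_map_sphere_param[of 1] \<phi>] by (simp add: o_def)
  then have "uniformly_continuous_on (cball 0 (4 / 3)) ?g"
    by (intro compact_uniformly_continuous) (auto intro: continuous_on_subset)
  then obtain d where d: "0 < d" "\<And>w w'. cmod w \<le> 4 / 3 \<Longrightarrow> cmod w' \<le> 4 / 3 \<Longrightarrow> dist w' w < d \<Longrightarrow> dist (?g w') (?g w) < e"
    using e unfolding uniformly_continuous_on_def by (metis mem_cball_0)
  have "(\<lambda>k. (2 / 3) ^ k * (8 / 3)) \<longlonglongrightarrow> 0 * (8 / 3 :: real)"
    by (intro tendsto_mult tendsto_const LIMSEQ_realpow_zero) auto
  then have "\<forall>\<^sub>F k in sequentially. (2 / 3) ^ k * (8 / 3) < d"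
    using d(1) by (intro order_tendstoD(2)) auto
  then obtain K where K: "\<And>k. k \<ge> K \<Longrightarrow> (2 / 3) ^ k * (8 / 3) < d" by (auto simp: eventually_sequentially)
  show ?thesis
  proof (intro exI[of _ K] allI impI ballI)
    fix k y assume k: "K \<le> k" and y: "y \<in> trap"
    have le: "\<bar>\<phi> (backward k s y) - \<phi> (sphere_param 1 (coded s))\<bar> \<le> e" for s
    proof -
      have b: "backward k s y \<in> trap" using y by (rule backward_in_trap)
      then have "cmod (sphere_coord 1 (backward k s y)) \<le> 4 / 3" by (simp add: trap_def)
      moreover have "dist (sphere_coord 1 (backward k s y)) (coded s) < d"
        using coded_approx[OF y, of s k] K[OF k] by (simp add: dist_norm norm_minus_commute)
      ultimately have "dist (?g (sphere_coord 1 (backward k s y))) (?g (coded s)) < e"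
        using d(2) coded_bound by blast
      then show ?thesis using trap_param[OF b] by (simp add: dist_real_def)
    qed
    have "bmean \<phi> k y - (LINT x|\<mu>. \<phi> x) = (LINT s|coins. \<phi> (backward k s y) - \<phi> (sphere_param 1 (coded s)))"
      unfolding mu_phi bmean_def using bmean_integrable phi_coded_integrable by simp
    also have "\<bar>\<dots>\<bar> \<le> (LINT s|coins. \<bar>\<phi> (backward k s y) - \<phi> (sphere_param 1 (coded s))\<bar>)"
      by (rule integral_abs_bound)
    also have "\<dots> \<le> (LINT s|coins. e)"
      using le bmean_integrable phi_coded_integrable by (intro integral_mono) auto
    finally show "\<bar>bmean \<phi> k y - (LINT x|\<mu>. \<phi> x)\<bar> \<le> e" using prob_space by simp
  qed
qed

text \<open>
  One of the two preimages of every point is trapped, so the deviation outside the trap is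
  halved in each step.
\<close>
lemma bmean_uniform:
  assumes e: "0 < e"
  shows "\<exists>K. \<forall>k\<ge>K. \<forall>y. \<bar>bmean \<phi> k y - (LINT x|\<mu>. \<phi> x)\<bar> \<le> e"
proof -
  let ?m = "LINT x|\<mu>. \<phi> x"
  obtain K where K: "\<And>k y. k \<ge> K \<Longrightarrow> y \<in> trap \<Longrightarrow> \<bar>bmean \<phi> k y - ?m\<bar> \<le> e / 2"
    using bmean_trap[of "e / 2"] e by auto
  have B0: "0 \<le> B" using \<phi>0[of None] \<phi>B[of None] by linarith
  have m: "0 \<le> ?m" "?m \<le> B"
  proof -
    interpret prob_space coins by (rule prob_space_coins)
    show "0 \<le> ?m" unfolding mu_phi using \<phi>0 by (intro Bochner_Integration.integral_nonneg) auto
    have "?m \<le> (LINT s|coins. B)"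
      unfolding mu_phi using \<phi>B by (intro integral_mono phi_coded_integrable) auto
    then show "?m \<le> B" using prob_space by simp
  qed
  have dec: "\<bar>bmean \<phi> (K + j) y - ?m\<bar> \<le> e / 2 + B / 2 ^ j" for j y
  proof (induction j arbitrary: y)
    case 0
    then show ?case using bmean_bounds[of "K" y] m e by simp
  next
    case (Suc j)
    show ?case
    proof (cases "y \<in> trap")
      case True
      then have "\<bar>bmean \<phi> (K + Suc j) y - ?m\<bar> \<le> e / 2" by (intro K) auto
      moreover have "0 \<le> B / 2 ^ Suc j" using B0 by simp
      ultimately show ?thesis by linarith
    next
      case False
      have "bmean \<phi> (K + Suc j) y - ?m = (bmean \<phi> (K + j) (branch False y) - ?m) / 2 + (bmean \<phi> (K + j) (branch True y) - ?m) / 2"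
        using bmean_rec[of "K + j" y] by (simp add: field_simps)
      moreover have "\<bar>bmean \<phi> (K + j) (branch True y) - ?m\<bar> \<le> e / 2" by (intro K branch_True_in_trap) auto
      moreover have "\<bar>bmean \<phi> (K + j) (branch False y) - ?m\<bar> \<le> e / 2 + B / 2 ^ j" by (rule Suc.IH)
      moreover have "\<bar>z\<bar> \<le> b / 2 + a / 2" if "z = y / 2 + x / 2" "\<bar>x\<bar> \<le> a" "\<bar>y\<bar> \<le> b" for x y z a b :: real
        using that by linarith
      ultimately have "\<bar>bmean \<phi> (K + Suc j) y - ?m\<bar> \<le> (e / 2 + B / 2 ^ j) / 2 + (e / 2) / 2" by blast
      also have "\<dots> = e / 2 + B / 2 ^ Suc j" by (simp add: field_simps)
      finally show ?thesis .
    qed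
  qed
  have "(\<lambda>j. B * (1 / 2) ^ j) \<longlonglongrightarrow> B * 0"
    by (intro tendsto_mult tendsto_const LIMSEQ_realpow_zero) auto
  then have "\<forall>\<^sub>F j in sequentially. B * (1 / 2) ^ j < e / 2" using e by (intro order_tendstoD(2)) auto
  then obtain J where J: "\<And>j. j \<ge> J \<Longrightarrow> B * (1 / 2) ^ j < e / 2" by (auto simp: eventually_sequentially)
  show ?thesis
  proof (intro exI[of _ "K + J"] allI impI)
    fix k y assume "K + J \<le> k"
    then obtain j where j: "k = K + j" "J \<le> j" by (metis add_leD1 le_iff_add nat_add_left_cancel_le)
    have "B * (1 / 2) ^ j = B / 2 ^ j" by (simp add: power_one_over)
    then show "\<bar>bmean \<phi> k y - ?m\<bar> \<le> e" using dec[of j y] J[OF j(2)] unfolding j(1) by linarith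
  qed
qed

lemma backward_dist_converges: "(\<lambda>k. LINT x|backward_dist k. \<phi> x) \<longlonglongrightarrow> (LINT x|\<mu>. \<phi> x)"
proof (rule LIMSEQ_I)
  fix e :: real assume e: "0 < e"
  interpret N: prob_space "normalized_vol riemann_sphere" by (rule prob_space_normalized_vol)
  interpret C: prob_space coins by (rule prob_space_coins)
  interpret NC: pair_prob_space "normalized_vol riemann_sphere" coins ..
  obtain K where K: "\<And>k y. k \<ge> K \<Longrightarrow> \<bar>bmean \<phi> k y - (LINT x|\<mu>. \<phi> x)\<bar> \<le> e / 2"
    using bmean_uniform[of "e / 2"] e by auto
  \<comment> \<open>The averages over coins converge uniformly in the starting point, so integrating over it is harmless.\<close>
  show "\<exists>K. \<forall>k\<ge>K. norm ((LINT x|backward_dist k. \<phi> x) - (LINT x|\<mu>. \<phi> x)) < e"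
  proof (intro exI[of _ K] allI impI)
    fix k assume k: "K \<le> k"
    have m: "(\<lambda>w. \<phi> (case w of (y, s) \<Rightarrow> backward k s y)) \<in> borel_measurable (normalized_vol riemann_sphere \<Otimes>\<^sub>M coins)"
      by (rule measurable_compose[OF measurable_backward_vol phi_measurable])
    have i: "integrable (normalized_vol riemann_sphere \<Otimes>\<^sub>M coins) (\<lambda>w. \<phi> (case w of (y, s) \<Rightarrow> backward k s y))"
      using \<phi>0 \<phi>B m by (intro NC.P.integrable_const_bound[of _ B]) auto
    have "(LINT x|backward_dist k. \<phi> x) = (LINT w|(normalized_vol riemann_sphere \<Otimes>\<^sub>M coins). \<phi> (case w of (y, s) \<Rightarrow> backward k s y))"
      unfolding backward_dist_def by (rule integral_distr[OF measurable_backward_vol phi_measurable])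
    also have "\<dots> = (LINT y|normalized_vol riemann_sphere. bmean \<phi> k y)"
      unfolding bmean_def using NC.integral_fst'[OF i] by simp
    finally have a: "(LINT x|backward_dist k. \<phi> x) = (LINT y|normalized_vol riemann_sphere. bmean \<phi> k y)" .
    have ib: "integrable (normalized_vol riemann_sphere) (bmean \<phi> k)"
      unfolding bmean_def[abs_def] using NC.integrable_fst'[OF i] by simp
    have "(LINT x|backward_dist k. \<phi> x) - (LINT x|\<mu>. \<phi> x) = (LINT y|normalized_vol riemann_sphere. bmean \<phi> k y - (LINT x|\<mu>. \<phi> x))"
      unfolding a using ib by (simp add: N.prob_space)
    also have "\<bar>\<dots>\<bar> \<le> (LINT y|normalized_vol riemann_sphere. \<bar>bmean \<phi> k y - (LINT x|\<mu>. \<phi> x)\<bar>)"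
      by (rule integral_abs_bound)
    also have "\<dots> \<le> (LINT y|normalized_vol riemann_sphere. e / 2)"
      using K[OF k] ib by (intro integral_mono) auto
    finally show "norm ((LINT x|backward_dist k. \<phi> x) - (LINT x|\<mu>. \<phi> x)) < e" using e by (simp add: N.prob_space)
  qed
qed

end

lemma continuous_sphere_bounded:
  assumes "continuous_map sphere_top euclideanreal \<phi>" obtains B where "\<And>x. \<bar>\<phi> x\<bar> \<le> B"
proof -
  have "compactin euclideanreal (\<phi> ` topspace sphere_top)"
    using compact_space_Alexandroff_compactification[of "euclidean :: complex topology"]
    by (intro image_compactin[OF _ assms]) (simp add: compact_space_def)
  then have "bounded (\<phi> ` UNIV)" by (simp add: compact_imp_bounded)
  then show ?thesis using that by (auto simp: bounded_iff)
qed

lemma is_equilibrium_measure_mu: "is_equilibrium_measure riemann_sphere 2 f \<mu>"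
  unfolding is_equilibrium_measure_def riemann_sphere_simps(1) pullback_measure_funpow weak_limit_def
proof (intro conjI allI impI)
  show "prob_space \<mu>" by (rule prob_space_mu)
  show "sets \<mu> = sets sphere_borel" by simp
  fix \<phi> :: "complex option \<Rightarrow> real" assume \<phi>: "continuous_map sphere_top euclideanreal \<phi>"
  obtain B where B: "\<And>x. \<bar>\<phi> x\<bar> \<le> B" using continuous_sphere_bounded[OF \<phi>] by blast
  have m: "\<phi> \<in> borel_measurable sphere_borel"
    using measurable_borel_of[OF \<phi>] by (simp add: borel_of_euclidean)
  have c: "continuous_map sphere_top euclideanreal (\<lambda>x. \<phi> x + B)"
    using \<phi> by (intro continuous_intros) auto
  have l: "(\<lambda>k. LINT x|backward_dist k. \<phi> x + B) \<longlonglongrightarrow> (LINT x|\<mu>. \<phi> x + B)"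
  proof (rule backward_dist_converges[OF c, of "2 * B"])
    fix x show "0 \<le> \<phi> x + B" "\<phi> x + B \<le> 2 * B" using B[of x] by linarith+
  qed
  have s: "(LINT x|M. \<phi> x + B) = (LINT x|M. \<phi> x) + B" if "prob_space M" "sets M = sets sphere_borel" for M
  proof -
    interpret prob_space M by (rule that)
    have "integrable M \<phi>"
      using B m by (intro integrable_const_bound[of _ B]) (auto simp: measurable_cong_sets[OF that(2) refl])
    then show ?thesis by (simp add: prob_space)
  qed
  show "(\<lambda>k. LINT x|backward_dist k. \<phi> x) \<longlonglongrightarrow> (LINT x|\<mu>. \<phi> x)"
    using l s[OF prob_space_backward_dist sets_backward_dist] s[OF prob_space_mu sets_mu] tendsto_diff[OF l tendsto_const, of B]
    by simp
qed

end

section \<open>Uniqueness of the equilibrium measure\<close>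

lemma continuous_map_compact_support:
  fixes g :: "complex \<Rightarrow> 'b::topological_space"
  assumes g: "continuous_on UNIV g" and c: "\<And>z. cmod z > R \<Longrightarrow> g z = c"
  shows "continuous_map sphere_top euclidean (case_option c g)"
  unfolding continuous_map_def
proof (intro conjI allI impI)
  fix V :: "'b set" assume V: "openin euclidean V"
  have "open (g -` V)" using g V by (simp add: continuous_on_open_vimage)
  moreover have "Some -` {x \<in> topspace sphere_top. case_option c g x \<in> V} = g -` V" by auto
  moreover have "\<exists>R. \<forall>z. cmod z > R \<longrightarrow> Some z \<in> {x \<in> topspace sphere_top. case_option c g x \<in> V}"
    if "None \<in> {x \<in> topspace sphere_top. case_option c g x \<in> V}"
    using that c by (intro exI[of _ R]) auto
  ultimately show "openin sphere_top {x \<in> topspace sphere_top. case_option c g x \<in> V}"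
    unfolding openin_sphere_at_infinity by metis
qed simp

text \<open>
  Indicators of open sets in the plane are pointwise limits of continuous functions with compact
  support, and these sets together with the whole sphere generate the Borel sets.
\<close>
lemma sphere_measure_eqI:
  assumes M: "prob_space M" "sets M = sets sphere_borel" and N: "prob_space N" "sets N = sets sphere_borel"
    and eq: "\<And>\<phi>::complex option \<Rightarrow> real. continuous_map sphere_top euclideanreal \<phi> \<Longrightarrow> (LINT x|M. \<phi> x) = (LINT x|N. \<phi> x)"
  shows "M = N"
proof (rule measure_eqI_generator_eq[where \<Omega> = UNIV and E = "{A. A = UNIV \<or> (\<exists>U. open U \<and> A = Some ` U)}" and A = "\<lambda>_. UNIV"])
  let ?E = "{A. A = (UNIV :: complex option set) \<or> (\<exists>U. open U \<and> A = Some ` U)}"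
  interpret M: prob_space M by (rule M(1))
  interpret N: prob_space N by (rule N(1))
  have sp: "space M = UNIV" "space N = UNIV" using sets_eq_imp_space_eq[OF M(2)] sets_eq_imp_space_eq[OF N(2)] by simp_all
  show "Int_stable ?E"
  proof (rule Int_stableI)
    fix a b assume ab: "a \<in> ?E" "b \<in> ?E"
    show "a \<inter> b \<in> ?E"
    proof (cases "a = UNIV \<or> b = UNIV")
      case False
      then obtain U V where "open U" "a = Some ` U" "open V" "b = Some ` V" using ab by auto
      then show ?thesis by (auto simp: image_Int[symmetric] intro!: exI[of _ "U \<inter> V"])
    qed (use ab in auto)
  qed
  show "?E \<subseteq> Pow UNIV" by simp
  have "sigma_sets UNIV ?E = sets sphere_borel"
    unfolding sets_borel_of topspace_sphere
  proof (rule antisym)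
    show "sigma_sets UNIV ?E \<subseteq> sigma_sets UNIV {U. openin sphere_top U}"
    proof (rule sigma_sets_subseteq)
      show "?E \<subseteq> {U. openin sphere_top U}"
        using openin_topspace[of sphere_top] by auto
    qed
    show "sigma_sets UNIV {U. openin sphere_top U} \<subseteq> sigma_sets UNIV ?E"
    proof (rule sigma_sets_mono)
      show "{U. openin sphere_top U} \<subseteq> sigma_sets UNIV ?E"
      proof
        fix W assume "W \<in> {U. openin sphere_top U}"
        then consider U where "open U" "W = Some ` U" | C where "closed C" "W = insert None (Some ` (UNIV - C))"
          by (auto simp: openin_Alexandroff_compactification)
        then show "W \<in> sigma_sets UNIV ?E"
        proof cases
          case 1 then show ?thesis by (intro sigma_sets.Basic) auto
        next
          case 2
          have r: "Some ` U \<in> sigma_sets UNIV ?E" if "open U" for U :: "complex set"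
            using that by (intro sigma_sets.Basic) auto
          have "UNIV - Some ` UNIV = {None :: complex option}" by (auto simp: image_iff)
          then have "{None} \<in> sigma_sets UNIV ?E" using sigma_sets.Compl[OF r[OF open_UNIV]] by simp
          from sigma_sets_Un[OF this r[of "UNIV - C"]] have "{None} \<union> Some ` (UNIV - C) \<in> sigma_sets UNIV ?E"
            using 2(1) by (simp add: open_Diff)
          then show ?thesis using 2(2) by simp
        qed
      qed
    qed
  qed
  then show "sets M = sigma_sets UNIV ?E" "sets N = sigma_sets UNIV ?E" using M(2) N(2) by simp_all
  fix X assume "X \<in> ?E"
  then consider "X = UNIV" | U where "open U" "X = Some ` U" by auto
  then show "emeasure M X = emeasure N X"
  proof cases
    case 1
    then show ?thesis using M.emeasure_space_1 N.emeasure_space_1 sp by simp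
  next
    case 2
    \<comment> \<open>Positive exactly on U within the disc of radius n, and eventually 1 at each point of U.\<close>
    define g where "g n z = min 1 (real n * infdist z (- U)) * max 0 (min 1 (real n - cmod z))" for n z
    define h where "h n = case_option 0 (g n)" for n
    have gc: "continuous_on UNIV (g n)" for n
      unfolding g_def by (intro continuous_intros continuous_on_infdist)
    have hc: "continuous_map sphere_top euclideanreal (h n)" for n
      unfolding h_def by (rule continuous_map_compact_support[OF gc, of "real n"]) (simp add: g_def)
    have g01: "0 \<le> g n z" "g n z \<le> 1" for n z
      unfolding g_def by (auto intro!: mult_nonneg_nonneg mult_le_one infdist_nonneg)
    have lim: "(\<lambda>n. h n x) \<longlonglongrightarrow> indicator X x" if ne: "U \<noteq> UNIV" for x
    proof (cases x)
      case None then show ?thesis by (auto simp: h_def 2 indicator_def)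
    next
      case (Some z)
      show ?thesis
      proof (cases "z \<in> U")
        case False
        then show ?thesis using Some by (auto simp: h_def g_def 2 indicator_def)
      next
        case True
        have "closed (- U)" "- U \<noteq> {}" using 2(1) ne by auto
        then have p: "infdist z (- U) > 0" using True by (metis ComplD in_closed_iff_infdist_zero infdist_nonneg order_le_less)
        obtain n1 where n1: "1 / infdist z (- U) < real n1" using reals_Archimedean2 by blast
        obtain n2 where n2: "cmod z + 1 < real n2" using reals_Archimedean2 by blast
        have "g n z = 1" if "n \<ge> max n1 n2" for n
        proof -
          have "1 / infdist z (- U) < real n" "cmod z + 1 < real n" using that n1 n2 by linarith+
          then show ?thesis using p by (simp add: g_def field_simps min_def)
        qed
        then have "\<forall>\<^sub>F n in sequentially. h n x = indicator X x"
          using True Some by (intro eventually_sequentiallyI[of "max n1 n2"]) (simp add: h_def 2 indicator_def)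
        then show ?thesis by (rule tendsto_eventually)
      qed
    qed
    have XS: "X \<in> sets sphere_borel" using 2 by (simp add: sets_Some_image_sphere borel_open)
    have conv: "(\<lambda>n. LINT x|Q. h n x) \<longlonglongrightarrow> measure Q X" if ne: "U \<noteq> UNIV" and Q: "prob_space Q" "sets Q = sets sphere_borel" for Q
    proof -
      interpret Q: prob_space Q by (rule Q(1))
      have mh: "h n \<in> borel_measurable Q" for n
        using measurable_borel_of[OF hc[of n]] by (simp add: borel_of_euclidean measurable_cong_sets[OF Q(2) refl])
      have mX: "X \<in> sets Q" using XS Q(2) by simp
      have "(\<lambda>n. LINT x|Q. h n x) \<longlonglongrightarrow> (LINT x|Q. indicator X x)"
      proof (rule integral_dominated_convergence[where w = "\<lambda>_. 1"])
        show "AE x in Q. norm (h n x) \<le> 1" for n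
          using g01 by (intro AE_I2) (auto simp: h_def split: option.split)
      qed (use lim[OF ne] mh mX in auto)
      then show ?thesis using mX by simp
    qed
    have "measure M X = measure N X"
    proof (cases "U = UNIV")
      case False
      show ?thesis
        using LIMSEQ_unique[OF conv[OF False M]] conv[OF False N] eq[OF hc] by simp
    next
      case True
      \<comment> \<open>The distance to the empty complement of U carries no information here, so that factor is left out.\<close>
      define k where "k n = case_option 0 (\<lambda>z. max 0 (min 1 (real n - cmod z)))" for n
      have kc: "continuous_map sphere_top euclideanreal (k n)" for n
        unfolding k_def by (rule continuous_map_compact_support[of _ "real n"]) (auto intro!: continuous_intros)
      have kl: "(\<lambda>n. k n x) \<longlonglongrightarrow> indicator X x" for x
      proof (cases x)
        case None then show ?thesis by (auto simp: k_def 2 indicator_def)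
      next
        case (Some z)
        obtain n2 where n2: "cmod z + 1 < real n2" using reals_Archimedean2 by blast
        then have "\<forall>\<^sub>F n in sequentially. k n x = indicator X x"
          using True Some by (intro eventually_sequentiallyI[of n2]) (simp add: k_def 2 indicator_def)
        then show ?thesis by (rule tendsto_eventually)
      qed
      have conv': "(\<lambda>n. LINT x|Q. k n x) \<longlonglongrightarrow> measure Q X" if Q: "prob_space Q" "sets Q = sets sphere_borel" for Q
      proof -
        interpret Q: prob_space Q by (rule Q(1))
        have mh: "k n \<in> borel_measurable Q" for n
          using measurable_borel_of[OF kc[of n]] by (simp add: borel_of_euclidean measurable_cong_sets[OF Q(2) refl])
        have mX: "X \<in> sets Q" using XS Q(2) by simp
        have "(\<lambda>n. LINT x|Q. k n x) \<longlonglongrightarrow> (LINT x|Q. indicator X x)"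
        proof (rule integral_dominated_convergence[where w = "\<lambda>_. 1"])
          show "AE x in Q. norm (k n x) \<le> 1" for n
            by (intro AE_I2) (auto simp: k_def split: option.split)
        qed (use kl mh mX in auto)
        then show ?thesis using mX by simp
      qed
      show ?thesis using LIMSEQ_unique[OF conv'[OF M]] conv'[OF N] eq[OF kc] by simp
    qed
    then show ?thesis by (simp add: M.emeasure_eq_measure N.emeasure_eq_measure)
  qed
next
  interpret M: prob_space M by (rule M(1))
  show "emeasure M UNIV \<noteq> \<infinity>" using M.emeasure_space_1 sets_eq_imp_space_eq[OF M(2)] by simp
qed auto

lemma is_equilibrium_measure_unique:
  assumes "is_equilibrium_measure riemann_sphere d f M" "is_equilibrium_measure riemann_sphere d f N"
  shows "M = N"
proof (rule sphere_measure_eqI)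
  fix \<phi> :: "complex option \<Rightarrow> real" assume "continuous_map sphere_top euclideanreal \<phi>"
  then show "(LINT x|M. \<phi> x) = (LINT x|N. \<phi> x)"
    using assms LIMSEQ_unique unfolding is_equilibrium_measure_def weak_limit_def riemann_sphere_simps(1) by blast
qed (use assms in \<open>auto simp: is_equilibrium_measure_def\<close>)

context small_parameter
begin

lemma equilibrium_measure_f: "equilibrium_measure riemann_sphere 2 f = \<mu>"
  unfolding equilibrium_measure_def
  using is_equilibrium_measure_mu is_equilibrium_measure_unique by (intro the_equality) blast+

end

section \<open>Cutoff functions of small Dirichlet energy\<close>

text \<open>
  A continuously differentiable, piecewise quadratic step from 1 to 0 on the unit interval. One
  continuous derivative is enough, since only weak derivatives enter the energy.
\<close>
definition spline :: "real \<Rightarrow> real" where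
  "spline s = 1 - 2 * (max 0 s)\<^sup>2 + 4 * (max 0 (s - 1 / 2))\<^sup>2 - 2 * (max 0 (s - 1))\<^sup>2"

definition spline' :: "real \<Rightarrow> real" where
  "spline' s = - 4 * max 0 s + 8 * max 0 (s - 1 / 2) - 4 * max 0 (s - 1)"

lemma DERIV_max_sq: "((\<lambda>s. (max 0 s)\<^sup>2) has_real_derivative 2 * max 0 s) (at (s::real))"
proof (cases s "0::real" rule: linorder_cases)
  case less
  have "((\<lambda>_. 0) has_real_derivative 0) (at s)" by simp
  then have "((\<lambda>s. (max 0 s)\<^sup>2) has_real_derivative 0) (at s)"
    by (rule has_field_derivative_transform_within_open[of _ _ _ "{..<0}"]) (use less in auto)
  then show ?thesis using less by simp
next
  case greater
  have "((\<lambda>s. s\<^sup>2) has_real_derivative 2 * s) (at s)" by (auto intro!: derivative_eq_intros)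
  then have "((\<lambda>s. (max 0 s)\<^sup>2) has_real_derivative 2 * s) (at s)"
    by (rule has_field_derivative_transform_within_open[of _ _ _ "{0<..}"]) (use greater in auto)
  then show ?thesis using greater by simp
next
  case equal
  have "((\<lambda>h::real. (max 0 h)\<^sup>2 / h) \<longlongrightarrow> 0) (at 0)"
  proof (rule Lim_null_comparison)
    show "\<forall>\<^sub>F h in at 0. norm ((max 0 h)\<^sup>2 / h) \<le> \<bar>h :: real\<bar>"
      by (rule always_eventually) (auto simp: max_def power2_eq_square)
    show "((\<lambda>h::real. \<bar>h\<bar>) \<longlongrightarrow> 0) (at 0)" using tendsto_rabs_zero tendsto_ident_at by blast
  qed
  then show ?thesis using equal by (simp add: DERIV_def)
qed

lemma DERIV_spline: "(spline has_real_derivative spline' s) (at s)"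
proof -
  have d: "((\<lambda>s. (max 0 (s - c))\<^sup>2) has_real_derivative 2 * max 0 (s - c)) (at s)" for c s :: real
  proof -
    have "((\<lambda>s. s - c) has_real_derivative 1) (at s)" by (auto intro!: derivative_eq_intros)
    from DERIV_chain'[OF this DERIV_max_sq] show ?thesis by simp
  qed
  show ?thesis unfolding spline_def[abs_def] spline'_def
    by (rule derivative_eq_intros DERIV_max_sq d refl | simp)+
qed

lemma spline_cases:
  "s \<le> 0 \<Longrightarrow> spline s = 1" "1 \<le> s \<Longrightarrow> spline s = 0" "s \<le> 0 \<Longrightarrow> spline' s = 0" "1 \<le> s \<Longrightarrow> spline' s = 0"
  by (auto simp: spline_def spline'_def max_def power2_eq_square algebra_simps)

lemma spline_bounds: "0 \<le> spline s" "spline s \<le> 1"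
proof -
  consider "s \<le> 0" | "0 \<le> s" "s \<le> 1 / 2" | "1 / 2 \<le> s" "s \<le> 1" | "1 \<le> s" by linarith
  then have "0 \<le> spline s \<and> spline s \<le> 1"
  proof cases
    case 2
    then have "s\<^sup>2 \<le> (1 / 2)\<^sup>2" by (intro power_mono)
    moreover have "spline s = 1 - 2 * s\<^sup>2" using 2 by (simp add: spline_def max_def)
    ultimately show ?thesis by (simp add: power2_eq_square)
  next
    case 3
    then have "(1 - s)\<^sup>2 \<le> (1 / 2)\<^sup>2" by (intro power_mono) auto
    moreover have "spline s = 2 * (1 - s)\<^sup>2" using 3 by (simp add: spline_def max_def power2_eq_square algebra_simps)
    ultimately show ?thesis by (simp add: power2_eq_square)
  qed (auto simp: spline_cases)
  then show "0 \<le> spline s" "spline s \<le> 1" by auto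
qed

lemma spline'_bound: "\<bar>spline' s\<bar> \<le> 2"
  by (auto simp: spline'_def max_def abs_if)

definition bump1 :: "real \<Rightarrow> real" where "bump1 x = spline (2 * x - 1) + spline (- 2 * x - 1) - 1"
definition bump1' :: "real \<Rightarrow> real" where "bump1' x = 2 * spline' (2 * x - 1) - 2 * spline' (- 2 * x - 1)"

lemma DERIV_bump1: "(bump1 has_real_derivative bump1' x) (at x)"
proof -
  have "((\<lambda>x. spline (2 * x - 1)) has_real_derivative spline' (2 * x - 1) * 2) (at x)"
    by (rule DERIV_chain'[OF _ DERIV_spline, unfolded mult.commute[of _ "spline' _"]]) (auto intro!: derivative_eq_intros)
  moreover have "((\<lambda>x. spline (- 2 * x - 1)) has_real_derivative spline' (- 2 * x - 1) * (- 2)) (at x)"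
    by (rule DERIV_chain'[OF _ DERIV_spline, unfolded mult.commute[of _ "spline' _"]]) (auto intro!: derivative_eq_intros)
  ultimately show ?thesis unfolding bump1_def[abs_def] bump1'_def
    by (auto intro!: derivative_eq_intros)
qed

lemma bump1_inner: "\<bar>x\<bar> \<le> 1 / 2 \<Longrightarrow> bump1 x = 1" "\<bar>x\<bar> \<le> 1 / 2 \<Longrightarrow> bump1' x = 0"
  by (auto simp: bump1_def bump1'_def spline_cases abs_le_iff)

lemma bump1_outer: assumes "1 \<le> \<bar>x\<bar>" shows "bump1 x = 0" "bump1' x = 0"
proof -
  have "1 \<le> x \<or> x \<le> - 1" using assms by linarith
  then show "bump1 x = 0" "bump1' x = 0" by (auto simp: bump1_def bump1'_def spline_cases)
qed

lemma bump1_bounds: "\<bar>bump1 x\<bar> \<le> 1" "\<bar>bump1' x\<bar> \<le> 4"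
proof -
  have "x \<le> 0 \<or> 0 \<le> x" by linarith
  then have "(2 * x - 1 \<le> 0) \<or> (- 2 * x - 1 \<le> 0)" by linarith
  then have "(spline (2 * x - 1) = 1 \<and> spline' (2 * x - 1) = 0) \<or> (spline (- 2 * x - 1) = 1 \<and> spline' (- 2 * x - 1) = 0)"
    using spline_cases by blast
  then show "\<bar>bump1 x\<bar> \<le> 1" "\<bar>bump1' x\<bar> \<le> 4"
    using spline_bounds[of "2 * x - 1"] spline_bounds[of "- 2 * x - 1"] spline'_bound[of "2 * x - 1"] spline'_bound[of "- 2 * x - 1"]
    by (auto simp: bump1_def bump1'_def)
qed

lemma continuous_bump1: "continuous_on A bump1" "continuous_on A bump1'"
proof -
  show "continuous_on A bump1"
    using DERIV_bump1 by (meson DERIV_isCont continuous_at_imp_continuous_on)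
  show "continuous_on A bump1'" unfolding bump1'_def[abs_def] spline'_def by (intro continuous_intros)
qed

definition dyadic :: "nat \<Rightarrow> real" where "dyadic j = 2 ^ (j + 5)"

lemma dyadic_bounds: "32 \<le> dyadic j" "0 < dyadic j"
proof -
  have "(2::real) ^ 5 \<le> 2 ^ (j + 5)" by (intro power_increasing) auto
  then show "32 \<le> dyadic j" by (simp add: dyadic_def)
  then show "0 < dyadic j" by linarith
qed

text \<open>
  The average of N bumps around 1 at dyadic scales. Their gradients live on disjoint square annuli and
  each has energy bounded independently of the scale, so the energy of the average is of order 1/N.
\<close>
definition cutoff :: "nat \<Rightarrow> complex \<Rightarrow> real" where
  "cutoff N z = (\<Sum>j<N. bump1 (dyadic j * (Re z - 1)) * bump1 (dyadic j * Im z)) / real N"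

definition cutoff_x :: "nat \<Rightarrow> complex \<Rightarrow> real" where
  "cutoff_x N z = (\<Sum>j<N. dyadic j * bump1' (dyadic j * (Re z - 1)) * bump1 (dyadic j * Im z)) / real N"

definition cutoff_y :: "nat \<Rightarrow> complex \<Rightarrow> real" where
  "cutoff_y N z = (\<Sum>j<N. dyadic j * bump1 (dyadic j * (Re z - 1)) * bump1' (dyadic j * Im z)) / real N"

lemma grad_deriv_cutoff: "grad_deriv (cutoff N) z (cutoff_x N z) (cutoff_y N z)"
proof -
  have b: "((\<lambda>z. bump1 (l z)) has_derivative (\<lambda>h. bump1' (l z) * l' h)) (at z)" if "(l has_derivative l') (at z)" for l :: "complex \<Rightarrow> real" and l'
    using has_derivative_compose[OF that, of bump1 "\<lambda>h. bump1' (l z) * h"] DERIV_bump1[of "l z"]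
    by (simp add: has_field_derivative_def)
  have r: "((\<lambda>z. dyadic j * (Re z - 1)) has_derivative (\<lambda>h. dyadic j * Re h)) (at z)"
    "((\<lambda>z. dyadic j * Im z) has_derivative (\<lambda>h. dyadic j * Im h)) (at z)" for j
    by (auto intro!: derivative_eq_intros)
  have "((\<lambda>z. \<Sum>j<N. bump1 (dyadic j * (Re z - 1)) * bump1 (dyadic j * Im z)) has_derivative
      (\<lambda>h. \<Sum>j<N. bump1 (dyadic j * (Re z - 1)) * (bump1' (dyadic j * Im z) * (dyadic j * Im h))
        + bump1' (dyadic j * (Re z - 1)) * (dyadic j * Re h) * bump1 (dyadic j * Im z))) (at z)"
    by (intro has_derivative_sum has_derivative_mult b r)
  then have "((\<lambda>z. (\<Sum>j<N. bump1 (dyadic j * (Re z - 1)) * bump1 (dyadic j * Im z)) / real N) has_derivative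
      (\<lambda>h. (\<Sum>j<N. bump1 (dyadic j * (Re z - 1)) * (bump1' (dyadic j * Im z) * (dyadic j * Im h))
        + bump1' (dyadic j * (Re z - 1)) * (dyadic j * Re h) * bump1 (dyadic j * Im z)) / real N)) (at z)"
    unfolding divide_inverse by (rule has_derivative_mult_left)
  then show ?thesis unfolding grad_deriv_def cutoff_def[abs_def]
    by (rule has_derivative_eq_rhs)
       (simp add: fun_eq_iff cutoff_x_def cutoff_y_def sum.distrib sum_distrib_left add_divide_distrib algebra_simps)
qed

lemma continuous_cutoff: "continuous_on A (cutoff N)" "continuous_on A (cutoff_x N)" "continuous_on A (cutoff_y N)"
proof -
  have c: "continuous_on A (\<lambda>z. bump1 (l z))" "continuous_on A (\<lambda>z. bump1' (l z))"
    if "continuous_on A l" for l :: "complex \<Rightarrow> real"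
    by (rule continuous_on_compose2[OF continuous_bump1(1)[of UNIV] that], simp,
        rule continuous_on_compose2[OF continuous_bump1(2)[of UNIV] that], simp)
  show "continuous_on A (cutoff N)" "continuous_on A (cutoff_x N)" "continuous_on A (cutoff_y N)"
    unfolding cutoff_def[abs_def] cutoff_x_def[abs_def] cutoff_y_def[abs_def] divide_inverse
    by (rule continuous_on_mult_right, intro continuous_intros c)+
qed

lemma cutoff_far:
  assumes "1 / 16 \<le> cmod (z - 1)" shows "cutoff N z = 0" "cutoff_x N z = 0" "cutoff_y N z = 0"
proof -
  have "cmod (z - 1) \<le> \<bar>Re z - 1\<bar> + \<bar>Im z\<bar>" using cmod_le[of "z - 1"] by simp
  then have "1 / 32 \<le> \<bar>Re z - 1\<bar> \<or> 1 / 32 \<le> \<bar>Im z\<bar>" using assms by linarith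
  then have "1 \<le> \<bar>dyadic j * (Re z - 1)\<bar> \<or> 1 \<le> \<bar>dyadic j * Im z\<bar>" for j
  proof
    assume "1 / 32 \<le> \<bar>Re z - 1\<bar>"
    then have "32 * (1 / 32) \<le> dyadic j * \<bar>Re z - 1\<bar>" using dyadic_bounds[of j] by (intro mult_mono) auto
    then show ?thesis using dyadic_bounds(2)[of j] by (simp add: abs_mult)
  next
    assume "1 / 32 \<le> \<bar>Im z\<bar>"
    then have "32 * (1 / 32) \<le> dyadic j * \<bar>Im z\<bar>" using dyadic_bounds[of j] by (intro mult_mono) auto
    then show ?thesis using dyadic_bounds(2)[of j] by (simp add: abs_mult)
  qed
  then have "bump1 (dyadic j * (Re z - 1)) = 0 \<and> bump1' (dyadic j * (Re z - 1)) = 0 \<or> bump1 (dyadic j * Im z) = 0 \<and> bump1' (dyadic j * Im z) = 0" for j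
    using bump1_outer by blast
  then have "bump1 (dyadic j * (Re z - 1)) * bump1 (dyadic j * Im z) = 0"
    "dyadic j * bump1' (dyadic j * (Re z - 1)) * bump1 (dyadic j * Im z) = 0"
    "dyadic j * bump1 (dyadic j * (Re z - 1)) * bump1' (dyadic j * Im z) = 0" for j
    by (metis mult_zero_left mult_zero_right)+
  then show "cutoff N z = 0" "cutoff_x N z = 0" "cutoff_y N z = 0"
    by (simp_all only: cutoff_def cutoff_x_def cutoff_y_def sum.neutral_const div_0)
qed

lemma cutoff_near:
  assumes "0 < N" "cmod (z - 1) \<le> 1 / 2 ^ (N + 5)" shows "cutoff N z = 1"
proof -
  have "bump1 (dyadic j * (Re z - 1)) = 1 \<and> bump1 (dyadic j * Im z) = 1" if "j < N" for j
  proof -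
    have "(2::real) ^ (j + 5) * 2 = 2 ^ (j + 6)" by (simp add: power_add)
    also have "(2::real) ^ (j + 6) \<le> 2 ^ (N + 5)" using that by (intro power_increasing) auto
    finally have "dyadic j * (1 / 2 ^ (N + 5)) \<le> 1 / 2" by (simp add: dyadic_def field_simps)
    moreover have "dyadic j * x \<le> dyadic j * (1 / 2 ^ (N + 5))" if "x \<le> cmod (z - 1)" for x
      using assms(2) that dyadic_bounds(2)[of j] by (intro mult_left_mono) auto
    ultimately have "dyadic j * x \<le> 1 / 2" if "x \<le> cmod (z - 1)" for x using that order_trans by blast
    moreover have "\<bar>Re z - 1\<bar> \<le> cmod (z - 1)" "\<bar>Im z\<bar> \<le> cmod (z - 1)"
      using abs_Re_le_cmod[of "z - 1"] abs_Im_le_cmod[of "z - 1"] by simp_all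
    ultimately have "\<bar>dyadic j * (Re z - 1)\<bar> \<le> 1 / 2" "\<bar>dyadic j * Im z\<bar> \<le> 1 / 2"
      using dyadic_bounds(2)[of j] by (simp_all add: abs_mult)
    then show ?thesis by (simp add: bump1_inner)
  qed
  then have "(\<Sum>j<N. bump1 (dyadic j * (Re z - 1)) * bump1 (dyadic j * Im z)) = real N" by simp
  then show ?thesis using assms(1) by (simp add: cutoff_def)
qed

text \<open>Different scales do not interact: the derivative of one bump vanishes where a finer one lives.\<close>
lemma bump1'_disjoint: "i \<noteq> j \<Longrightarrow> bump1' (dyadic i * x) * bump1' (dyadic j * x) = 0"
proof (induction i j rule: linorder_wlog)
  case (le i j)
  then have "dyadic i * 2 \<le> dyadic j"
  proof -
    have "(2::real) ^ (i + 6) \<le> 2 ^ (j + 5)" using le by (intro power_increasing) auto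
    then show ?thesis by (simp add: dyadic_def power_add)
  qed
  then have "dyadic i * 2 * \<bar>x\<bar> \<le> dyadic j * \<bar>x\<bar>" by (intro mult_right_mono) auto
  then have "\<bar>dyadic i * x\<bar> \<le> 1 / 2 \<or> 1 \<le> \<bar>dyadic j * x\<bar>"
    using dyadic_bounds(2)[of i] dyadic_bounds(2)[of j] by (auto simp: abs_mult)
  then show ?case using bump1_inner(2) bump1_outer(2) by (metis mult_zero_left mult_zero_right)
next
  case (sym i j) then show ?case by (simp add: mult.commute)
qed

lemma sum_square_disjoint:
  fixes a :: "nat \<Rightarrow> real"
  assumes "\<And>i j. i \<noteq> j \<Longrightarrow> a i * a j = 0" shows "(\<Sum>j<N. a j)\<^sup>2 = (\<Sum>j<N. (a j)\<^sup>2)"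
proof -
  have "(\<Sum>j<N. a j)\<^sup>2 = (\<Sum>i<N. \<Sum>j<N. a i * a j)" by (simp add: power2_eq_square sum_product)
  also have "\<dots> = (\<Sum>i<N. \<Sum>j<N. if j = i then a i * a i else 0)"
    using assms by (intro sum.cong refl) auto
  finally show ?thesis by (simp add: power2_eq_square)
qed

definition dyadic_box :: "nat \<Rightarrow> complex set" where
  "dyadic_box j = cbox (Complex (1 - 1 / dyadic j) (- 1 / dyadic j)) (Complex (1 + 1 / dyadic j) (1 / dyadic j))"

lemma measure_dyadic_box: "measure lborel (dyadic_box j) = 4 / (dyadic j)\<^sup>2"
  using dyadic_bounds(2)[of j]
  by (simp add: dyadic_box_def measure_lborel_cbox_eq Basis_complex_def inner_complex_def power2_eq_square)

lemma bump_product_bound: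
  assumes "\<bar>a\<bar> \<le> 4 \<and> \<bar>b\<bar> \<le> 1 \<or> \<bar>a\<bar> \<le> 1 \<and> \<bar>b\<bar> \<le> 4"
    "1 \<le> \<bar>dyadic j * (Re z - 1)\<bar> \<Longrightarrow> a = 0" "1 \<le> \<bar>dyadic j * Im z\<bar> \<Longrightarrow> b = 0"
  shows "(dyadic j * a * b)\<^sup>2 \<le> 16 * (dyadic j)\<^sup>2 * indicator (dyadic_box j) z"
proof (cases "z \<in> dyadic_box j")
  case True
  have "\<bar>a * b\<bar> \<le> 4"
  proof -
    have "\<bar>a\<bar> * \<bar>b\<bar> \<le> 4 * 1 \<or> \<bar>a\<bar> * \<bar>b\<bar> \<le> 1 * 4" using assms(1) by (meson mult_mono abs_ge_zero zero_le_numeral zero_le_one)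
    then show ?thesis by (simp add: abs_mult)
  qed
  then have "(a * b)\<^sup>2 \<le> 4\<^sup>2" by (metis abs_le_square_iff abs_numeral)
  then have "(dyadic j)\<^sup>2 * (a * b)\<^sup>2 \<le> (dyadic j)\<^sup>2 * 4\<^sup>2" by (intro mult_left_mono) auto
  then show ?thesis using True by (simp add: power_mult_distrib mult_ac)
next
  case False
  then have "1 / dyadic j < \<bar>Re z - 1\<bar> \<or> 1 / dyadic j < \<bar>Im z\<bar>"
    by (auto simp: dyadic_box_def in_cbox_complex_iff)
  then have "1 < dyadic j * \<bar>Re z - 1\<bar> \<or> 1 < dyadic j * \<bar>Im z\<bar>"
    using dyadic_bounds(2)[of j] by (simp add: pos_divide_less_eq mult.commute)
  then have "1 \<le> \<bar>dyadic j * (Re z - 1)\<bar> \<or> 1 \<le> \<bar>dyadic j * Im z\<bar>"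
    unfolding abs_mult using dyadic_bounds(2)[of j] by (auto simp: less_imp_le)
  then have "a = 0 \<or> b = 0" using assms(2,3) by blast
  then show ?thesis using False by auto
qed

lemma cutoff_gradient_bound:
  "(cutoff_x N z)\<^sup>2 + (cutoff_y N z)\<^sup>2 \<le> (\<Sum>j<N. 32 * (dyadic j)\<^sup>2 * indicator (dyadic_box j) z) / (real N)\<^sup>2"
proof -
  let ?a = "\<lambda>j. dyadic j * bump1' (dyadic j * (Re z - 1)) * bump1 (dyadic j * Im z)"
  let ?b = "\<lambda>j. dyadic j * bump1 (dyadic j * (Re z - 1)) * bump1' (dyadic j * Im z)"
  have "?a i * ?a j = 0" if "i \<noteq> j" for i j
    using bump1'_disjoint[OF that, of "Re z - 1"] by auto
  then have "(\<Sum>j<N. ?a j)\<^sup>2 = (\<Sum>j<N. (?a j)\<^sup>2)" by (rule sum_square_disjoint)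
  also have "\<dots> \<le> (\<Sum>j<N. 16 * (dyadic j)\<^sup>2 * indicator (dyadic_box j) z)"
    by (intro sum_mono bump_product_bound) (use bump1_bounds bump1_outer in auto)
  finally have a: "(\<Sum>j<N. ?a j)\<^sup>2 \<le> (\<Sum>j<N. 16 * (dyadic j)\<^sup>2 * indicator (dyadic_box j) z)" .
  have "?b i * ?b j = 0" if "i \<noteq> j" for i j
    using bump1'_disjoint[OF that, of "Im z"] by auto
  then have "(\<Sum>j<N. ?b j)\<^sup>2 = (\<Sum>j<N. (?b j)\<^sup>2)" by (rule sum_square_disjoint)
  also have "\<dots> \<le> (\<Sum>j<N. 16 * (dyadic j)\<^sup>2 * indicator (dyadic_box j) z)"
    by (intro sum_mono bump_product_bound) (use bump1_bounds bump1_outer in auto)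
  finally have b: "(\<Sum>j<N. ?b j)\<^sup>2 \<le> (\<Sum>j<N. 16 * (dyadic j)\<^sup>2 * indicator (dyadic_box j) z)" .
  have "(cutoff_x N z)\<^sup>2 + (cutoff_y N z)\<^sup>2 = ((\<Sum>j<N. ?a j)\<^sup>2 + (\<Sum>j<N. ?b j)\<^sup>2) / (real N)\<^sup>2"
    by (simp add: cutoff_x_def cutoff_y_def power_divide add_divide_distrib)
  also have "\<dots> \<le> ((\<Sum>j<N. 16 * (dyadic j)\<^sup>2 * indicator (dyadic_box j) z) + (\<Sum>j<N. 16 * (dyadic j)\<^sup>2 * indicator (dyadic_box j) z)) / (real N)\<^sup>2"
    using a b by (intro divide_right_mono add_mono) auto
  also have "\<dots> = (\<Sum>j<N. 32 * (dyadic j)\<^sup>2 * indicator (dyadic_box j) z) / (real N)\<^sup>2"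
    by (simp add: sum.distrib[symmetric])
  finally show ?thesis .
qed

definition dirichlet :: "nat \<Rightarrow> real" where
  "dirichlet N = (LINT z|lborel. (cutoff_x N z)\<^sup>2 + (cutoff_y N z)\<^sup>2)"

lemma dyadic_box_finite: "dyadic_box j \<in> sets lborel" "emeasure lborel (dyadic_box j) < \<infinity>"
proof -
  show "dyadic_box j \<in> sets lborel"
    unfolding dyadic_box_def sets_lborel by (rule borel_closed) (rule closed_cbox)
  show "emeasure lborel (dyadic_box j) < \<infinity>"
    unfolding dyadic_box_def by (rule emeasure_lborel_cbox_finite)
qed

lemma integrable_dyadic_bound: "integrable lborel (\<lambda>z. (\<Sum>j<N. 32 * (dyadic j)\<^sup>2 * indicator (dyadic_box j) z) / (real N)\<^sup>2)"
  by (intro integrable_divide Bochner_Integration.integrable_sum integrable_mult_right integrable_real_indicator dyadic_box_finite)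

lemma integrable_dirichlet: "integrable lborel (\<lambda>z. (cutoff_x N z)\<^sup>2 + (cutoff_y N z)\<^sup>2)"
proof (rule Bochner_Integration.integrable_bound[OF integrable_dyadic_bound[of N]])
  show "(\<lambda>z. (cutoff_x N z)\<^sup>2 + (cutoff_y N z)\<^sup>2) \<in> borel_measurable lborel"
    using borel_measurable_continuous_onI[OF continuous_cutoff(2)[of UNIV N]] borel_measurable_continuous_onI[OF continuous_cutoff(3)[of UNIV N]] by simp
  show "AE z in lborel. norm ((cutoff_x N z)\<^sup>2 + (cutoff_y N z)\<^sup>2) \<le> norm ((\<Sum>j<N. 32 * (dyadic j)\<^sup>2 * indicat_real (dyadic_box j) z) / (real N)\<^sup>2)"
  proof (rule AE_I2)
    fix z
    have "0 \<le> (cutoff_x N z)\<^sup>2 + (cutoff_y N z)\<^sup>2" by simp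
    then show "norm ((cutoff_x N z)\<^sup>2 + (cutoff_y N z)\<^sup>2) \<le> norm ((\<Sum>j<N. 32 * (dyadic j)\<^sup>2 * indicat_real (dyadic_box j) z) / (real N)\<^sup>2)"
      using cutoff_gradient_bound[of N z] by (simp only: real_norm_def abs_of_nonneg)
  qed
qed

lemma dirichlet_le: "0 < N \<Longrightarrow> dirichlet N \<le> 128 / real N"
proof -
  assume N: "0 < N"
  have "dirichlet N \<le> (LINT z|lborel. (\<Sum>j<N. 32 * (dyadic j)\<^sup>2 * indicator (dyadic_box j) z) / (real N)\<^sup>2)"
    unfolding dirichlet_def using cutoff_gradient_bound
    by (intro integral_mono integrable_dirichlet integrable_dyadic_bound)
  also have "\<dots> = (LINT z|lborel. (\<Sum>j<N. 32 * (dyadic j)\<^sup>2 * indicator (dyadic_box j) z)) / (real N)\<^sup>2"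
    by (rule integral_divide_zero)
  also have "(LINT z|lborel. (\<Sum>j<N. 32 * (dyadic j)\<^sup>2 * indicator (dyadic_box j) z)) = (\<Sum>j<N. 32 * (dyadic j)\<^sup>2 * measure lborel (dyadic_box j))"
  proof (subst Bochner_Integration.integral_sum)
    show "integrable lborel (\<lambda>z. 32 * (dyadic j)\<^sup>2 * indicat_real (dyadic_box j) z)" for j
      by (intro integrable_mult_right integrable_real_indicator dyadic_box_finite)
  qed (simp add: dyadic_box_def)
  also have "\<dots> = (\<Sum>j<N. 128)"
    using dyadic_bounds(2) by (intro sum.cong refl) (simp add: measure_dyadic_box less_imp_neq[symmetric])
  also have "(\<Sum>j<N. 128) / (real N)\<^sup>2 = 128 / real N" using N by (simp add: power2_eq_square)
  finally show ?thesis .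
qed

lemma continuous_AE_zero:
  fixes g :: "complex \<Rightarrow> real"
  assumes "continuous_on UNIV g" "AE z in lborel. g z = 0" shows "g z = 0"
proof (rule ccontr)
  assume "g z \<noteq> 0"
  let ?S = "- (g -` {0})"
  have "open ?S" using assms(1) by (intro open_Compl continuous_closed_vimage) (auto simp: continuous_on_eq_continuous_at)
  then have "\<not> negligible ?S" using \<open>g z \<noteq> 0\<close> by (intro open_not_negligible) auto
  moreover have "?S \<in> null_sets lborel"
  proof -
    have "?S \<in> sets lborel" using \<open>open ?S\<close> by simp
    moreover have "AE z in lborel. z \<notin> ?S" using assms(2) by simp
    ultimately show ?thesis using AE_iff_null_sets by blast
  qed
  ultimately show False by (auto simp: negligible_iff_null_sets dest: null_sets_completionI)
qed

lemma dirichlet_pos: "0 < N \<Longrightarrow> 0 < dirichlet N"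
proof -
  assume N: "0 < N"
  let ?g = "\<lambda>z. (cutoff_x N z)\<^sup>2 + (cutoff_y N z)\<^sup>2"
  have nn: "0 \<le> ?g z" for z by simp
  have "dirichlet N \<noteq> 0"
  proof
    assume "dirichlet N = 0"
    then have "AE z in lborel. ?g z = 0"
      unfolding dirichlet_def using integral_nonneg_eq_0_iff_AE[OF integrable_dirichlet[of N]] nn by simp
    then have g0: "?g z = 0" for z
      by (rule continuous_AE_zero[rotated]) (intro continuous_intros continuous_cutoff)
    \<comment> \<open>A point where the coarsest bump has nonzero slope and all finer bumps vanish.\<close>
    let ?z = "Complex (1 + 3 / (4 * dyadic 0)) 0"
    have b: "bump1' (3 / 4) = - 4" by (simp add: bump1'_def spline'_def max_def)
    have "dyadic j * bump1' (dyadic j * (Re ?z - 1)) * bump1 (dyadic j * Im ?z) = (if j = 0 then - 4 * dyadic 0 else 0)" for j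
    proof (cases "j = 0")
      case True
      have "dyadic 0 * (Re ?z - 1) = 3 / 4" using dyadic_bounds(2)[of 0] by simp
      then show ?thesis using True b bump1_inner(1)[of 0] by simp
    next
      case False
      have "dyadic 0 * 2 \<le> dyadic j"
      proof -
        have "(2::real) ^ 6 \<le> 2 ^ (j + 5)" using False by (intro power_increasing) auto
        then show ?thesis by (simp add: dyadic_def)
      qed
      then have "1 \<le> dyadic j * (Re ?z - 1)" using dyadic_bounds(2)[of 0] by (simp add: field_simps)
      then have "bump1' (dyadic j * (Re ?z - 1)) = 0" by (intro bump1_outer(2)) linarith
      then show ?thesis using False by simp
    qed
    then have "cutoff_x N ?z = - 4 * dyadic 0 / real N" using N by (simp add: cutoff_x_def)
    then have "cutoff_x N ?z \<noteq> 0" using N dyadic_bounds(2)[of 0] by simp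
    then show False using g0[of ?z] by (simp add: sum_power2_eq_zero_iff)
  qed
  moreover have "0 \<le> dirichlet N" unfolding dirichlet_def using nn by (intro Bochner_Integration.integral_nonneg) auto
  ultimately show ?thesis by simp
qed

section \<open>The cutoff on the sphere\<close>

definition sphere_cutoff :: "nat \<Rightarrow> complex option \<Rightarrow> complex" where
  "sphere_cutoff N x = of_real (case_option 0 (cutoff N) x)"

lemma cutoff_0: "cutoff N 0 = 0" by (rule cutoff_far) simp

lemma sphere_cutoff_param: "sphere_cutoff N (sphere_param i z) = of_real (cutoff N (if i = 0 then z else 1 / z))"
  by (auto simp: sphere_cutoff_def sphere_param_def cutoff_0)

lemma continuous_map_sphere_cutoff: "continuous_map sphere_top euclidean (sphere_cutoff N)"
proof -
  have "continuous_map sphere_top euclidean (case_option 0 (\<lambda>z. complex_of_real (cutoff N z)))"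
  proof (rule continuous_map_compact_support)
    show "continuous_on UNIV (\<lambda>z. complex_of_real (cutoff N z))"
      by (intro continuous_intros continuous_cutoff)
    fix z assume "cmod z > 2"
    then have "1 / 16 \<le> cmod (z - 1)" using norm_triangle_ineq2[of z 1] by simp
    then show "complex_of_real (cutoff N z) = 0" by (simp add: cutoff_far)
  qed
  moreover have "case_option 0 (\<lambda>z. complex_of_real (cutoff N z)) = sphere_cutoff N"
    by (auto simp: sphere_cutoff_def fun_eq_iff split: option.split)
  ultimately show ?thesis by simp
qed

text \<open>
  The partial derivatives of the cutoff in the chart 1/z, by the chain rule. At w = 0 the convention
  1/0 = 0 gives the right value 0, because the cutoff vanishes near 0 and near infinity.
\<close>
definition inv_cutoff_x :: "nat \<Rightarrow> complex \<Rightarrow> real" where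
  "inv_cutoff_x N w = Re (- 1 / w\<^sup>2) * cutoff_x N (1 / w) + Im (- 1 / w\<^sup>2) * cutoff_y N (1 / w)"

definition inv_cutoff_y :: "nat \<Rightarrow> complex \<Rightarrow> real" where
  "inv_cutoff_y N w = - Im (- 1 / w\<^sup>2) * cutoff_x N (1 / w) + Re (- 1 / w\<^sup>2) * cutoff_y N (1 / w)"

lemma inv_cutoff_near_0:
  assumes "cmod w < 1 / 2"
  shows "cutoff N (1 / w) = 0" "cutoff_x N (1 / w) = 0" "cutoff_y N (1 / w) = 0"
proof -
  have "1 / 16 \<le> cmod (1 / w - 1)"
  proof (cases "w = 0")
    case False
    then have "2 < cmod (1 / w)" using assms by (simp add: norm_divide field_simps)
    then show ?thesis using norm_triangle_ineq2[of "1 / w" 1] by simp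
  qed simp
  then show "cutoff N (1 / w) = 0" "cutoff_x N (1 / w) = 0" "cutoff_y N (1 / w) = 0" by (simp_all add: cutoff_far)
qed

lemma grad_deriv_inv_cutoff: "grad_deriv (\<lambda>w. cutoff N (1 / w)) w (inv_cutoff_x N w) (inv_cutoff_y N w)"
proof (cases "w = 0")
  case False
  have "((\<lambda>w. 1 / w) has_field_derivative - 1 / w\<^sup>2) (at w)"
    using False by (auto intro!: derivative_eq_intros simp: power2_eq_square)
  then have i: "((\<lambda>w. 1 / w) has_derivative (\<lambda>h. - 1 / w\<^sup>2 * h)) (at w)"
    unfolding has_field_derivative_def .
  have c: "(cutoff N has_derivative (\<lambda>h. Re h *\<^sub>R cutoff_x N (1 / w) + Im h *\<^sub>R cutoff_y N (1 / w))) (at (1 / w))"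
    using grad_deriv_cutoff[of N "1 / w"] by (simp add: grad_deriv_def)
  show ?thesis unfolding grad_deriv_def
    by (rule has_derivative_eq_rhs[OF has_derivative_compose[OF i c]])
       (simp only: fun_eq_iff inv_cutoff_x_def inv_cutoff_y_def times_complex.sel real_scaleR_def, simp only: algebra_simps, simp)
next
  case True
  have "((\<lambda>_. 0) has_derivative (\<lambda>_. 0)) (at w)" by simp
  then have "((\<lambda>w. cutoff N (1 / w)) has_derivative (\<lambda>_. 0)) (at w)"
    by (rule has_derivative_transform_within_open[of _ _ _ _ "ball 0 (1 / 2)"]) (use True inv_cutoff_near_0(1) in auto)
  then show ?thesis using True inv_cutoff_near_0[of 0 N]
    by (simp add: grad_deriv_def inv_cutoff_x_def inv_cutoff_y_def)
qed

lemma continuous_inv_cutoff: "continuous_on UNIV (inv_cutoff_x N)" "continuous_on UNIV (inv_cutoff_y N)"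
proof -
  have u: "UNIV = - {0} \<union> ball (0::complex) (1 / 2)" by auto
  have c: "continuous_on (- {0}) (\<lambda>w. - 1 / w\<^sup>2 :: complex)" "continuous_on (- {0}) (\<lambda>w. cutoff_x N (1 / w))"
    "continuous_on (- {0}) (\<lambda>w. cutoff_y N (1 / w))"
    by (auto intro!: continuous_intros continuous_on_compose2[OF continuous_cutoff(2)[of UNIV N]]
        continuous_on_compose2[OF continuous_cutoff(3)[of UNIV N]])
  show "continuous_on UNIV (inv_cutoff_x N)"
    unfolding u
  proof (rule continuous_on_open_Un)
    show "continuous_on (- {0}) (inv_cutoff_x N)"
      unfolding inv_cutoff_x_def[abs_def]
      by (intro continuous_on_add continuous_on_mult continuous_on_minus continuous_on_Re continuous_on_Im c)
    show "continuous_on (ball 0 (1 / 2)) (inv_cutoff_x N)"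
      by (rule continuous_on_eq[OF continuous_on_const[of _ 0]]) (simp add: inv_cutoff_x_def inv_cutoff_near_0)
  qed auto
  show "continuous_on UNIV (inv_cutoff_y N)"
    unfolding u
  proof (rule continuous_on_open_Un)
    show "continuous_on (- {0}) (inv_cutoff_y N)"
      unfolding inv_cutoff_y_def[abs_def]
      by (intro continuous_on_add continuous_on_mult continuous_on_minus continuous_on_Re continuous_on_Im c)
    show "continuous_on (ball 0 (1 / 2)) (inv_cutoff_y N)"
      by (rule continuous_on_eq[OF continuous_on_const[of _ 0]]) (simp add: inv_cutoff_y_def inv_cutoff_near_0)
  qed auto
qed

lemma grad_deriv_of_real: "grad_deriv u z a b \<Longrightarrow> grad_deriv (\<lambda>z. complex_of_real (u z)) z (of_real a) (of_real b)"
  unfolding grad_deriv_def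
  by (drule has_derivative_of_real[where 'a = complex]) (simp add: scaleR_conv_of_real)

definition cutoff_differential :: "nat \<Rightarrow> nat \<Rightarrow> complex option \<Rightarrow> complex Matrix.vec" where
  "cutoff_differential N i x = Matrix.vec 2 (\<lambda>a. of_real (if i = 0
     then (if a = 0 then cutoff_x N (sphere_coord i x) else cutoff_y N (sphere_coord i x))
     else (if a = 0 then inv_cutoff_x N (sphere_coord i x) else inv_cutoff_y N (sphere_coord i x))))"

lemma weak_differential_sphere_cutoff:
  "weak_differential riemann_sphere (sphere_cutoff N) (cutoff_differential N)"
  unfolding weak_differential_def
proof (intro conjI allI impI)
  fix i :: nat and x show "cutoff_differential N i x \<in> carrier_vec (mdim riemann_sphere)"
    by (simp add: cutoff_differential_def)
next
  fix i a assume "i < nch riemann_sphere" "a < mdim riemann_sphere"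
  then have a: "a < 2" by simp
  show "weak_partial (mdim riemann_sphere) (coord riemann_sphere i ` dom riemann_sphere i) a
        (\<lambda>y. sphere_cutoff N (param riemann_sphere i y)) (\<lambda>y. vec_index (cutoff_differential N i (param riemann_sphere i y)) a)"
    unfolding coord_image_dom_UNIV riemann_sphere_simps(2)
  proof (cases "i = 0")
    case True
    show "weak_partial 2 (range complex_coords) a (\<lambda>y. sphere_cutoff N (param riemann_sphere i y)) (\<lambda>y. vec_index (cutoff_differential N i (param riemann_sphere i y)) a)"
    proof (rule weak_partial_grad_deriv[OF open_UNIV _ _ _ a])
      show "grad_deriv (\<lambda>z. complex_of_real (cutoff N z)) z (of_real (cutoff_x N z)) (of_real (cutoff_y N z))" for z
        by (rule grad_deriv_of_real[OF grad_deriv_cutoff])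
      show "continuous_on UNIV (\<lambda>z. complex_of_real (cutoff_x N z))" "continuous_on UNIV (\<lambda>z. complex_of_real (cutoff_y N z))"
        by (intro continuous_intros continuous_cutoff)+
    qed (use True a in \<open>auto simp: sphere_cutoff_param cutoff_differential_def\<close>)
  next
    case False
    show "weak_partial 2 (range complex_coords) a (\<lambda>y. sphere_cutoff N (param riemann_sphere i y)) (\<lambda>y. vec_index (cutoff_differential N i (param riemann_sphere i y)) a)"
    proof (rule weak_partial_grad_deriv[OF open_UNIV _ _ _ a])
      show "grad_deriv (\<lambda>z. complex_of_real (cutoff N (1 / z))) z (of_real (inv_cutoff_x N z)) (of_real (inv_cutoff_y N z))" for z
        by (rule grad_deriv_of_real[OF grad_deriv_inv_cutoff])
      show "continuous_on UNIV (\<lambda>z. complex_of_real (inv_cutoff_x N z))" "continuous_on UNIV (\<lambda>z. complex_of_real (inv_cutoff_y N z))"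
        by (intro continuous_intros continuous_inv_cutoff)+
    qed (use False a in \<open>auto simp: sphere_cutoff_param cutoff_differential_def\<close>)
  qed
qed

lemma weak_differential_chart_0:
  assumes "weak_differential riemann_sphere \<phi> w" "a < 2"
  shows "weak_partial 2 (range complex_coords) a (\<lambda>y. \<phi> (param riemann_sphere 0 y)) (\<lambda>y. vec_index (w 0 (param riemann_sphere 0 y)) a)"
  using assms(1)[unfolded weak_differential_def coord_image_dom_UNIV riemann_sphere_simps(2,3), THEN conjunct2, rule_format, of 0 a] assms(2)
  by simp

text \<open>
  The differential is a choice among all weak differentials, of which only membership in that class
  is known.
\<close>
lemma differential_chosen:
  assumes "weak_differential riemann_sphere \<phi> w"
  obtains w' where "weak_differential riemann_sphere \<phi> w'" "\<And>z. differential riemann_sphere \<phi> (Some z) = w' 0 (Some z)"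
proof
  show "weak_differential riemann_sphere \<phi> (SOME w. weak_differential riemann_sphere \<phi> w)" using assms by (rule someI[where P = "weak_differential riemann_sphere \<phi>"])
  show "differential riemann_sphere \<phi> (Some z) = (SOME w. weak_differential riemann_sphere \<phi> w) 0 (Some z)" for z
    by (simp add: differential_def)
qed

lemma weak_differential_carrier:
  "weak_differential riemann_sphere \<phi> w \<Longrightarrow> w i x \<in> carrier_vec 2"
  unfolding weak_differential_def riemann_sphere_simps(2) by blast

text \<open>
  Unlike its values at points, the differential is determined almost everywhere.
\<close>
lemma AE_differential:
  assumes w: "weak_differential riemann_sphere \<phi> w"
  shows "AE z in lborel. differential riemann_sphere \<phi> (Some z) = w 0 (Some z)"
proof -
  obtain w' where w': "weak_differential riemann_sphere \<phi> w'" "\<And>z. differential riemann_sphere \<phi> (Some z) = w' 0 (Some z)"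
    using differential_chosen[OF w] by blast
  have e: "AE z in lborel. vec_index (w' 0 (Some z)) a = vec_index (w 0 (Some z)) a" if "a < 2" for a
    using weak_partial_unique[OF open_UNIV weak_differential_chart_0[OF w'(1) that] weak_differential_chart_0[OF w that]]
    by (simp add: sphere_param_simps)
  have e0: "AE z in lborel. vec_index (w' 0 (Some z)) 0 = vec_index (w 0 (Some z)) 0" by (rule e) simp
  have e1: "AE z in lborel. vec_index (w' 0 (Some z)) (Suc 0) = vec_index (w 0 (Some z)) (Suc 0)" by (rule e) simp
  from e0 e1 show ?thesis
  proof eventually_elim
    case (elim z)
    have "w' 0 (Some z) = w 0 (Some z)"
    proof (rule eq_vecI)
      have d: "dim_vec (w' 0 (Some z)) = 2" "dim_vec (w 0 (Some z)) = 2"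
        by (rule carrier_vecD[OF weak_differential_carrier[OF w'(1)]], rule carrier_vecD[OF weak_differential_carrier[OF w]])
      then show "dim_vec (w' 0 (Some z)) = dim_vec (w 0 (Some z))" by simp
      fix i assume "i < dim_vec (w 0 (Some z))"
      then show "vec_index (w' 0 (Some z)) i = vec_index (w 0 (Some z)) i"
        using elim d by (auto simp: less_2_cases_iff)
    qed
    then show ?case by (simp add: w'(2))
  qed
qed

lemma loc_integrable_measurable:
  fixes v :: "coords \<Rightarrow> 'b::{banach, second_countable_topology}"
  assumes "loc_integrable 2 (range complex_coords) v"
  shows "(\<lambda>z. v (complex_coords z)) \<in> borel_measurable borel"
proof (rule borel_measurable_LIMSEQ_metric)
  show "(\<lambda>z. indicator (cball 0 (real n)) z *\<^sub>R v (complex_coords z)) \<in> borel_measurable borel" for n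
  proof -
    have "set_integrable lborel (cball 0 (real n)) (\<lambda>z. v (complex_coords z))"
      using assms unfolding loc_integrable_complex_coords by simp
    then show ?thesis unfolding set_integrable_def using borel_measurable_integrable by fastforce
  qed
  fix z :: complex
  obtain n where "cmod z < real n" using reals_Archimedean2 by blast
  then have "\<forall>\<^sub>F k in sequentially. indicator (cball 0 (real k)) z *\<^sub>R v (complex_coords z) = v (complex_coords z)"
    by (intro eventually_sequentiallyI[of n]) (auto simp: indicator_def)
  then show "(\<lambda>k. indicat_real (cball 0 (real k)) z *\<^sub>R v (complex_coords z)) \<longlonglongrightarrow> v (complex_coords z)"
    by (rule tendsto_eventually)
qed

text \<open>
  The covector norm is a supremum over the unit ball: the Cauchy-Schwarz inequality bounds it, and the
  rescaled covector attains the bound. The conformal factor enters inversely.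
\<close>
lemma conorm_standard:
  assumes x: "\<xi> \<in> carrier_vec 2"
  shows "conorm riemann_sphere (standard_structure riemann_sphere) (Some z) \<xi>
     = sqrt (((vec_index \<xi> 0)\<^sup>2 + (vec_index \<xi> (Suc 0))\<^sup>2) / sphere_density z)"
proof -
  let ?\<rho> = "sphere_density z" and ?n = "(vec_index \<xi> 0)\<^sup>2 + (vec_index \<xi> (Suc 0))\<^sup>2"
  let ?S = "{scalar_prod \<xi> v | v. v \<in> carrier_vec 2 \<and> ginner riemann_sphere (Some z) (standard_structure riemann_sphere (Some z) *\<^sub>v v) v \<le> 1}"
  have n0: "0 \<le> ?n" by simp
  have up: "s \<le> sqrt (?n / ?\<rho>)" if s: "s \<in> ?S" for s
  proof -
    obtain v where v: "s = scalar_prod \<xi> v" "v \<in> carrier_vec 2"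
      "ginner riemann_sphere (Some z) (standard_structure riemann_sphere (Some z) *\<^sub>v v) v \<le> 1" using s by blast
    let ?m = "(vec_index v 0)\<^sup>2 + (vec_index v (Suc 0))\<^sup>2"
    have "?\<rho> * ?m \<le> 1" using v(2,3) by (simp add: ginner_standard ginner_sphere scalar_prod_2 power2_eq_square)
    then have m: "?m \<le> 1 / ?\<rho>" by (simp add: field_simps)
    have "s\<^sup>2 \<le> ?n * ?m"
    proof -
      have "?n * ?m - s\<^sup>2 = (vec_index \<xi> 0 * vec_index v (Suc 0) - vec_index \<xi> (Suc 0) * vec_index v 0)\<^sup>2"
        using v(1,2) by (simp add: scalar_prod_2 power2_eq_square algebra_simps)
      then show ?thesis by (metis diff_ge_0_iff_ge zero_le_power2)
    qed
    also have "\<dots> \<le> ?n * (1 / ?\<rho>)" using m n0 by (rule mult_left_mono)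
    finally show ?thesis by (simp add: real_le_rsqrt)
  qed
  have att: "sqrt (?n / ?\<rho>) \<in> ?S"
  proof (cases "?n = 0")
    case True
    have "0\<^sub>v 2 \<in> carrier_vec 2" by simp
    moreover have "scalar_prod \<xi> (0\<^sub>v 2) = 0" using x by simp
    moreover have "ginner riemann_sphere (Some z) (standard_structure riemann_sphere (Some z) *\<^sub>v 0\<^sub>v 2) (0\<^sub>v 2) \<le> 1"
      by (simp add: ginner_standard ginner_sphere)
    ultimately show ?thesis using True by (auto intro!: exI[of _ "0\<^sub>v 2"])
  next
    case False
    then have np: "0 < ?n" using n0 by linarith
    let ?c = "1 / sqrt (?n * ?\<rho>)"
    have sp: "scalar_prod \<xi> (k \<cdot>\<^sub>v \<xi>) = k * ?n" for k
      using x by (simp add: scalar_prod_2 power2_eq_square algebra_simps)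
    have gi: "ginner riemann_sphere (Some z) (standard_structure riemann_sphere (Some z) *\<^sub>v (k \<cdot>\<^sub>v \<xi>)) (k \<cdot>\<^sub>v \<xi>) = ?\<rho> * (k\<^sup>2 * ?n)" for k
      using x by (simp add: ginner_standard ginner_sphere scalar_prod_2 power2_eq_square algebra_simps)
    have np2: "0 < ?n * ?\<rho>" using np by simp
    have "?c \<cdot>\<^sub>v \<xi> \<in> carrier_vec 2" using x by simp
    moreover have "scalar_prod \<xi> (?c \<cdot>\<^sub>v \<xi>) = sqrt (?n / ?\<rho>)"
    proof -
      have "scalar_prod \<xi> (?c \<cdot>\<^sub>v \<xi>) = ?c * ?n" by (rule sp)
      also have "\<dots> = sqrt ((?c * ?n)\<^sup>2)" using np2 n0 by (simp add: less_imp_le)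
      also have "(?c * ?n)\<^sup>2 = ?n / ?\<rho>"
        using np2 np by (simp add: power_mult_distrib power_divide) (simp add: power2_eq_square)
      finally show ?thesis .
    qed
    moreover have "ginner riemann_sphere (Some z) (standard_structure riemann_sphere (Some z) *\<^sub>v (?c \<cdot>\<^sub>v \<xi>)) (?c \<cdot>\<^sub>v \<xi>) \<le> 1"
    proof -
      have "ginner riemann_sphere (Some z) (standard_structure riemann_sphere (Some z) *\<^sub>v (?c \<cdot>\<^sub>v \<xi>)) (?c \<cdot>\<^sub>v \<xi>) = ?\<rho> * (?c\<^sup>2 * ?n)" by (rule gi)
      also have "?c\<^sup>2 = 1 / (?n * ?\<rho>)" using np2 by (simp add: power_divide less_imp_le)
      finally show ?thesis using np by simp
    qed
    ultimately show ?thesis by (metis (mono_tags, lifting) mem_Collect_eq)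
  qed
  have "Sup ?S = sqrt (?n / ?\<rho>)" by (rule cSup_eq_maximum[OF att up])
  then show ?thesis unfolding conorm_def riemann_sphere_simps(2) .
qed

lemma conorm_complex_standard:
  assumes x: "\<xi> \<in> carrier_vec 2"
  shows "(conorm_complex riemann_sphere (standard_structure riemann_sphere) (Some z) \<xi>)\<^sup>2
     = ((cmod (vec_index \<xi> 0))\<^sup>2 + (cmod (vec_index \<xi> (Suc 0)))\<^sup>2) / sphere_density z"
proof -
  have c: "map_vec Re \<xi> \<in> carrier_vec 2" "map_vec Im \<xi> \<in> carrier_vec 2" using x by auto
  have d: "dim_vec \<xi> = 2" using x by (rule carrier_vecD)
  show ?thesis
    unfolding conorm_complex_def conorm_standard[OF c(1)] conorm_standard[OF c(2)]
    using d by (simp add: less_imp_le cmod_power2 add_divide_distrib)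
qed

definition grad_sq :: "(complex option \<Rightarrow> complex) \<Rightarrow> complex option \<Rightarrow> real" where
  "grad_sq \<phi> x = (conorm_complex riemann_sphere (standard_structure riemann_sphere) x (differential riemann_sphere \<phi> x))\<^sup>2"

lemma measurable_grad_sq:
  assumes w: "weak_differential riemann_sphere \<phi> w"
  shows "grad_sq \<phi> \<in> borel_measurable sphere_borel"
proof (rule measurable_on_sphere)
  obtain w' where w': "weak_differential riemann_sphere \<phi> w'" "\<And>z. differential riemann_sphere \<phi> (Some z) = w' 0 (Some z)"
    using differential_chosen[OF w] by blast
  have m: "(\<lambda>z. vec_index (w' 0 (Some z)) a) \<in> borel_measurable borel" if "a < 2" for a
  proof -
    have "loc_integrable 2 (range complex_coords) (\<lambda>y. vec_index (w' 0 (param riemann_sphere 0 y)) a)"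
      using weak_differential_chart_0[OF w'(1) that] unfolding weak_partial_def by blast
    from loc_integrable_measurable[OF this] show ?thesis by (simp add: sphere_param_simps)
  qed
  have "grad_sq \<phi> (Some z) = ((cmod (vec_index (w' 0 (Some z)) 0))\<^sup>2 + (cmod (vec_index (w' 0 (Some z)) (Suc 0)))\<^sup>2) / sphere_density z" for z
    unfolding grad_sq_def w'(2) by (rule conorm_complex_standard[OF weak_differential_carrier[OF w'(1)]])
  then show "(\<lambda>z. grad_sq \<phi> (Some z)) \<in> borel_measurable borel"
    using m[of 0] m[of "Suc 0"] by simp
qed simp

lemma AE_grad_sq_cutoff:
  "AE z in lborel. grad_sq (sphere_cutoff N) (Some z) = ((cutoff_x N z)\<^sup>2 + (cutoff_y N z)\<^sup>2) / sphere_density z"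
  using AE_differential[OF weak_differential_sphere_cutoff[of N]]
proof eventually_elim
  case (elim z)
  show ?case unfolding grad_sq_def elim
    by (subst conorm_complex_standard) (auto simp: cutoff_differential_def sphere_coord_def)
qed

text \<open>
  Conformal invariance of the Dirichlet integral in dimension 2: the conformal factor of the squared
  norm of the differential cancels against the density of the area.
\<close>
lemma integral_grad_sq_cutoff:
  "integrable (normalized_vol riemann_sphere) (grad_sq (sphere_cutoff N))"
  "(LINT x|normalized_vol riemann_sphere. grad_sq (sphere_cutoff N) x) = dirichlet N / sphere_area"
proof -
  let ?h = "\<lambda>z. grad_sq (sphere_cutoff N) (Some z)" and ?r = "\<lambda>z. sphere_density z / sphere_area"
  have mg: "grad_sq (sphere_cutoff N) \<in> borel_measurable sphere_borel"
    by (rule measurable_grad_sq[OF weak_differential_sphere_cutoff])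
  have mh: "?h \<in> borel_measurable borel" using measurable_compose[OF measurable_Some_sphere mg] .
  have r0: "0 \<le> ?r z" for z using sphere_area_pos by simp
  have mr: "?r \<in> borel_measurable borel" by simp
  have mS: "Some \<in> measurable (density lborel (\<lambda>z. ennreal (?r z))) sphere_borel" by simp
  have mc: "(\<lambda>z. (cutoff_x N z)\<^sup>2 + (cutoff_y N z)\<^sup>2) \<in> borel_measurable borel"
    using borel_measurable_continuous_onI[OF continuous_cutoff(2)[of UNIV N]] borel_measurable_continuous_onI[OF continuous_cutoff(3)[of UNIV N]] by simp
  have ae: "AE z in lborel. ((cutoff_x N z)\<^sup>2 + (cutoff_y N z)\<^sup>2) / sphere_area = ?r z *\<^sub>R ?h z"
    using AE_grad_sq_cutoff[of N]
  proof eventually_elim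
    case (elim z)
    show ?case unfolding elim using sphere_density_pos[of z] by simp
  qed
  have ae': "AE z in lborel. ?r z *\<^sub>R ?h z = ((cutoff_x N z)\<^sup>2 + (cutoff_y N z)\<^sup>2) / sphere_area"
    by (rule eventually_mono[OF ae]) (erule sym)
  have m1: "(\<lambda>z. ((cutoff_x N z)\<^sup>2 + (cutoff_y N z)\<^sup>2) / sphere_area) \<in> borel_measurable lborel" using mc by simp
  have m2: "(\<lambda>z. ?r z *\<^sub>R ?h z) \<in> borel_measurable lborel" using mh mr by simp
  have i0: "integrable lborel (\<lambda>z. ((cutoff_x N z)\<^sup>2 + (cutoff_y N z)\<^sup>2) / sphere_area)"
    using integrable_dirichlet by (rule integrable_divide)
  then have "integrable lborel (\<lambda>z. ?r z *\<^sub>R ?h z)"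
    using integrable_cong_AE[OF m1 m2 ae] by blast
  then have "integrable (density lborel (\<lambda>z. ennreal (?r z))) ?h"
    using r0 mh mr by (subst integrable_density) auto
  then show "integrable (normalized_vol riemann_sphere) (grad_sq (sphere_cutoff N))"
    unfolding normalized_vol_sphere using mg mS by (subst integrable_distr_eq) auto
  have "(LINT x|normalized_vol riemann_sphere. grad_sq (sphere_cutoff N) x) = (LINT z|density lborel (\<lambda>z. ennreal (?r z)). ?h z)"
    unfolding normalized_vol_sphere by (rule integral_distr[OF mS mg])
  also have "\<dots> = (LINT z|lborel. ?r z *\<^sub>R ?h z)"
    using r0 mh mr by (subst integral_density) auto
  also have "\<dots> = (LINT z|lborel. ((cutoff_x N z)\<^sup>2 + (cutoff_y N z)\<^sup>2) / sphere_area)"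
    by (rule integral_cong_AE[OF m2 m1 ae'])
  also have "\<dots> = dirichlet N / sphere_area" unfolding dirichlet_def by (rule integral_divide_zero)
  finally show "(LINT x|normalized_vol riemann_sphere. grad_sq (sphere_cutoff N) x) = dirichlet N / sphere_area" .
qed

lemma energy_sphere_cutoff:
  "energy riemann_sphere (standard_structure riemann_sphere) (sphere_cutoff N) = sqrt (dirichlet N / sphere_area)"
  unfolding energy_def riemann_sphere_simps(2) grad_sq_def[symmetric] integral_grad_sq_cutoff(2) by (simp add: sqrt_def)

lemma cutoff_bounded: "\<bar>cutoff N z\<bar> \<le> 1"
proof (cases "N = 0")
  case False
  have "\<bar>\<Sum>j<N. bump1 (dyadic j * (Re z - 1)) * bump1 (dyadic j * Im z)\<bar> \<le> (\<Sum>j<N. \<bar>bump1 (dyadic j * (Re z - 1)) * bump1 (dyadic j * Im z)\<bar>)"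
    by (rule sum_abs)
  also have "\<dots> \<le> (\<Sum>j<N. 1)"
    unfolding abs_mult by (intro sum_mono mult_le_one bump1_bounds) auto
  finally show ?thesis using False by (simp add: cutoff_def)
qed (simp add: cutoff_def)

lemma sphere_cutoff_bounded: "cmod (sphere_cutoff N x) \<le> 1"
  using cutoff_bounded by (auto simp: sphere_cutoff_def split: option.split)

lemma measurable_sphere_cutoff: "sphere_cutoff N \<in> borel_measurable sphere_borel"
  using measurable_borel_of[OF continuous_map_sphere_cutoff[of N]] by (simp add: borel_of_euclidean)

lemma sphere_cutoff_sobolev: "sphere_cutoff N \<in> continuous_sobolev riemann_sphere"
proof -
  interpret prob_space "normalized_vol riemann_sphere" by (rule prob_space_normalized_vol)
  have m: "(\<lambda>x. cmod (sphere_cutoff N x) ^ 2) \<in> borel_measurable (normalized_vol riemann_sphere)"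
    using measurable_sphere_cutoff[of N] by (simp add: measurable_cong_sets[OF sets_normalized_vol refl])
  have "integrable (normalized_vol riemann_sphere) (\<lambda>x. cmod (sphere_cutoff N x) ^ 2)"
    using sphere_cutoff_bounded m by (intro integrable_const_bound[of _ 1]) (auto simp: power_le_one)
  moreover have "integrable (normalized_vol riemann_sphere) (\<lambda>x. (conorm_complex riemann_sphere (standard_structure riemann_sphere) x
      (differential riemann_sphere (sphere_cutoff N) x))\<^sup>2)"
    using integral_grad_sq_cutoff(1)[of N] by (simp add: grad_sq_def[abs_def])
  ultimately show ?thesis
    using continuous_map_sphere_cutoff measurable_sphere_cutoff weak_differential_sphere_cutoff
    unfolding continuous_sobolev_def sobolev_W1n_def by auto
qed

lemma energy_cutoff_pos: "0 < N \<Longrightarrow> 0 < energy riemann_sphere (standard_structure riemann_sphere) (sphere_cutoff N)"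
  using dirichlet_pos sphere_area_pos by (simp add: energy_sphere_cutoff)

lemma energy_cutoff_small:
  assumes e: "0 < e" shows "\<exists>N>0. energy riemann_sphere (standard_structure riemann_sphere) (sphere_cutoff N) < e"
proof -
  obtain N where N: "128 / (sphere_area * e\<^sup>2) < real N" using reals_Archimedean2 by blast
  have p: "0 < sphere_area * e\<^sup>2" using sphere_area_pos e by simp
  have "0 < 128 / (sphere_area * e\<^sup>2)" using p by simp
  then have N0: "0 < N" using N by (metis gr0I less_trans of_nat_0 less_irrefl)
  have "dirichlet N / sphere_area \<le> 128 / real N / sphere_area"
    using dirichlet_le[OF N0] sphere_area_pos by (intro divide_right_mono) auto
  also have "\<dots> < e\<^sup>2" using N N0 p sphere_area_pos by (simp add: field_simps)
  finally have "sqrt (dirichlet N / sphere_area) < e" using e by (intro real_less_lsqrt) auto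
  with N0 show ?thesis by (auto simp: energy_sphere_cutoff)
qed

section \<open>The cutoff separates the two branches\<close>

context small_parameter
begin

text \<open>
  The coded point is within 8 t of 1 or at distance at least 1/8 from 1, both in the coordinate 1/z,
  according to the first coin; the bound on t places it where the cutoff is 1 in the first case.
\<close>
lemma sphere_cutoff_coded:
  assumes N: "0 < N" "t \<le> 1 / 2 ^ (N + 9)"
  shows "sphere_cutoff N (sphere_param 1 (coded s)) = (if shd s then 1 else 0)"
proof (cases "shd s")
  case True
  let ?w = "coded s"
  have a: "cmod (1 - ?w) \<le> 8 * t" using coded_True[of s] True by simp
  have "cmod 1 \<le> cmod (1 - ?w) + cmod ?w" by (metis diff_add_cancel norm_triangle_ineq)
  then have h: "1 / 2 \<le> cmod ?w" using a t_small by simp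
  then have w0: "?w \<noteq> 0" by auto
  have "cmod (1 / ?w - 1) = cmod (1 - ?w) / cmod ?w"
    using w0 by (simp add: norm_divide[symmetric] diff_divide_distrib)
  also have "\<dots> \<le> 8 * t / (1 / 2)" using a h t_pos by (intro frac_le) auto
  \<comment> \<open>This is where the exponent N + 9 comes from: the factor 16 costs four powers of 2.\<close>
  also have "\<dots> \<le> 16 * (1 / 2 ^ (N + 9))" using N(2) by simp
  also have "\<dots> = 1 / 2 ^ (N + 5)" by (simp add: power_add)
  finally show ?thesis using True cutoff_near[OF N(1)] sphere_cutoff_param[of N 1 ?w] by simp
next
  case False
  let ?w = "coded s"
  have a: "1 / 8 \<le> cmod (1 - ?w)" using coded_False[of s] False by simp
  have "1 / 16 \<le> cmod (1 / ?w - 1)"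
  proof (cases "?w = 0")
    case w0: False
    show ?thesis
    proof (rule ccontr)
      assume c: "\<not> ?thesis"
      have e: "cmod (1 / ?w - 1) * cmod ?w = cmod (1 - ?w)"
        using w0 by (simp add: norm_mult[symmetric] left_diff_distrib)
      have "cmod ?w \<le> 4 / 3" by (rule coded_bound)
      then have "cmod (1 / ?w - 1) * cmod ?w \<le> 1 / 16 * (4 / 3)" using c by (intro mult_mono) auto
      then show False using a e by simp
    qed
  qed simp
  then show ?thesis using False cutoff_far(1) sphere_cutoff_param[of N 1 ?w] by simp
qed

lemma integral_coins_shd:
  fixes a b :: "'b::{banach, second_countable_topology}"
  shows "(LINT s|coins. (if shd s then a else b)) = (1 / 2) *\<^sub>R (a + b)"
proof -
  interpret prob_space coins by (rule prob_space_coins)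
  have S: "{s. shd s} \<in> sets coins"
    using measurable_sets[OF measurable_shd_coins, of "{True}"] by (simp add: vimage_def)
  have "emeasure coins {s. shd s} = (\<integral>\<^sup>+ s. indicator {s. shd s} s \<partial>coins)" using S by simp
  also have "\<dots> = ((\<integral>\<^sup>+ s. indicator {s. shd s} (False ## s) \<partial>coins) + (\<integral>\<^sup>+ s. indicator {s. shd s} (True ## s) \<partial>coins)) / 2"
    by (rule nn_integral_coins) (use S in simp)
  also have "\<dots> = 1 / 2" using emeasure_space_1 by simp
  finally have "ennreal (measure coins {s. shd s}) = ennreal (1 / 2)"
    using divide_ennreal[of 1 2] by (simp add: emeasure_eq_measure)
  then have m: "measure coins {s. shd s} = 1 / 2" by (subst (asm) ennreal_inj) auto
  have i: "integrable coins (indicator {s. shd s} :: _ \<Rightarrow> real)"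
    using S by (intro integrable_real_indicator) (simp_all add: emeasure_eq_measure)
  have i1: "integrable coins (\<lambda>s. b)" by (rule integrable_const)
  have i2: "integrable coins (\<lambda>s. indicator {s. shd s} s *\<^sub>R (a - b))" using i by (intro integrable_scaleR_left)
  have "(LINT s|coins. (if shd s then a else b)) = (LINT s|coins. b + indicator {s. shd s} s *\<^sub>R (a - b))"
    by (intro Bochner_Integration.integral_cong refl) (auto simp: indicator_def)
  also have "\<dots> = (LINT s|coins. b) + (LINT s|coins. indicator {s. shd s} s *\<^sub>R (a - b))"
    by (rule Bochner_Integration.integral_add[OF i1 i2])
  also have "(LINT s|coins. indicator {s. shd s} s *\<^sub>R (a - b)) = (1 / 2) *\<^sub>R (a - b)"
    using S m i by (subst integral_scaleR_left) auto
  also have "(LINT s|coins. b) = b" using prob_space by simp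
  also have "b + (1 / 2) *\<^sub>R (a - b) = (1 / 2) *\<^sub>R (a + b)"
  proof -
    have h: "b = (1 / 2) *\<^sub>R b + (1 / 2) *\<^sub>R b" by (simp add: scaleR_left_distrib[symmetric])
    have "x + x + (y - x) = y + x" for x y :: 'b by (simp add: algebra_simps)
    from this[of "(1 / 2) *\<^sub>R b" "(1 / 2) *\<^sub>R a"] show ?thesis
      unfolding h[symmetric] by (simp only: scaleR_diff_right scaleR_add_right)
  qed
  finally show ?thesis .
qed

lemma integral_mu_cutoff:
  fixes h :: "complex \<Rightarrow> 'b::{banach, second_countable_topology}"
  assumes N: "0 < N" "t \<le> 1 / 2 ^ (N + 9)" and h: "h \<in> borel_measurable borel"
  shows "(LINT x|\<mu>. h (sphere_cutoff N x)) = (1 / 2) *\<^sub>R (h 1 + h 0)"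
proof -
  have "(LINT x|\<mu>. h (sphere_cutoff N x)) = (LINT s|coins. h (sphere_cutoff N (sphere_param 1 (coded s))))"
    unfolding \<mu>_def by (rule integral_distr[OF measurable_coded_point measurable_compose[OF measurable_sphere_cutoff h]])
  also have "\<dots> = (LINT s|coins. (if shd s then h 1 else h 0))"
    by (intro Bochner_Integration.integral_cong refl) (simp only: sphere_cutoff_coded[OF N] if_distrib[of h])
  finally show ?thesis by (simp only: integral_coins_shd)
qed

text \<open>
  The cutoff takes the values 1 and 0 with probability 1/2 each, so it deviates from its mean by 1/2
  almost everywhere.
\<close>
lemma optimal_const_ge:
  assumes N: "0 < N" "t \<le> 1 / 2 ^ (N + 9)"
  shows "ereal (1 / 2 / energy riemann_sphere (standard_structure riemann_sphere) (sphere_cutoff N)) \<le> optimal_const f_num (f_den t)"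
proof -
  let ?E = "energy riemann_sphere (standard_structure riemann_sphere)"
  have mean: "(LINT y|\<mu>. sphere_cutoff N y) = 1 / 2"
    using integral_mu_cutoff[OF N, of "\<lambda>x. x"] by (simp add: scaleR_conv_of_real)
  have dev: "(LINT x|\<mu>. cmod (sphere_cutoff N x - (LINT y|\<mu>. sphere_cutoff N y))) = 1 / 2"
    using integral_mu_cutoff[OF N, of "\<lambda>x. cmod (x - 1 / 2)"] unfolding mean by (simp add: norm_divide)
  have "optimal_const f_num (f_den t) = (SUP \<phi>\<in>{\<phi> \<in> continuous_sobolev riemann_sphere. ?E \<phi> > 0}.
           ereal ((LINT x|\<mu>. cmod (\<phi> x - (LINT y|\<mu>. \<phi> y))) / ?E \<phi>))"
    using equilibrium_measure_f unfolding optimal_const_def Let_def rational_degree_f f_def[symmetric] by simp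
  moreover have "ereal (1 / 2 / ?E (sphere_cutoff N)) \<le> (SUP \<phi>\<in>{\<phi> \<in> continuous_sobolev riemann_sphere. ?E \<phi> > 0}.
           ereal ((LINT x|\<mu>. cmod (\<phi> x - (LINT y|\<mu>. \<phi> y))) / ?E \<phi>))"
  proof (rule SUP_upper2[of "sphere_cutoff N"])
    show "sphere_cutoff N \<in> {\<phi> \<in> continuous_sobolev riemann_sphere. ?E \<phi> > 0}"
      using sphere_cutoff_sobolev energy_cutoff_pos[OF N(1)] by blast
  qed (simp only: dev order_refl)
  ultimately show ?thesis by simp
qed

text \<open>
  The inequality is tested at k = 0 with both functions equal to the cutoff, whose variance is 1/4.
  Its supremum norm is at most 1.
\<close>
lemma correlation_lower_bound:
  assumes N: "0 < N" "t \<le> 1 / 2 ^ (N + 9)"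
    and c: "correlation_bound riemann_sphere 2 f (standard_structure riemann_sphere) \<mu> C"
  shows "1 / 4 \<le> C * energy riemann_sphere (standard_structure riemann_sphere) (sphere_cutoff N)"
proof -
  let ?E = "energy riemann_sphere (standard_structure riemann_sphere) (sphere_cutoff N)"
  interpret prob_space \<mu> by (rule prob_space_mu)
  have m: "sphere_cutoff N \<in> borel_measurable \<mu>"
    using measurable_sphere_cutoff[of N] by (simp add: measurable_cong_sets[OF sets_mu refl])
  have me: "(\<lambda>x. ereal (cmod (sphere_cutoff N x))) \<in> borel_measurable \<mu>" using m by simp
  have le: "esssup \<mu> (\<lambda>x. ereal (cmod (sphere_cutoff N x))) \<le> 1"
    by (rule esssup_I[OF me]) (use sphere_cutoff_bounded in \<open>auto simp: one_ereal_def\<close>)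
  have "esssup \<mu> (\<lambda>x. 0 :: ereal) \<le> esssup \<mu> (\<lambda>x. ereal (cmod (sphere_cutoff N x)))"
    by (rule esssup_mono) auto
  then have ge: "0 \<le> esssup \<mu> (\<lambda>x. ereal (cmod (sphere_cutoff N x)))"
    using esssup_const[of \<mu> "0 :: ereal"] emeasure_space_1 by simp
  have L: "sphere_cutoff N \<in> Linf \<mu>"
    unfolding Linf_def using m le by (auto intro: order_le_less_trans)
  let ?L = "Linf_norm \<mu> (sphere_cutoff N)"
  have L1: "0 \<le> ?L" "?L \<le> 1"
    using ge le unfolding Linf_norm_def by (cases "esssup \<mu> (\<lambda>x. ereal (cmod (sphere_cutoff N x)))"; simp add: one_ereal_def)+
  have i1: "(LINT x|\<mu>. sphere_cutoff N x) = 1 / 2"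
    using integral_mu_cutoff[OF N, of "\<lambda>x. x"] by (simp add: scaleR_conv_of_real)
  have i2: "(LINT x|\<mu>. sphere_cutoff N x * sphere_cutoff N x) = 1 / 2"
    using integral_mu_cutoff[OF N, of "\<lambda>x. x * x"] by (simp add: scaleR_conv_of_real)
  have "cmod ((LINT x|\<mu>. sphere_cutoff N x * sphere_cutoff N ((f ^^ 0) x)) - (LINT x|\<mu>. sphere_cutoff N x) * (LINT x|\<mu>. sphere_cutoff N x))
      \<le> C * real 2 powr (- real 0 / real (mdim riemann_sphere)) * ?E * ?L"
    using c[unfolded correlation_bound_def, rule_format, OF sphere_cutoff_sobolev[of N] L, of 0] .
  then have b: "1 / 4 \<le> C * ?E * ?L" by (simp add: i1 i2 norm_divide)
  have "0 \<le> C * ?E"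
  proof (rule ccontr)
    assume "\<not> ?thesis"
    then have "C * ?E * ?L \<le> 0" using L1(1) by (simp add: mult_nonpos_nonneg)
    then show False using b by simp
  qed
  then have "C * ?E * ?L \<le> C * ?E * 1" using L1(2) by (intro mult_left_mono)
  then show ?thesis using b by simp
qed

lemma AE_funpow_finite: "AE z in lborel. (f ^^ k) (Some z) \<noteq> None"
proof -
  have "finite (Some -` ((f ^^ k) -` {None}))" using finite_funpow_vimage by (rule finite_vimageI) simp
  then have "Some -` ((f ^^ k) -` {None}) \<in> null_sets lborel" by (rule finite_imp_null_set_lborel)
  then have "AE z in lborel. z \<notin> Some -` ((f ^^ k) -` {None})" by (rule AE_not_in)
  then show ?thesis by simp
qed

text \<open>
  The arguments 2, 1, 2 of C (dimension, dilatation, degree) are the same for all t.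
\<close>
lemma universal_constant_bound:
  assumes N: "0 < N" "t \<le> 1 / 2 ^ (N + 9)"
    and C: "\<forall>n K d (M :: complex option riem) f G \<mu>.
        n \<ge> 2 \<longrightarrow> d \<ge> 2 \<longrightarrow>
        closed_connected_oriented_riemannian M \<longrightarrow> mdim M = n \<longrightarrow>
        uniformly_quasiregular M K f \<longrightarrow> has_degree (mtop M) f d \<longrightarrow>
        conformal_structure M G \<longrightarrow> invariant_structure M f G \<longrightarrow>
        is_equilibrium_measure M d f \<mu> \<longrightarrow>
        correlation_bound M d f G \<mu> (C n K d)"
  shows "1 / 4 \<le> C 2 1 2 * energy riemann_sphere (standard_structure riemann_sphere) (sphere_cutoff N)"
proof (rule correlation_lower_bound[OF N])
  show "correlation_bound riemann_sphere 2 f (standard_structure riemann_sphere) \<mu> (C 2 1 2)"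
  proof (rule C[rule_format])
    show "closed_connected_oriented_riemannian riemann_sphere" by (rule closed_connected_oriented_riemannian_sphere)
    show "uniformly_quasiregular riemann_sphere 1 f"
      by (rule uniformly_quasiregular_sphere[OF sphere_holomorphic_f AE_funpow_finite])
    show "has_degree (mtop riemann_sphere) f 2" using has_degree_f by simp
    show "conformal_structure riemann_sphere (standard_structure riemann_sphere)" by (rule conformal_structure_standard)
    show "invariant_structure riemann_sphere f (standard_structure riemann_sphere)"
      by (rule invariant_structure_standard[OF sphere_holomorphic_f AE_funpow_finite])
    show "is_equilibrium_measure riemann_sphere 2 f \<mu>" by (rule is_equilibrium_measure_mu)
  qed simp_all
qed

end

text \<open>
  The parameters below this bound satisfy both the standing assumption on t and the one under which
  the N-th cutoff separates the two branches.
\<close>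
definition admissible :: "nat \<Rightarrow> real" where "admissible N = min (1 / 1000) (1 / 2 ^ (N + 9))"

lemma admissible_pos: "0 < admissible N"
  by (simp add: admissible_def)

theorem theorem1p4:
  shows "((\<lambda>t. optimal_const f_num (f_den t)) \<longlongrightarrow> \<infinity>) (at_right 0) \<and>
    (\<nexists>C :: nat \<Rightarrow> real \<Rightarrow> nat \<Rightarrow> real.
      \<forall>n K d (M :: complex option riem) f G \<mu>.
        n \<ge> 2 \<longrightarrow> d \<ge> 2 \<longrightarrow>
        closed_connected_oriented_riemannian M \<longrightarrow> mdim M = n \<longrightarrow>
        uniformly_quasiregular M K f \<longrightarrow> has_degree (mtop M) f d \<longrightarrow>
        conformal_structure M G \<longrightarrow> invariant_structure M f G \<longrightarrow>
        is_equilibrium_measure M d f \<mu> \<longrightarrow>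
        correlation_bound M d f G \<mu> (C n K d))"
proof
  let ?E = "\<lambda>N. energy riemann_sphere (standard_structure riemann_sphere) (sphere_cutoff N)"
  show "((\<lambda>t. optimal_const f_num (f_den t)) \<longlongrightarrow> \<infinity>) (at_right 0)"
    unfolding tendsto_PInfty
  proof
    fix r :: real
    have "0 < \<bar>r\<bar> + 1" by linarith
    then have "0 < 1 / (2 * (\<bar>r\<bar> + 1))" by simp
    then obtain N where N: "0 < N" "?E N < 1 / (2 * (\<bar>r\<bar> + 1))"
      using energy_cutoff_small by blast
    have "\<bar>r\<bar> + 1 < 1 / 2 / ?E N" using N(2) energy_cutoff_pos[OF N(1)] by (simp add: field_simps)
    then have r: "r < 1 / 2 / ?E N" by linarith
    have "ereal r < optimal_const f_num (f_den t)" if "0 < t" "t < admissible N" for t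
    proof -
      interpret small_parameter t by unfold_locales (use that in \<open>simp_all add: admissible_def\<close>)
      have "t \<le> 1 / 2 ^ (N + 9)" using that by (simp add: admissible_def)
      from optimal_const_ge[OF N(1) this] r show ?thesis by (meson ereal_less_eq(3) less_ereal.simps(1) order_less_le_trans)
    qed
    then show "\<forall>\<^sub>F t in at_right 0. ereal r < optimal_const f_num (f_den t)"
      using admissible_pos[of N] unfolding eventually_at_right_field by blast
  qed
  show "\<nexists>C :: nat \<Rightarrow> real \<Rightarrow> nat \<Rightarrow> real.
      \<forall>n K d (M :: complex option riem) f G \<mu>.
        n \<ge> 2 \<longrightarrow> d \<ge> 2 \<longrightarrow>
        closed_connected_oriented_riemannian M \<longrightarrow> mdim M = n \<longrightarrow>
        uniformly_quasiregular M K f \<longrightarrow> has_degree (mtop M) f d \<longrightarrow>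
        conformal_structure M G \<longrightarrow> invariant_structure M f G \<longrightarrow>
        is_equilibrium_measure M d f \<mu> \<longrightarrow>
        correlation_bound M d f G \<mu> (C n K d)"
  proof (rule notI, elim exE)
    fix C :: "nat \<Rightarrow> real \<Rightarrow> nat \<Rightarrow> real"
    assume C: "\<forall>n K d (M :: complex option riem) f G \<mu>.
        n \<ge> 2 \<longrightarrow> d \<ge> 2 \<longrightarrow>
        closed_connected_oriented_riemannian M \<longrightarrow> mdim M = n \<longrightarrow>
        uniformly_quasiregular M K f \<longrightarrow> has_degree (mtop M) f d \<longrightarrow>
        conformal_structure M G \<longrightarrow> invariant_structure M f G \<longrightarrow>
        is_equilibrium_measure M d f \<mu> \<longrightarrow>
        correlation_bound M d f G \<mu> (C n K d)"
    let ?c = "\<bar>C 2 1 2\<bar> + 1"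
    have c: "0 < ?c" by simp
    obtain N where N: "0 < N" "?E N < 1 / (4 * ?c)" using energy_cutoff_small[of "1 / (4 * ?c)"] c by auto
    interpret small_parameter "admissible N"
      by unfold_locales (use admissible_pos[of N] in \<open>simp_all add: admissible_def\<close>)
    have "1 / 4 \<le> C 2 1 2 * ?E N"
      by (rule universal_constant_bound[OF N(1) _ C]) (simp add: admissible_def)
    also have "\<dots> \<le> ?c * ?E N" using energy_cutoff_pos[OF N(1)] by (intro mult_right_mono) auto
    also have "\<dots> < ?c * (1 / (4 * ?c))" using N(2) c by (rule mult_strict_left_mono)
    also have "\<dots> = 1 / 4" using c by simp
    finally show False by simp
  qed
qed

end
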